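(* Consider immersed solutions of $$u^{1-p}(u_{\theta}^2+u^2)^{\frac{q-2}{2}}(u_{\theta\theta}+u)=1.\qquad(\ast)$$ (1) If $p\ge q$, all immersed solutions are constant. (2) If $(p,q)=(1,2)$, all immersed solutions have the form $u(\theta)=1+\lambda\cos(\theta-\theta_0)$, $\lambda\ge0$, $\theta_0\in[0,2\pi)$; if $(p,q)=(-2,-1)$, all immersed solutions have the form $u(\theta)=\frac{\sqrt{1-\mu^2\sin^2(\theta-\theta_0)}-\mu\cos(\theta-\theta_0)}{1-\mu^2}$, $0\le\mu<1$, $\theta_0\in[0,2\pi)$; if $(p,q)=(-2,2)$, all immersed solutions have the form $u(\theta)=\sqrt{\lambda^2\cos^2(\theta-\theta_0)+\lambda^{-2}\sin^2(\theta-\theta_0)}$, $\lambda>0$, $\theta_0\in[0,2\pi)$. (3) Let $m,n$ be coprime positive integers. If $p<q$ and $(p,q)\notin\{(1,2),(-2,-1),(-2,2)\}$, and $\frac{m}{n}$ lies strictly between $\sqrt{q-p}$ and $\Xi(p,q)$, then there exists a smooth, strictly locally convex, non-constant immersed solution of $(\ast)$ corresponding to a curve with total curvature $2\pi n$ and such that $u$ has $m$ maxima (per period $2\pi n$). Moreover, if in addition $(p,q)$ satisfies one of (i) $p\le-2$, $q\ge 2$; (ii) $p\le -2$, $q\le\frac{2p}{2-p}$; (iii) $q\ge 2$, $p\ge\frac{2q}{2+q}$; (iv) $p\ge -2$, $q\le 2$, $q\ge\frac{2p}{2-p}$, then there exists exactly one such solution up to rotation and scaling.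
   Context: An immersed solution of $(\ast)$ is a smooth positive function $u:\mathbb{R}\to(0,\infty)$, periodic of period $2\pi n$ for some positive integer $n$, satisfying $(\ast)$; it is the support function of a closed strictly locally convex immersed planar curve of total curvature $2\pi n$. Here $\Xi(p,q)=\frac{2(q-p)}{q}$ if $0\le p<q$, $\Xi(p,q)=2$ if $p<0<q$, and $\Xi(p,q)=\frac{2(p-q)}{p}$ if $p<q\le 0$. *)

theory Defs
  imports "HOL-Analysis.Analysis"
begin

definition smooth_fun :: "(real \<Rightarrow> real) \<Rightarrow> bool" where
  "smooth_fun u \<longleftrightarrow> (\<forall>k x. ((deriv ^^ k) u) differentiable (at x))"

definition solves_eq :: "real \<Rightarrow> real \<Rightarrow> (real \<Rightarrow> real) \<Rightarrow> bool" where
  "solves_eq p q u \<longleftrightarrow>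
     (\<forall>\<theta>. u \<theta> powr (1 - p) * ((deriv u \<theta>)\<^sup>2 + (u \<theta>)\<^sup>2) powr ((q - 2) / 2)
            * (deriv (deriv u) \<theta> + u \<theta>) = 1)"

definition periodic_with :: "real \<Rightarrow> (real \<Rightarrow> real) \<Rightarrow> bool" where
  "periodic_with T u \<longleftrightarrow> (\<forall>\<theta>. u (\<theta> + T) = u \<theta>)"

definition immersed_solution_n :: "real \<Rightarrow> real \<Rightarrow> nat \<Rightarrow> (real \<Rightarrow> real) \<Rightarrow> bool" where
  "immersed_solution_n p q n u \<longleftrightarrow>
     0 < n \<and> smooth_fun u \<and> (\<forall>\<theta>. 0 < u \<theta>) \<and> periodic_with (2 * pi * real n) u \<and> solves_eq p q u"

definition immersed_solution :: "real \<Rightarrow> real \<Rightarrow> (real \<Rightarrow> real) \<Rightarrow> bool" where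
  "immersed_solution p q u \<longleftrightarrow> (\<exists>n. immersed_solution_n p q n u)"

text \<open>The closed curve with support function u has total curvature 2 pi n:
  n is the least positive integer with u being 2 pi n-periodic.\<close>
definition total_curvature_index :: "(real \<Rightarrow> real) \<Rightarrow> nat \<Rightarrow> bool" where
  "total_curvature_index u n \<longleftrightarrow> 0 < n \<and> periodic_with (2 * pi * real n) u \<and>
     (\<forall>k. 0 < k \<and> k < n \<longrightarrow> \<not> periodic_with (2 * pi * real k) u)"

definition strictly_locally_convex :: "(real \<Rightarrow> real) \<Rightarrow> bool" where
  "strictly_locally_convex u \<longleftrightarrow> (\<forall>\<theta>. deriv (deriv u) \<theta> + u \<theta> > 0)"

definition is_constant_fun :: "(real \<Rightarrow> real) \<Rightarrow> bool" where
  "is_constant_fun u \<longleftrightarrow> (\<exists>c. \<forall>\<theta>. u \<theta> = c)"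

definition local_max_point :: "(real \<Rightarrow> real) \<Rightarrow> real \<Rightarrow> bool" where
  "local_max_point u x \<longleftrightarrow> (\<exists>e>0. \<forall>y. \<bar>y - x\<bar> < e \<longrightarrow> u y \<le> u x)"

definition num_maxima :: "(real \<Rightarrow> real) \<Rightarrow> nat \<Rightarrow> nat" where
  "num_maxima u n = card {x. 0 \<le> x \<and> x < 2 * pi * real n \<and> local_max_point u x}"

definition Xi :: "real \<Rightarrow> real \<Rightarrow> real" where
  "Xi p q = (if 0 \<le> p then 2 * (q - p) / q else if 0 < q then 2 else 2 * (p - q) / p)"

definition good_solution :: "real \<Rightarrow> real \<Rightarrow> nat \<Rightarrow> nat \<Rightarrow> (real \<Rightarrow> real) \<Rightarrow> bool" where
  "good_solution p q m n u \<longleftrightarrow>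
     immersed_solution_n p q n u \<and> strictly_locally_convex u \<and> \<not> is_constant_fun u \<and>
     total_curvature_index u n \<and> finite {x. 0 \<le> x \<and> x < 2 * pi * real n \<and> local_max_point u x} \<and>
     num_maxima u n = m"

end

theory Submission
  imports Defs "HOL-Real_Asymp.Real_Asymp"
begin

text \<open>
  With $w = u_\theta / u$ the equation becomes the autonomous system $u' = u w$,
  $w' = u^{p-q} (1 + w^2)^{1-q/2} - (1 + w^2)$, which has a first integral relating $u$ and
  $r = u \sqrt{1 + w^2}$. For $p < q$, $(r/u)^2$ is along each orbit a constant $e^H$ times a function
  $F(z) = (1 + B z)^{1/B} (1 - C z)^{1/C}$ of one real parameter $z$, where $B, C \ge 0$ depend only on $p, q$
  (three sign cases), and $u$ increases with $z$. Let $y$ be the signed square root of $1 - F(z)$ and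
  $\eta = y / z$. Parametrising the orbit by $y = E \cos t / \sqrt{1 + E^2 \cos^2 t}$,
  $w = - E \sin t / \sqrt{1 + E^2 \cos^2 t}$ with $1 + E^2 = e^H$ turns the period into
  a constant times the integral of $\eta(y) + \eta(-y)$ over $0 \le t \le \pi/2$.
  Since $\eta$ equals $\sqrt{(B + C)/2}$ at $0$ and tends to $C$ and $B$ at $1$ and $-1$, the period
  runs from $2 \pi / \sqrt{q - p}$ to $2 \pi / \Xi(p, q)$ as $E$ runs from $0$ to infinity. If
  $B, C \ge 1$ or $B, C \le 1$, and not $B = C = 1$, then $\eta(y) + \eta(-y)$ is strictly monotone in
  $y > 0$, hence so is the period in $E$; these conditions on $B, C$ are the four regions of the theorem.
\<close>

section \<open>The polar form of the equation\<close>

text \<open>In the coordinates (y, w) an orbit is the curve 1 + w^2 = (1 + E^2) (1 - y^2), which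
  involves neither p nor q; both enter only through the speed at which the angle runs along it. The
  period is thus the integral of a smooth positive function over a full turn, free of the
  singularities that quadrature in u has at its extrema. The speed is affine in eta and y, and
  folding the turn onto a quarter cancels the odd terms; hence only eta(y) + eta(-y) survives. The
  obstacle is that eta need not be monotone: its slope at 0 is (C - B) / 3. For the sum it suffices
  to compare the slopes at y and -y, so this constant may be subtracted from both, after which the
  comparison reduces to the sign of an affine function. The pairs (1, 2), (-2, -1), (-2, 2) are
  exactly those with B = C = 1. There the affine function vanishes identically and both end values
  of the period coincide, and the solutions are explicit.\<close>

definition polar_sol :: "real \<Rightarrow> real \<Rightarrow> (real \<Rightarrow> real) \<Rightarrow> (real \<Rightarrow> real) \<Rightarrow> bool" where
  "polar_sol p q u w \<longleftrightarrow> (\<forall>x. 0 < u x \<and> (u has_real_derivative u x * w x) (at x) \<and>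
     (w has_real_derivative u x powr (p - q) * (1 + (w x)\<^sup>2) powr (1 - q / 2) - (1 + (w x)\<^sup>2)) (at x))"

lemma polar_solD:
  assumes "polar_sol p q u w"
  shows "0 < u x" "(u has_real_derivative u x * w x) (at x)"
    "(w has_real_derivative u x powr (p - q) * (1 + (w x)\<^sup>2) powr (1 - q / 2) - (1 + (w x)\<^sup>2)) (at x)"
  using assms by (auto simp: polar_sol_def)

lemma one_plus_sq_pos: "0 < 1 + (x::real)\<^sup>2"
  by (intro add_pos_nonneg) auto

section \<open>Uniqueness for the initial value problem\<close>

lemma powr_bounded_Icc:
  fixes m M a :: real
  assumes "0 < m"
  obtains K where "0 \<le> K" "\<And>x. x \<in> {m..M} \<Longrightarrow> \<bar>x powr a\<bar> \<le> K"
proof -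
  have "continuous_on {m..M} (\<lambda>x. x powr a)"
    using assms by (intro continuous_intros) auto
  then have "bounded ((\<lambda>x. x powr a) ` {m..M})"
    by (intro compact_imp_bounded compact_continuous_image) auto
  then obtain K where K: "\<And>x. x \<in> {m..M} \<Longrightarrow> \<bar>x powr a\<bar> \<le> K"
    unfolding bounded_iff by (metis imageI real_norm_def)
  show thesis by (rule that[of "\<bar>K\<bar>"]) (use K in fastforce)+
qed

lemma powr_lipschitz_Icc:
  fixes m M a :: real
  assumes "0 < m"
  obtains K where "0 \<le> K" "\<And>x y. x \<in> {m..M} \<Longrightarrow> y \<in> {m..M} \<Longrightarrow> \<bar>x powr a - y powr a\<bar> \<le> K * \<bar>x - y\<bar>"
proof -
  obtain K where K: "0 \<le> K" "\<And>x. x \<in> {m..M} \<Longrightarrow> \<bar>x powr (a - 1)\<bar> \<le> K"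
    using powr_bounded_Icc[OF assms] by blast
  have "\<bar>x powr a - y powr a\<bar> \<le> (\<bar>a\<bar> * K) * \<bar>x - y\<bar>" if "x \<in> {m..M}" "y \<in> {m..M}" for x y
  proof -
    have "norm (x powr a - y powr a) \<le> (\<bar>a\<bar> * K) * norm (x - y)"
    proof (rule field_differentiable_bound[of "{m..M}" "\<lambda>x. x powr a" "\<lambda>x. a * x powr (a - 1)"])
      fix t assume t: "t \<in> {m..M}"
      then show "((\<lambda>x. x powr a) has_field_derivative a * t powr (a - 1)) (at t within {m..M})"
        using assms by (intro has_field_derivative_at_within[OF has_real_derivative_powr]) auto
      show "norm (a * t powr (a - 1)) \<le> \<bar>a\<bar> * K"
        using K(2)[OF t] by (simp add: abs_mult mult_left_mono)
    qed (use that in auto)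
    then show ?thesis by simp
  qed
  with K(1) show thesis by (intro that[of "\<bar>a\<bar> * K"]) auto
qed

lemma sq_powr_half: "0 < a \<Longrightarrow> (a\<^sup>2) powr (r / 2) = a powr r" for a r :: real
  by (simp add: powr_powr flip: powr_numeral)

text \<open>The weight exp(-K t) makes \<open>e\<close> nonincreasing to the right of
  \<open>a\<close>, and exp(K t) makes it nondecreasing to the left; with \<open>e a = 0\<close> and
  \<open>e\<close> nonnegative both force zero. The bound is on the absolute value of the derivative
  because both directions are needed.\<close>

lemma gronwall_zero:
  fixes e e' :: "real \<Rightarrow> real"
  assumes d: "\<And>t. t \<in> {a-R..a+R} \<Longrightarrow> (e has_real_derivative e' t) (at t)"
    and bd: "\<And>t. t \<in> {a-R..a+R} \<Longrightarrow> \<bar>e' t\<bar> \<le> K * e t"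
    and nn: "\<And>t. t \<in> {a-R..a+R} \<Longrightarrow> 0 \<le> e t" and "e a = 0" and t: "t \<in> {a-R..a+R}"
  shows "e t = 0"
proof (cases "a \<le> t")
  case True
  have "e t * exp (- K * t) \<le> e a * exp (- K * a)"
  proof (rule DERIV_nonpos_imp_nonincreasing[OF True])
    fix x assume "a \<le> x" "x \<le> t"
    then have x: "x \<in> {a-R..a+R}" using t by auto
    have "((\<lambda>x. e x * exp (- K * x)) has_real_derivative e' x * exp (- K * x) + (exp (- K * x) * - K) * e x) (at x)"
      by (intro DERIV_mult d x) (auto intro!: derivative_eq_intros)
    moreover have "e' x * exp (- K * x) + (exp (- K * x) * - K) * e x = (e' x - K * e x) * exp (- K * x)"
      by (simp add: algebra_simps)
    moreover have "(e' x - K * e x) * exp (- K * x) \<le> 0"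
      using bd[OF x] by (intro mult_nonpos_nonneg) auto
    ultimately show "\<exists>y. ((\<lambda>x. e x * exp (- K * x)) has_real_derivative y) (at x) \<and> y \<le> 0" by metis
  qed
  with \<open>e a = 0\<close> nn[OF t] show ?thesis by (simp add: mult_le_0_iff)
next
  case False
  then have "t \<le> a" by simp
  have "e t * exp (K * t) \<le> e a * exp (K * a)"
  proof (rule DERIV_nonneg_imp_nondecreasing[OF \<open>t \<le> a\<close>])
    fix x assume "t \<le> x" "x \<le> a"
    then have x: "x \<in> {a-R..a+R}" using t by auto
    have "((\<lambda>x. e x * exp (K * x)) has_real_derivative e' x * exp (K * x) + (exp (K * x) * K) * e x) (at x)"
      by (intro DERIV_mult d x) (auto intro!: derivative_eq_intros)
    moreover have "e' x * exp (K * x) + (exp (K * x) * K) * e x = (e' x + K * e x) * exp (K * x)"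
      by (simp add: algebra_simps)
    moreover have "0 \<le> (e' x + K * e x) * exp (K * x)"
      using bd[OF x] by (intro mult_nonneg_nonneg) auto
    ultimately show "\<exists>y. ((\<lambda>x. e x * exp (K * x)) has_real_derivative y) (at x) \<and> 0 \<le> y" by metis
  qed
  with \<open>e a = 0\<close> nn[OF t] show ?thesis by (simp add: mult_le_0_iff)
qed

lemma abs_mult_diff_le:
  fixes a b c d :: real
  assumes "\<bar>b\<bar> \<le> K" "\<bar>c\<bar> \<le> K" "\<bar>a - c\<bar> \<le> L * s" "\<bar>b - d\<bar> \<le> L * s"
  shows "\<bar>a * b - c * d\<bar> \<le> 2 * K * L * s"
proof -
  have "a * b - c * d = (a - c) * b + c * (b - d)" by (simp add: algebra_simps)
  then have "\<bar>a * b - c * d\<bar> \<le> \<bar>a - c\<bar> * \<bar>b\<bar> + \<bar>c\<bar> * \<bar>b - d\<bar>"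
    by (metis abs_mult abs_triangle_ineq)
  also have "\<dots> \<le> (L * s) * K + K * (L * s)"
    using assms by (intro add_mono mult_mono) auto
  finally show ?thesis by (simp add: algebra_simps)
qed

text \<open>On a compact interval both solutions stay in a compact part of the half plane
  \<open>u > 0\<close>, where the right-hand side is Lipschitz although the powers of
  \<open>u\<close> may be singular at 0. Gronwall then applies to the squared distance of the two
  phase points.\<close>

lemma polar_sol_unique:
  assumes u: "polar_sol p q u w" and v: "polar_sol p q v z" and eq: "u a = v a" "w a = z a"
  shows "u x = v x"
proof -
  note U = polar_solD[OF u] and V = polar_solD[OF v]
  define R where "R = \<bar>x - a\<bar> + 1"
  define I where "I = {a-R..a+R}"
  have x: "x \<in> I" by (auto simp: I_def R_def)
  have cont: "continuous_on I u" "continuous_on I v" "continuous_on I w" "continuous_on I z"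
    using U V by (auto intro!: continuous_at_imp_continuous_on DERIV_isCont)
  have I: "compact I" "I \<noteq> {}" using x by (auto simp: I_def)
  have lower: "\<exists>m>0. \<forall>t\<in>I. m \<le> f t" if "continuous_on I f" "\<And>t. 0 < f t" for f :: "real \<Rightarrow> real"
    using continuous_attains_inf[OF I that(1)] that(2) by blast
  have upper: "\<exists>M>0. \<forall>t\<in>I. \<bar>f t\<bar> \<le> M" if "continuous_on I f" for f :: "real \<Rightarrow> real"
    using compact_imp_bounded[OF compact_continuous_image[OF that I(1)]] unfolding bounded_pos by auto
  obtain m1 m2 where m: "0 < m1" "\<And>t. t \<in> I \<Longrightarrow> m1 \<le> u t" "0 < m2" "\<And>t. t \<in> I \<Longrightarrow> m2 \<le> v t"
    using lower[OF cont(1) U(1)] lower[OF cont(2) V(1)] by blast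
  obtain M1 M2 M3 M4 where M: "0 < M1" "\<And>t. t \<in> I \<Longrightarrow> \<bar>u t\<bar> \<le> M1" "0 < M2" "\<And>t. t \<in> I \<Longrightarrow> \<bar>v t\<bar> \<le> M2"
     "0 < M3" "\<And>t. t \<in> I \<Longrightarrow> \<bar>w t\<bar> \<le> M3" "0 < M4" "\<And>t. t \<in> I \<Longrightarrow> \<bar>z t\<bar> \<le> M4"
    using cont[THEN upper] by blast
  define lo where "lo = min m1 m2"
  define M where "M = max (max M1 M2) (max M3 M4)"
  have M': "0 < M" "0 < lo" using M m by (auto simp: M_def lo_def)
  have bd: "u t \<in> {lo..M}" "v t \<in> {lo..M}" "\<bar>u t\<bar> \<le> M" "\<bar>v t\<bar> \<le> M" "\<bar>w t\<bar> \<le> M" "\<bar>z t\<bar> \<le> M" if "t \<in> I" for t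
    using m(2)[OF that] m(4)[OF that] M(2)[OF that] M(4)[OF that] M(6)[OF that] M(8)[OF that]
    by (auto simp: lo_def M_def)
  have sqb: "1 + s\<^sup>2 \<in> {1..1 + M\<^sup>2}" if "\<bar>s\<bar> \<le> M" for s
    using that abs_le_square_iff[of s M] M' by auto
  obtain K1 where K1: "0 \<le> K1" "\<And>x. x \<in> {lo..M} \<Longrightarrow> \<bar>x powr (p - q)\<bar> \<le> K1"
    using powr_bounded_Icc[OF M'(2)] by blast
  obtain K2 where K2: "0 \<le> K2" "\<And>x. x \<in> {1..1 + M\<^sup>2} \<Longrightarrow> \<bar>x powr (1 - q / 2)\<bar> \<le> K2"
    using powr_bounded_Icc[of 1] by auto
  obtain L1 where L1: "0 \<le> L1" "\<And>x y. x \<in> {lo..M} \<Longrightarrow> y \<in> {lo..M} \<Longrightarrow> \<bar>x powr (p - q) - y powr (p - q)\<bar> \<le> L1 * \<bar>x - y\<bar>"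
    using powr_lipschitz_Icc[OF M'(2)] by blast
  obtain L2 where L2: "0 \<le> L2" "\<And>x y. x \<in> {1..1 + M\<^sup>2} \<Longrightarrow> y \<in> {1..1 + M\<^sup>2} \<Longrightarrow>
      \<bar>x powr (1 - q / 2) - y powr (1 - q / 2)\<bar> \<le> L2 * \<bar>x - y\<bar>"
    using powr_lipschitz_Icc[of 1] by auto
  define K where "K = max K1 K2"
  define L where "L = L1 + L2 * (2 * M)"
  have KL: "0 \<le> K" "0 \<le> L" using K1 L1 L2 M' by (auto simp: K_def L_def)
  define F where "F r s = r powr (p - q) * (1 + s\<^sup>2) powr (1 - q / 2) - (1 + s\<^sup>2)" for r s :: real
  define e where "e t = (u t - v t)\<^sup>2 + (w t - z t)\<^sup>2" for t
  define e' where "e' t = 2 * ((u t - v t) * (u t * w t - v t * z t)) + 2 * ((w t - z t) * (F (u t) (w t) - F (v t) (z t)))" for t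
  define G where "G = 2 * M + (2 * K * L + 2 * M)"
  have G: "0 \<le> G" using M' KL by (simp add: G_def)
  have "e x = 0"
  proof (rule gronwall_zero[where e = e and e' = e' and t = x and K = "4 * G" and a = a and R = R])
    fix t assume "t \<in> {a-R..a+R}"
    then have t: "t \<in> I" by (simp add: I_def)
    show "(e has_real_derivative e' t) (at t)"
      unfolding e_def e'_def F_def
      by (rule derivative_eq_intros U V refl)+ (simp add: algebra_simps)
    \<comment> \<open>The sum of distances suits the Lipschitz bounds; it is converted back by
      \<open>s\<^sup>2 \<le> 2 * e t\<close>, whence the constant \<open>4 * G\<close>.\<close>
    define s where "s = \<bar>u t - v t\<bar> + \<bar>w t - z t\<bar>"
    have s: "0 \<le> s" "\<bar>u t - v t\<bar> \<le> s" "\<bar>w t - z t\<bar> \<le> s" by (auto simp: s_def)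
    have 1: "\<bar>u t * w t - v t * z t\<bar> \<le> 2 * M * s"
      using abs_mult_diff_le[of "w t" M "v t" "u t" 1 s "z t"] bd[OF t] s by simp
    have sq: "\<bar>(1 + (w t)\<^sup>2) - (1 + (z t)\<^sup>2)\<bar> \<le> 2 * M * s"
      using abs_mult_diff_le[of "w t" M "z t" "w t" 1 s "z t"] bd[OF t] s by (simp add: power2_eq_square)
    have "\<bar>u t powr (p - q) * (1 + (w t)\<^sup>2) powr (1 - q / 2) - v t powr (p - q) * (1 + (z t)\<^sup>2) powr (1 - q / 2)\<bar> \<le> 2 * K * L * s"
    proof (rule abs_mult_diff_le)
      show "\<bar>(1 + (w t)\<^sup>2) powr (1 - q / 2)\<bar> \<le> K" "\<bar>v t powr (p - q)\<bar> \<le> K"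
        using K1(2)[of "v t"] K2(2)[OF sqb[of "w t"]] bd[OF t] by (auto simp: K_def)
      have "\<bar>u t powr (p - q) - v t powr (p - q)\<bar> \<le> L1 * \<bar>u t - v t\<bar>"
        using L1(2) bd[OF t] by blast
      also have "\<dots> \<le> L * s"
        using L1 L2 M' s by (intro mult_mono) (auto simp: L_def)
      finally show "\<bar>u t powr (p - q) - v t powr (p - q)\<bar> \<le> L * s" .
      have "\<bar>(1 + (w t)\<^sup>2) powr (1 - q / 2) - (1 + (z t)\<^sup>2) powr (1 - q / 2)\<bar> \<le> L2 * \<bar>(1 + (w t)\<^sup>2) - (1 + (z t)\<^sup>2)\<bar>"
        using L2(2) sqb bd[OF t] by blast
      also have "\<dots> \<le> L2 * (2 * M * s)" using L2(1) sq by (intro mult_left_mono) auto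
      also have "\<dots> \<le> L * s" using L1 s by (simp add: L_def algebra_simps)
      finally show "\<bar>(1 + (w t)\<^sup>2) powr (1 - q / 2) - (1 + (z t)\<^sup>2) powr (1 - q / 2)\<bar> \<le> L * s" .
    qed
    with sq have 2: "\<bar>F (u t) (w t) - F (v t) (z t)\<bar> \<le> (2 * K * L + 2 * M) * s"
      unfolding F_def distrib_right by linarith
    have "\<bar>e' t\<bar> \<le> 2 * (\<bar>u t - v t\<bar> * \<bar>u t * w t - v t * z t\<bar>) + 2 * (\<bar>w t - z t\<bar> * \<bar>F (u t) (w t) - F (v t) (z t)\<bar>)"
      unfolding e'_def by (rule order_trans[OF abs_triangle_ineq]) (simp add: abs_mult)
    also have "\<dots> \<le> 2 * (s * (2 * M * s)) + 2 * (s * ((2 * K * L + 2 * M) * s))"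
      using 1 2 s by (intro add_mono mult_mono) auto
    also have "\<dots> = 2 * G * s\<^sup>2" by (simp add: G_def algebra_simps power2_eq_square)
    also have "\<dots> \<le> 4 * G * e t"
    proof -
      have "s\<^sup>2 \<le> 2 * e t"
        using zero_le_power2[of "\<bar>u t - v t\<bar> - \<bar>w t - z t\<bar>"]
        by (simp add: s_def e_def power2_sum power2_diff)
      from mult_left_mono[OF this G] show ?thesis by simp
    qed
    finally show "\<bar>e' t\<bar> \<le> 4 * G * e t" .
    show "0 \<le> e t" by (simp add: e_def)
  qed (use eq x in \<open>auto simp: e_def I_def\<close>)
  then show ?thesis by (simp add: e_def add_nonneg_eq_0_iff)
qed

section \<open>Smoothness of solutions\<close>

text \<open>The functions obtained from a solution by differentiating repeatedly all lie in this algebra.\<close>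

inductive polar_alg :: "(real \<Rightarrow> real) \<Rightarrow> (real \<Rightarrow> real) \<Rightarrow> (real \<Rightarrow> real) \<Rightarrow> bool" for u w where
  const: "polar_alg u w (\<lambda>x. c)"
| slope: "polar_alg u w w"
| powr_u: "polar_alg u w (\<lambda>x. u x powr a)"
| powr_w: "polar_alg u w (\<lambda>x. (1 + (w x)\<^sup>2) powr a)"
| add: "polar_alg u w f \<Longrightarrow> polar_alg u w g \<Longrightarrow> polar_alg u w (\<lambda>x. f x + g x)"
| mult: "polar_alg u w f \<Longrightarrow> polar_alg u w g \<Longrightarrow> polar_alg u w (\<lambda>x. f x * g x)"

text \<open>The generators are chosen so that their derivatives are again polynomials in them: the
  system supplies the derivative of \<open>w\<close>, and u^a differentiates to a u^a w. Iteration
  gives derivatives of every order without computing any.\<close>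

lemma polar_alg_deriv:
  assumes s: "polar_sol p q u w" and f: "polar_alg u w f"
  shows "\<exists>f'. polar_alg u w f' \<and> (\<forall>x. (f has_real_derivative f' x) (at x))"
proof -
  note U = polar_solD[OF s]
  \<comment> \<open>A product and the constant -1 stand in for the square and the subtraction, which
    are not among the formation rules.\<close>
  have w': "polar_alg u w (\<lambda>x. u x powr (p - q) * (1 + (w x)\<^sup>2) powr (1 - q / 2) + (- 1) * (1 + w x * w x))"
    by (intro polar_alg.intros)
  have dw: "(w has_real_derivative u x powr (p - q) * (1 + (w x)\<^sup>2) powr (1 - q / 2) + (- 1) * (1 + w x * w x)) (at x)" for x
    using U(3)[of x] by (simp add: power2_eq_square algebra_simps)
  show ?thesis
    using f
  proof induction
    case (const c)
    show ?case by (rule exI[of _ "\<lambda>x. 0"]) (auto intro: polar_alg.intros)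
  next
    case slope
    show ?case using w' dw by blast
  next
    case (powr_u a)
    have "((\<lambda>x. u x powr a) has_real_derivative (a * u x powr a) * w x) (at x)" for x
    proof -
      have "((\<lambda>x. u x powr a) has_real_derivative (a * u x powr (a - 1)) * (u x * w x)) (at x)"
        using U(1)[of x] by (intro DERIV_chain2[where f = "\<lambda>x. x powr a", OF _ U(2)] has_real_derivative_powr)
      moreover have "u x powr a = u x powr (a - 1) * u x"
        using U(1)[of x] by (simp add: powr_mult_base mult.commute)
      ultimately show ?thesis by (simp add: mult_ac)
    qed
    then show ?case by (intro exI[of _ "\<lambda>x. (a * u x powr a) * w x"]) (auto intro!: polar_alg.intros)
  next
    case (powr_w a)
    have "((\<lambda>x. (1 + (w x)\<^sup>2) powr a) has_real_derivative (a * (1 + (w x)\<^sup>2) powr (a - 1)) * ((2 * w x) *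
       (u x powr (p - q) * (1 + (w x)\<^sup>2) powr (1 - q / 2) + (- 1) * (1 + w x * w x)))) (at x)" for x
      using one_plus_sq_pos
      by (intro DERIV_chain2[where f = "\<lambda>x. x powr a"] has_real_derivative_powr)
         (auto intro!: derivative_eq_intros dw)
    moreover have "polar_alg u w (\<lambda>x. (a * (1 + (w x)\<^sup>2) powr (a - 1)) * ((2 * w x) *
       (u x powr (p - q) * (1 + (w x)\<^sup>2) powr (1 - q / 2) + (- 1) * (1 + w x * w x))))"
      by (intro polar_alg.intros)
    ultimately show ?case by blast
  next
    case (add f g)
    then obtain f' g' where *: "polar_alg u w f'" "\<forall>x. (f has_real_derivative f' x) (at x)"
      "polar_alg u w g'" "\<forall>x. (g has_real_derivative g' x) (at x)" by blast
    then show ?case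
      by (intro exI[of _ "\<lambda>x. f' x + g' x"]) (auto intro!: polar_alg.intros DERIV_add)
  next
    case (mult f g)
    then obtain f' g' where *: "polar_alg u w f'" "\<forall>x. (f has_real_derivative f' x) (at x)"
      "polar_alg u w g'" "\<forall>x. (g has_real_derivative g' x) (at x)" by blast
    then show ?case
      using mult.hyps
      by (intro exI[of _ "\<lambda>x. f' x * g x + g' x * f x"]) (auto intro!: polar_alg.intros DERIV_mult)
  qed
qed

lemma polar_sol_smooth:
  assumes s: "polar_sol p q u w"
  shows "smooth_fun u"
proof -
  have step: "polar_alg u w (deriv f)" "f differentiable (at x)" if f: "polar_alg u w f" for f x
  proof -
    obtain f' where f': "polar_alg u w f'" "\<And>x. (f has_real_derivative f' x) (at x)"
      using polar_alg_deriv[OF s f] by blast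
    then have "deriv f = f'" by (intro ext DERIV_imp_deriv)
    with f' show "polar_alg u w (deriv f)" "f differentiable (at x)"
      by (auto simp: real_differentiable_def)
  qed
  have "(\<lambda>x. u x powr 1) = u" using polar_solD(1)[OF s] by (auto simp: fun_eq_iff less_imp_le)
  with polar_alg.powr_u[of u w 1] have u: "polar_alg u w u" by simp
  have "polar_alg u w ((deriv ^^ k) u)" for k
    by (induction k) (auto simp: u step)
  with step show ?thesis by (auto simp: smooth_fun_def)
qed

section \<open>Equivalence with the original equation\<close>

lemma polar_sol_solves:
  assumes s: "polar_sol p q u w"
  shows "solves_eq p q u" "strictly_locally_convex u"
proof -
  note U = polar_solD[OF s]
  have u': "deriv u = (\<lambda>x. u x * w x)" using U(2) by (intro ext DERIV_imp_deriv)
  have conv: "deriv (deriv u) x + u x = u x * (u x powr (p - q) * (1 + (w x)\<^sup>2) powr (1 - q / 2))" for x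
  proof -
    have "deriv (deriv u) x = u x * w x * w x + (u x powr (p - q) * (1 + (w x)\<^sup>2) powr (1 - q / 2) - (1 + (w x)\<^sup>2)) * u x"
      unfolding u' by (intro DERIV_imp_deriv DERIV_mult U)
    then show ?thesis by (simp add: algebra_simps power2_eq_square)
  qed
  then show "strictly_locally_convex u"
    using U(1) one_plus_sq_pos by (simp add: strictly_locally_convex_def less_imp_neq[symmetric])
  show "solves_eq p q u"
    unfolding solves_eq_def
  proof
    fix x
    have p: "0 < u x" "0 < 1 + (w x)\<^sup>2" using U(1) one_plus_sq_pos by auto
    have "(deriv u x)\<^sup>2 + (u x)\<^sup>2 = (u x)\<^sup>2 * (1 + (w x)\<^sup>2)"
      by (simp add: u' algebra_simps power2_eq_square)
    also have "\<dots> powr ((q - 2) / 2) = u x powr (q - 2) * (1 + (w x)\<^sup>2) powr ((q - 2) / 2)"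
      using p by (simp add: powr_mult sq_powr_half)
    finally have r: "((deriv u x)\<^sup>2 + (u x)\<^sup>2) powr ((q - 2) / 2) = u x powr (q - 2) * (1 + (w x)\<^sup>2) powr ((q - 2) / 2)" .
    have "u x powr (1 - p) * (u x powr (q - 2) * (1 + (w x)\<^sup>2) powr ((q - 2) / 2)) * (u x * (u x powr (p - q) * (1 + (w x)\<^sup>2) powr (1 - q / 2)))
       = (u x powr (1 - p) * u x powr (q - 2) * u x powr 1 * u x powr (p - q)) * ((1 + (w x)\<^sup>2) powr ((q - 2) / 2) * (1 + (w x)\<^sup>2) powr (1 - q / 2))"
      using p by (simp add: mult_ac)
    also have "\<dots> = u x powr ((1 - p) + (q - 2) + 1 + (p - q)) * (1 + (w x)\<^sup>2) powr ((q - 2) / 2 + (1 - q / 2))"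
      by (simp only: powr_add)
    also have "\<dots> = 1"
    proof -
      have "(1 - p) + (q - 2) + 1 + (p - q) = 0" "(q - 2) / 2 + (1 - q / 2) = 0" by (auto simp: field_simps)
      with p show ?thesis by simp
    qed
    finally show "u x powr (1 - p) * ((deriv u x)\<^sup>2 + (u x)\<^sup>2) powr ((q - 2) / 2) * (deriv (deriv u) x + u x) = 1"
      unfolding r conv .
  qed
qed

text \<open>Since u_theta^2 + u^2 = u^2 (1 + w^2), dividing the equation by powers isolates (u'' +
  u) / u, and w' is this quotient minus 1 + w^2.\<close>

lemma immersed_polar_sol:
  assumes "immersed_solution_n p q n u"
  shows "polar_sol p q u (\<lambda>x. deriv u x / u x)"
proof -
  have pos: "0 < u x" for x using assms by (simp add: immersed_solution_n_def)
  have sm: "((deriv ^^ k) u) differentiable (at x)" for k x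
    using assms by (simp add: immersed_solution_n_def smooth_fun_def)
  have d1: "(u has_real_derivative deriv u x) (at x)" for x
    using sm[of 0 x] by (simp add: DERIV_deriv_iff_real_differentiable)
  have d2: "(deriv u has_real_derivative deriv (deriv u) x) (at x)" for x
    using sm[of 1 x] by (simp add: DERIV_deriv_iff_real_differentiable)
  have eq: "(deriv (deriv u) x + u x) / u x = u x powr (p - q) * (1 + (deriv u x / u x)\<^sup>2) powr (1 - q / 2)" for x
  proof -
    define W where "W = 1 + (deriv u x / u x)\<^sup>2"
    have W: "0 < W" unfolding W_def by (rule one_plus_sq_pos)
    have "(deriv u x)\<^sup>2 + (u x)\<^sup>2 = (u x)\<^sup>2 * W"
      using pos[of x] by (simp add: W_def field_simps power2_eq_square)
    also have "\<dots> powr ((q - 2) / 2) = u x powr (q - 2) * W powr ((q - 2) / 2)"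
      using W pos[of x] by (simp add: powr_mult sq_powr_half)
    finally have r: "((deriv u x)\<^sup>2 + (u x)\<^sup>2) powr ((q - 2) / 2) = u x powr (q - 2) * W powr ((q - 2) / 2)" .
    have "u x powr (1 - p) * (u x powr (q - 2) * W powr ((q - 2) / 2)) * (deriv (deriv u) x + u x) = 1"
      using assms r unfolding immersed_solution_n_def solves_eq_def by metis
    then have one: "u x powr (1 - p) * u x powr (q - 2) * W powr ((q - 2) / 2) * (deriv (deriv u) x + u x) = 1"
      by (simp add: mult.assoc)
    have "u x powr (p - q) * W powr (1 - q / 2) =
       (u x powr (p - q) * W powr (1 - q / 2)) * (u x powr (1 - p) * u x powr (q - 2) * W powr ((q - 2) / 2) * (deriv (deriv u) x + u x))"
      unfolding one by simp
    also have "\<dots> = (u x powr (p - q) * u x powr (1 - p) * u x powr (q - 2)) * (W powr (1 - q / 2) * W powr ((q - 2) / 2)) * (deriv (deriv u) x + u x)"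
      by (simp add: mult_ac)
    also have "\<dots> = u x powr ((p - q) + (1 - p) + (q - 2)) * W powr ((1 - q / 2) + (q - 2) / 2) * (deriv (deriv u) x + u x)"
      by (simp only: powr_add)
    also have "\<dots> = (deriv (deriv u) x + u x) / u x"
    proof -
      have "(p - q) + (1 - p) + (q - 2) = - 1" "(1 - q / 2) + (q - 2) / 2 = 0" by (auto simp: field_simps)
      with W pos[of x] show ?thesis by (simp add: powr_minus field_simps)
    qed
    finally show ?thesis by (simp add: W_def)
  qed
  have "((\<lambda>x. deriv u x / u x) has_real_derivative
      u x powr (p - q) * (1 + (deriv u x / u x)\<^sup>2) powr (1 - q / 2) - (1 + (deriv u x / u x)\<^sup>2)) (at x)" for x
  proof -
    have "((\<lambda>x. deriv u x / u x) has_real_derivative (deriv (deriv u) x * u x - deriv u x * deriv u x) / (u x * u x)) (at x)"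
      using pos[of x] by (intro DERIV_divide d1 d2) simp
    moreover have "(deriv (deriv u) x * u x - deriv u x * deriv u x) / (u x * u x) = (deriv (deriv u) x + u x) / u x - (1 + (deriv u x / u x)\<^sup>2)"
      using pos[of x] by (simp add: field_simps power2_eq_square)
    ultimately show ?thesis unfolding eq by simp
  qed
  then show ?thesis
    unfolding polar_sol_def using pos d1 by (simp add: less_imp_neq[symmetric])
qed

lemma polar_sol_immersed:
  assumes "polar_sol p q u w" "0 < n" "periodic_with (2 * pi * real n) u"
  shows "immersed_solution_n p q n u"
  using assms polar_sol_smooth polar_sol_solves(1) polar_solD(1) by (auto simp: immersed_solution_n_def)

section \<open>The one-parameter profile\<close>

text \<open>The value at \<open>a = 0\<close> is the limit; it lets the exponents \<open>p = 0\<close> and \<open>q = 0\<close> be treated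
  together with the others.\<close>

definition slog :: "real \<Rightarrow> real \<Rightarrow> real" where
  "slog a t = (if a = 0 then t else ln (1 + a * t) / a)"

lemma slog_0 [simp]: "slog a 0 = 0"
  by (simp add: slog_def)

lemma slog_deriv:
  assumes "0 < 1 + a * t"
  shows "(slog a has_real_derivative 1 / (1 + a * t)) (at t)"
proof (cases "a = 0")
  case True
  then have "slog a = (\<lambda>t. t)" by (auto simp: slog_def)
  with True show ?thesis by simp
next
  case False
  then have eq: "slog a = (\<lambda>t. ln (1 + a * t) / a)" by (auto simp: slog_def)
  show ?thesis unfolding eq
    using assms False by (auto intro!: derivative_eq_intros)
qed

lemma mult_slog: "0 < 1 + a * t \<Longrightarrow> a * slog a t = ln (1 + a * t)"
  by (auto simp: slog_def)

definition wdom :: "real \<Rightarrow> real \<Rightarrow> real set" where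
  "wdom B C = {z. 0 < 1 + B * z \<and> 0 < 1 - C * z}"

definition lwell :: "real \<Rightarrow> real \<Rightarrow> real \<Rightarrow> real" where
  "lwell B C z = slog B z + slog C (- z)"

text \<open>The function F of the overview. Going through \<open>slog\<close> keeps it meaningful
  for B = 0 or C = 0, where a factor becomes an exponential.\<close>

definition well :: "real \<Rightarrow> real \<Rightarrow> real \<Rightarrow> real" where
  "well B C z = exp (lwell B C z)"

text \<open>Not the derivative of \<open>well\<close>: it is the denominator in the logarithmic
  derivative - (B + C) z / \<open>dwell B C z\<close>.\<close>

definition dwell :: "real \<Rightarrow> real \<Rightarrow> real \<Rightarrow> real" where
  "dwell B C z = (1 + B * z) * (1 - C * z)"

lemma well_pos [simp]: "0 < well B C z" by (simp add: well_def)

lemma lwell_0 [simp]: "lwell B C 0 = 0" by (simp add: lwell_def)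
lemma well_0 [simp]: "well B C 0 = 1" by (simp add: well_def)
lemma dwell_0 [simp]: "dwell B C 0 = 1" by (simp add: dwell_def)
lemma zero_in_wdom [simp]: "0 \<in> wdom B C" by (simp add: wdom_def)

text \<open>Reflection in z exchanges B and C. Through this symmetry statements about negative z,
  and about y near -1, reduce to positive ones for the swapped pair.\<close>

lemma lwell_uminus: "lwell B C (- z) = lwell C B z"
  by (simp add: lwell_def)
lemma well_uminus: "well B C (- z) = well C B z"
  by (simp add: well_def lwell_uminus)
lemma wdom_uminus: "- z \<in> wdom B C \<longleftrightarrow> z \<in> wdom C B"
  by (auto simp: wdom_def)

lemma dwell_pos: "z \<in> wdom B C \<Longrightarrow> 0 < dwell B C z"
  by (simp add: wdom_def dwell_def)

lemma open_wdom: "open (wdom B C)"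
  unfolding wdom_def by (intro open_Collect_conj open_Collect_less continuous_intros)

lemma wdom_between:
  assumes "x \<in> wdom B C" "y \<in> wdom B C" "x \<le> t" "t \<le> y"
  shows "t \<in> wdom B C"
proof -
  have lin: "min (a * x) (a * y) \<le> a * t \<and> a * t \<le> max (a * x) (a * y)" for a
    using assms(3,4) by (cases "0 \<le> a") (auto simp: min_def max_def mult_left_mono mult_left_mono_neg)
  from lin[of B] lin[of C] assms(1,2) show ?thesis
    unfolding wdom_def by (auto simp: min_def max_def split: if_splits)
qed

lemma lwell_deriv:
  assumes "z \<in> wdom B C"
  shows "(lwell B C has_real_derivative - (B + C) * z / dwell B C z) (at z)"
proof -
  have eq: "lwell B C = (\<lambda>z. slog B z + slog C (- z))" by (auto simp: lwell_def)
  have "((\<lambda>z. slog C (- z)) has_real_derivative 1 / (1 + C * (- z)) * (- 1)) (at z)"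
  proof (rule DERIV_chain2[where f = "slog C" and g = uminus])
    show "(slog C has_real_derivative 1 / (1 + C * (- z))) (at (- z))"
      by (rule slog_deriv) (use assms in \<open>simp add: wdom_def\<close>)
  qed (auto intro!: derivative_eq_intros)
  moreover have "(slog B has_real_derivative 1 / (1 + B * z)) (at z)"
    using assms by (intro slog_deriv) (auto simp: wdom_def)
  ultimately have "(lwell B C has_real_derivative 1 / (1 + B * z) + 1 / (1 + C * (- z)) * (- 1)) (at z)"
    unfolding eq by (intro DERIV_add)
  moreover have "1 / (1 + B * z) + 1 / (1 + C * (- z)) * (- 1) = - (B + C) * z / dwell B C z"
    using assms by (simp add: wdom_def dwell_def divide_simps) (simp add: algebra_simps)
  ultimately show ?thesis by simp
qed

lemma well_deriv:
  assumes "z \<in> wdom B C"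
  shows "(well B C has_real_derivative - (B + C) * z * well B C z / dwell B C z) (at z)"
proof -
  have eq: "well B C = (\<lambda>z. exp (lwell B C z))" by (auto simp: well_def)
  show ?thesis
    unfolding eq by (rule derivative_eq_intros lwell_deriv assms refl)+ (simp add: well_def)
qed

lemma dwell_deriv: "(dwell B C has_real_derivative B - C - 2 * B * C * z) (at z)"
proof -
  have eq: "dwell B C = (\<lambda>z. (1 + B * z) * (1 - C * z))" by (auto simp: dwell_def)
  show ?thesis unfolding eq
    by (rule derivative_eq_intros refl)+ (simp add: algebra_simps)
qed

section \<open>The slope of eta compared with its value at the origin\<close>

text \<open>\<open>wlin\<close> governs the sign of the derivative of \<open>wcmp\<close>. It is affine in \<open>z\<close>, so its sign
  is decided at the end points \<open>z = - 1 / B\<close> and \<open>z = 1 / C\<close> of \<open>wdom\<close>.\<close>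

definition wlin :: "real \<Rightarrow> real \<Rightarrow> real \<Rightarrow> real" where
  "wlin B C z = (2 * (B - C)\<^sup>2 + 6 * B * C - 3 * (B + C) - (B - C) * (B * C + B + C) * z) / 3"

lemma wlin_uminus: "wlin B C (- z) = wlin C B z"
  by (simp add: wlin_def power2_eq_square algebra_simps)

text \<open>Interpolation between the end points of \<open>wdom\<close>: at z = -1/B only the first
  summand remains, with the sign of B - 1, and at z = 1/C only the second, with the sign of C - 1.
  The factor B + C clears denominators, so B = 0 and C = 0 are included.\<close>

lemma wlin_combination:
  "3 * (B + C) * wlin B C z =
    (1 - C * z) * ((B + C) * (C + 2 * B) * (B - 1)) + (1 + B * z) * ((B + C) * (B + 2 * C) * (C - 1))"
proof -
  have "3 * wlin B C z = 2 * (B - C)\<^sup>2 + 6 * B * C - 3 * (B + C) - (B - C) * (B * C + B + C) * z"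
    by (simp add: wlin_def)
  then have "3 * (B + C) * wlin B C z =
      (B + C) * (2 * (B - C)\<^sup>2 + 6 * B * C - 3 * (B + C) - (B - C) * (B * C + B + C) * z)"
    by (metis mult.assoc mult.commute)
  also have "\<dots> = (1 - C * z) * ((B + C) * (C + 2 * B) * (B - 1)) + (1 + B * z) * ((B + C) * (B + 2 * C) * (C - 1))"
    by (simp add: algebra_simps power2_eq_square)
  finally show ?thesis .
qed

lemma wlin_pos:
  assumes "1 \<le> B" "1 \<le> C" "(B, C) \<noteq> (1, 1)" "z \<in> wdom B C"
  shows "0 < wlin B C z"
proof -
  have nn: "0 \<le> (1 - C * z) * ((B + C) * (C + 2 * B) * (B - 1))" "0 \<le> (1 + B * z) * ((B + C) * (B + 2 * C) * (C - 1))"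
    using assms by (auto simp: wdom_def)
  have "0 < (1 - C * z) * ((B + C) * (C + 2 * B) * (B - 1)) \<or> 0 < (1 + B * z) * ((B + C) * (B + 2 * C) * (C - 1))"
    using assms by (cases "B = 1") (auto simp: wdom_def intro!: mult_pos_pos)
  with nn have "0 < 3 * (B + C) * wlin B C z"
    using assms by (subst wlin_combination) auto
  then show ?thesis using assms by (simp add: zero_less_mult_iff)
qed

lemma wlin_neg:
  assumes "0 \<le> B" "0 \<le> C" "0 < B + C" "B \<le> 1" "C \<le> 1" "(B, C) \<noteq> (1, 1)" "z \<in> wdom B C"
  shows "wlin B C z < 0"
proof -
  have nn: "0 \<le> (1 - C * z) * ((B + C) * (C + 2 * B) * (1 - B))" "0 \<le> (1 + B * z) * ((B + C) * (B + 2 * C) * (1 - C))"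
    using assms by (auto simp: wdom_def)
  have "0 < (1 - C * z) * ((B + C) * (C + 2 * B) * (1 - B)) \<or> 0 < (1 + B * z) * ((B + C) * (B + 2 * C) * (1 - C))"
    using assms by (cases "B = 1") (auto simp: wdom_def intro!: mult_pos_pos)
  with nn have "0 < (1 - C * z) * ((B + C) * (C + 2 * B) * (1 - B)) + (1 + B * z) * ((B + C) * (B + 2 * C) * (1 - C))"
    by linarith
  also have "\<dots> = - (3 * (B + C) * wlin B C z)"
    using assms by (subst wlin_combination) (auto simp: algebra_simps)
  finally show ?thesis using assms by (simp add: mult_less_0_iff)
qed

text \<open>For \<open>y = z * wsig B C z\<close>, the derivative of \<open>y / z\<close> with respect to \<open>y\<close> is
  \<open>(C - B) / 3\<close> plus a positive multiple of \<open>(wcmp B C z - 1) / z ^ 3\<close>.\<close>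

definition wcmp :: "real \<Rightarrow> real \<Rightarrow> real \<Rightarrow> real" where
  "wcmp B C z = well B C z * (1 + (B + C) * z\<^sup>2 * (1 - (C - B) * z / 3) / (2 * dwell B C z))"

lemma wcmp_0 [simp]: "wcmp B C 0 = 1" by (simp add: wcmp_def)

text \<open>The coefficient (C - B) / 3 inside \<open>wcmp\<close> is exactly the one that cancels
  the z^2 term of the numerator. What remains is z^3 times an affine function, so the sign can be
  read off.\<close>

lemma wcmp_deriv:
  assumes "z \<in> wdom B C"
  shows "(wcmp B C has_real_derivative
    well B C z * (B + C) * z ^ 3 * wlin B C z / (2 * (dwell B C z)\<^sup>2)) (at z)"
proof -
  define Q where "Q = dwell B C z"
  have Q: "Q > 0" using dwell_pos[OF assms] by (simp add: Q_def)
  have eq: "wcmp B C = (\<lambda>z. well B C z * (1 + (B + C) * z\<^sup>2 * (1 - (C - B) * z / 3) / (2 * dwell B C z)))"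
    by (auto simp: wcmp_def)
  define W where "W = well B C z"
  define P where "P = (B + C) * z\<^sup>2 * (1 - (C - B) * z / 3)"
  define P' where "P' = (B + C) * (2 * z - (C - B) * z\<^sup>2)"
  define Q' where "Q' = B - C - 2 * B * C * z"
  have P: "((\<lambda>z. (B + C) * z\<^sup>2 * (1 - (C - B) * z / 3)) has_real_derivative P') (at z)"
    unfolding P'_def by (auto intro!: derivative_eq_intros simp: field_simps power2_eq_square)
  have Q2: "((\<lambda>z. 2 * dwell B C z) has_real_derivative 2 * Q') (at z)"
    unfolding Q'_def by (intro DERIV_cmult dwell_deriv)
  have "((\<lambda>z. (B + C) * z\<^sup>2 * (1 - (C - B) * z / 3) / (2 * dwell B C z)) has_real_derivative
      (P' * (2 * Q) - P * (2 * Q')) / ((2 * Q) * (2 * Q))) (at z)"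
    using DERIV_divide[OF P Q2] Q by (simp add: P_def Q_def)
  from DERIV_mult[OF well_deriv[OF assms] DERIV_add[OF DERIV_const this, of 1]]
  have "(wcmp B C has_real_derivative
     (- (B + C) * z * W / Q) * (1 + P / (2 * Q)) + (P' * (2 * Q) - P * (2 * Q')) / ((2 * Q) * (2 * Q)) * W) (at z)"
    unfolding eq by (simp add: P_def Q_def W_def)
  moreover have "(- (B + C) * z * W / Q) * (1 + P / (2 * Q)) + (P' * (2 * Q) - P * (2 * Q')) / ((2 * Q) * (2 * Q)) * W
    = W * ((- (B + C) * z) * (2 * Q + P) + (P' * Q - P * Q')) / (2 * Q\<^sup>2)"
  proof -
    have "(a * W / Q) * (1 + P / (2 * Q)) = W * (a * (2 * Q + P)) / (2 * Q\<^sup>2)" for a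
      using Q by (simp add: field_simps power2_eq_square)
    from this[of "- (B + C) * z"]
    have "(- (B + C) * z * W / Q) * (1 + P / (2 * Q)) = W * ((- (B + C) * z) * (2 * Q + P)) / (2 * Q\<^sup>2)" .
    moreover have "(P' * (2 * Q) - P * (2 * Q')) / ((2 * Q) * (2 * Q)) * W = W * (P' * Q - P * Q') / (2 * Q\<^sup>2)"
      using Q by (simp add: field_simps power2_eq_square)
    ultimately show ?thesis
      by (simp add: add_divide_distrib distrib_left)
  qed
  moreover have "(- (B + C) * z) * (2 * Q + P) + (P' * Q - P * Q') = (B + C) * z ^ 3 * wlin B C z"
  proof -
    have P3: "3 * P = (B + C) * z\<^sup>2 * (3 - (C - B) * z)"
      by (simp add: P_def field_simps)
    have w3: "3 * wlin B C z = 2 * (B - C)\<^sup>2 + 6 * B * C - 3 * (B + C) - (B - C) * (B * C + B + C) * z"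
      by (simp add: wlin_def)
    have "3 * ((- (B + C) * z) * (2 * Q + P) + (P' * Q - P * Q')) =
        (- (B + C) * z) * (6 * Q + 3 * P) + (3 * P' * Q - (3 * P) * Q')"
      by (simp add: algebra_simps)
    also have "\<dots> = (B + C) * z ^ 3 * (3 * wlin B C z)"
      unfolding P3 w3 Q_def dwell_def P'_def Q'_def
      by (simp add: algebra_simps power2_eq_square power3_eq_cube)
    finally show ?thesis by simp
  qed
  ultimately show ?thesis by (simp add: Q_def W_def mult.assoc)
qed


lemma wcmp_uminus: "wcmp B C (- z) = wcmp C B z"
  by (simp add: wcmp_def well_uminus dwell_def algebra_simps)

lemma wcmp_sgn_pos:
  assumes B: "0 < B + C" and s: "\<And>z. z \<in> wdom B C \<Longrightarrow> 0 < s * wlin B C z"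
    and z: "z \<in> wdom B C" "0 < z"
  shows "0 < s * (wcmp B C z - 1)"
proof -
  have dom: "t \<in> wdom B C" if "0 \<le> t" "t \<le> z" for t
    using wdom_between[OF zero_in_wdom z(1)] that by simp
  have "s * wcmp B C 0 < s * wcmp B C z"
  proof (rule DERIV_pos_imp_increasing_open[OF z(2)])
    fix t assume t: "0 < t" "t < z"
    have "((\<lambda>t. s * wcmp B C t) has_real_derivative
        s * (well B C t * (B + C) * t ^ 3 * wlin B C t / (2 * (dwell B C t)\<^sup>2))) (at t)"
      by (intro DERIV_cmult wcmp_deriv dom) (use t in auto)
    moreover have "0 < (well B C t * (B + C) * t ^ 3 / (2 * (dwell B C t)\<^sup>2)) * (s * wlin B C t)"
      by (intro mult_pos_pos divide_pos_pos s dom B) (use t dwell_pos[OF dom, of t] in auto)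
    ultimately show "\<exists>y. ((\<lambda>t. s * wcmp B C t) has_real_derivative y) (at t) \<and> 0 < y"
      by (auto simp: mult_ac)
  next
    show "continuous_on {0..z} (\<lambda>t. s * wcmp B C t)"
      by (intro continuous_intros continuous_at_imp_continuous_on ballI DERIV_isCont[OF wcmp_deriv] dom) auto
  qed
  then show ?thesis by (simp add: algebra_simps)
qed

text \<open>The derivative of \<open>wcmp\<close> changes sign at 0 with z^3, so
  \<open>wcmp - 1\<close> has the same sign on both sides. The factor s, later 1 or -1, treats both
  directions of monotonicity at once.\<close>

lemma wcmp_sgn:
  assumes B: "0 < B + C" and s: "\<And>z. z \<in> wdom B C \<Longrightarrow> 0 < s * wlin B C z"
    and z: "z \<in> wdom B C" "z \<noteq> 0"
  shows "0 < s * (wcmp B C z - 1)"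
proof (cases "0 < z")
  case True
  with assms show ?thesis by (intro wcmp_sgn_pos)
next
  case False
  have "0 < s * (wcmp C B (- z) - 1)"
  proof (rule wcmp_sgn_pos)
    show "0 < s * wlin C B x" if "x \<in> wdom C B" for x
      using s[of "- x"] that by (simp add: wdom_uminus wlin_uminus)
  qed (use False assms in \<open>auto simp: wdom_uminus\<close>)
  then show ?thesis by (simp add: wcmp_uminus)
qed

lemma lwell_neg_pos:
  assumes "0 < B + C" "z \<in> wdom B C" "0 < z"
  shows "lwell B C z < 0"
proof -
  have dom: "t \<in> wdom B C" if "0 \<le> t" "t \<le> z" for t
    using wdom_between[OF zero_in_wdom assms(2)] that by simp
  have "lwell B C z < lwell B C 0"
  proof (rule DERIV_neg_imp_decreasing_open[OF assms(3)])
    fix t assume t: "0 < t" "t < z"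
    then show "\<exists>y. (lwell B C has_real_derivative y) (at t) \<and> y < 0"
      using lwell_deriv[OF dom, of t] dwell_pos[OF dom, of t] assms(1)
      by (intro exI[of _ "- (B + C) * t / dwell B C t"]) (auto simp: divide_neg_pos mult_neg_pos)
  next
    show "continuous_on {0..z} (lwell B C)"
      by (intro continuous_at_imp_continuous_on ballI DERIV_isCont[OF lwell_deriv] dom) auto
  qed
  then show ?thesis by simp
qed

lemma lwell_neg:
  assumes "0 < B + C" "z \<in> wdom B C" "z \<noteq> 0"
  shows "lwell B C z < 0"
proof (cases "0 < z")
  case False
  then have "lwell C B (- z) < 0"
    using assms by (intro lwell_neg_pos) (auto simp: wdom_uminus)
  then show ?thesis by (simp add: lwell_uminus)
qed (use assms lwell_neg_pos in auto)

lemma well_less_1: "0 < B + C \<Longrightarrow> z \<in> wdom B C \<Longrightarrow> z \<noteq> 0 \<Longrightarrow> well B C z < 1"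
  by (simp add: well_def lwell_neg)

section \<open>The signed square root of 1 - F\<close>

text \<open>The case \<open>z = 0\<close> fills in the limit of the quotient.\<close>

definition wsig :: "real \<Rightarrow> real \<Rightarrow> real \<Rightarrow> real" where
  "wsig B C z = (if z = 0 then sqrt ((B + C) / 2) else sqrt ((1 - well B C z) / z\<^sup>2))"

text \<open>Factoring out z gives the root the sign of z and turns the trouble of the square root at
  0 into a removable singularity of \<open>wsig\<close>.\<close>

definition wroot :: "real \<Rightarrow> real \<Rightarrow> real \<Rightarrow> real" where
  "wroot B C z = z * wsig B C z"

lemma wsig_pos: "0 < B + C \<Longrightarrow> z \<in> wdom B C \<Longrightarrow> 0 < wsig B C z"
  using well_less_1[of B C z] by (auto simp: wsig_def)

lemma wsig_sq: "0 < B + C \<Longrightarrow> z \<in> wdom B C \<Longrightarrow> z \<noteq> 0 \<Longrightarrow> (wsig B C z)\<^sup>2 = (1 - well B C z) / z\<^sup>2"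
  using well_less_1[of B C z] by (auto simp: wsig_def)

lemma wroot_sq: "0 < B + C \<Longrightarrow> z \<in> wdom B C \<Longrightarrow> (wroot B C z)\<^sup>2 = 1 - well B C z"
  by (cases "z = 0") (auto simp: wroot_def power_mult_distrib wsig_sq)

lemma wsig_uminus: "wsig B C (- z) = wsig C B z"
  by (simp add: wsig_def well_uminus add.commute)

lemma wroot_uminus: "wroot B C (- z) = - wroot C B z"
  by (simp add: wroot_def wsig_uminus)

lemma wroot_0 [simp]: "wroot B C 0 = 0" by (simp add: wroot_def)

lemma wroot_abs_less_1:
  assumes "0 < B + C" "z \<in> wdom B C"
  shows "- 1 < wroot B C z" "wroot B C z < 1"
proof -
  have "(wroot B C z)\<^sup>2 < 1"
    using wroot_sq[OF assms] by simp
  then have "\<bar>wroot B C z\<bar> < 1"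
    by (simp add: abs_square_less_1)
  then show "- 1 < wroot B C z" "wroot B C z < 1" by auto
qed

lemma eventually_wdom: "z \<in> wdom B C \<Longrightarrow> \<forall>\<^sub>F t in nhds z. t \<in> wdom B C"
  using open_wdom by (simp add: eventually_nhds_in_open)

lemma one_minus_well_deriv:
  assumes "z \<in> wdom B C"
  shows "((\<lambda>z. 1 - well B C z) has_real_derivative (B + C) * z * well B C z / dwell B C z) (at z)"
proof -
  have "0 - - (B + C) * z * well B C z / dwell B C z = (B + C) * z * well B C z / dwell B C z"
    by (simp only: minus_mult_left[symmetric] minus_divide_left[symmetric] diff_0 minus_minus)
  with DERIV_diff[OF DERIV_const well_deriv[OF assms], of 1] show ?thesis by metis
qed

text \<open>One application of l'Hopital suffices because z cancels from the quotient of the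
  derivatives. The limit is the square of eta at 0.\<close>

lemma well_quotient_tendsto:
  "((\<lambda>z. (1 - well B C z) / z\<^sup>2) \<longlongrightarrow> (B + C) / 2) (at 0)"
proof -
  have ev: "\<forall>\<^sub>F t in at 0. t \<in> wdom B C"
    using eventually_wdom[of 0 B C] by (simp add: eventually_at_filter eventually_mono)
  have lim: "((\<lambda>z. (B + C) * well B C z / (2 * dwell B C z)) \<longlongrightarrow> (B + C) * well B C 0 / (2 * dwell B C 0)) (at 0)"
    by (intro tendsto_intros isContD DERIV_isCont[OF well_deriv] DERIV_isCont[OF dwell_deriv]) auto
  show ?thesis
  proof (rule lhopital[where f' = "\<lambda>z. (B + C) * z * well B C z / dwell B C z" and g' = "\<lambda>z. 2 * z"])
    have "((\<lambda>z. 1 - well B C z) \<longlongrightarrow> 1 - well B C 0) (at 0)"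
      by (intro tendsto_intros isContD DERIV_isCont[OF well_deriv]) auto
    then show "((\<lambda>z. 1 - well B C z) \<longlongrightarrow> 0) (at 0)" by simp
    show "((\<lambda>z::real. z\<^sup>2) \<longlongrightarrow> 0) (at 0)" by (auto intro!: tendsto_eq_intros)
    show "\<forall>\<^sub>F z in at (0::real). z\<^sup>2 \<noteq> 0" "\<forall>\<^sub>F z in at (0::real). 2 * z \<noteq> 0"
      by (auto simp: eventually_at_filter)
    show "\<forall>\<^sub>F z in at 0. ((\<lambda>z. 1 - well B C z) has_real_derivative (B + C) * z * well B C z / dwell B C z) (at z)"
      using ev by eventually_elim (rule one_minus_well_deriv)
    show "\<forall>\<^sub>F z in at 0. ((\<lambda>z. z\<^sup>2) has_real_derivative 2 * z) (at z)"
      by (intro always_eventually allI) (auto intro!: derivative_eq_intros)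
    show "((\<lambda>z. (B + C) * z * well B C z / dwell B C z / (2 * z)) \<longlongrightarrow> (B + C) / 2) (at 0)"
      by (rule tendsto_cong[THEN iffD1, OF _ lim[simplified]]) (auto simp: eventually_at_filter)
  qed
qed

lemma wsig_isCont_0:
  assumes "0 < B + C" shows "isCont (wsig B C) 0"
proof -
  have "((\<lambda>z. sqrt ((1 - well B C z) / z\<^sup>2)) \<longlongrightarrow> sqrt ((B + C) / 2)) (at 0)"
    by (intro tendsto_real_sqrt well_quotient_tendsto)
  then have "(wsig B C \<longlongrightarrow> sqrt ((B + C) / 2)) (at 0)"
    by (rule tendsto_cong[THEN iffD1, rotated]) (auto simp: eventually_at_filter wsig_def)
  then show ?thesis by (simp add: isCont_def wsig_def)
qed

lemma wroot_deriv_pos: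
  assumes "0 < B + C" "z \<in> wdom B C" "0 < z"
  shows "(wroot B C has_real_derivative (B + C) * well B C z / (2 * wsig B C z * dwell B C z)) (at z)"
proof -
  have F: "well B C z < 1" using assms well_less_1 by auto
  have sq: "sqrt (1 - well B C z) = z * wsig B C z"
    using assms by (simp add: wsig_def real_sqrt_divide)
  have "((\<lambda>z. sqrt (1 - well B C z)) has_real_derivative
      (inverse (sqrt (1 - well B C z)) / 2) * ((B + C) * z * well B C z / dwell B C z)) (at z)"
    using F by (intro DERIV_chain2[where f = sqrt] DERIV_real_sqrt one_minus_well_deriv assms(2)) simp
  also have "(inverse (sqrt (1 - well B C z)) / 2) * ((B + C) * z * well B C z / dwell B C z)
      = (B + C) * well B C z / (2 * wsig B C z * dwell B C z)"
    unfolding sq using assms(3) wsig_pos[OF assms(1,2)] dwell_pos[OF assms(2)] by (simp add: divide_simps)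
  finally have D: "((\<lambda>z. sqrt (1 - well B C z)) has_real_derivative
      (B + C) * well B C z / (2 * wsig B C z * dwell B C z)) (at z)" .
  show ?thesis
  proof (rule has_field_derivative_transform_within_open[OF D, of "{0<..}"])
    fix t :: real assume "t \<in> {0<..}"
    then show "sqrt (1 - well B C t) = wroot B C t"
      by (simp add: wroot_def wsig_def real_sqrt_divide)
  qed (use assms in auto)
qed

text \<open>Written with \<open>wsig\<close> instead of the square root of 1 - F, the formula stays
  regular at 0; there it is the limit of the difference quotient, which is \<open>wsig\<close>
  itself. Negative z follow by reflection.\<close>

lemma wroot_deriv:
  assumes "0 < B + C" "z \<in> wdom B C"
  shows "(wroot B C has_real_derivative (B + C) * well B C z / (2 * wsig B C z * dwell B C z)) (at z)"
proof -
  consider "0 < z" | "z < 0" | "z = 0" by linarith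
  then show ?thesis
  proof cases
    case 1 with assms show ?thesis by (rule wroot_deriv_pos)
  next
    case 2
    have "(wroot C B has_real_derivative (C + B) * well C B (- z) / (2 * wsig C B (- z) * dwell C B (- z))) (at (- z))"
      using assms 2 by (intro wroot_deriv_pos) (auto simp: wdom_uminus)
    moreover have "dwell C B (- z) = dwell B C z" by (simp add: dwell_def)
    ultimately have *: "(wroot C B has_real_derivative (B + C) * well B C z / (2 * wsig B C z * dwell B C z)) (at (- z))"
      by (simp add: well_uminus wsig_uminus add.commute)
    have eq: "wroot B C = (\<lambda>z. - wroot C B (- z))"
      by (auto simp: wroot_uminus)
    show ?thesis
      unfolding eq using DERIV_minus[OF DERIV_chain2[where g = uminus, OF * DERIV_minus[OF DERIV_ident]]]
      by simp
  next
    case 3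
    have s: "wsig B C 0 * wsig B C 0 = (B + C) / 2" "wsig B C 0 > 0"
      using assms by (auto simp: wsig_def)
    have "(B + C) * well B C 0 / (2 * wsig B C 0 * dwell B C 0) = wsig B C 0"
      using s by (simp add: field_simps)
    moreover have "(wroot B C has_real_derivative wsig B C 0) (at 0)"
    proof -
      have "((\<lambda>h. (wroot B C h - wroot B C 0) / (h - 0)) \<longlongrightarrow> wsig B C 0) (at 0)"
        by (rule tendsto_cong[THEN iffD1, OF _ isContD[OF wsig_isCont_0[OF assms(1)]]])
           (auto simp: eventually_at_filter wroot_def)
      then show ?thesis by (simp add: has_field_derivative_iff)
    qed
    ultimately show ?thesis using 3 by simp
  qed
qed

lemma wroot_deriv_gt_0:
  assumes "0 < B + C" "z \<in> wdom B C"
  shows "0 < (B + C) * well B C z / (2 * wsig B C z * dwell B C z)"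
  using assms wsig_pos[OF assms] dwell_pos[OF assms(2)] by auto

lemma wroot_strict_mono:
  assumes "0 < B + C" "x \<in> wdom B C" "y \<in> wdom B C" "x < y"
  shows "wroot B C x < wroot B C y"
proof (rule DERIV_pos_imp_increasing[OF assms(4)])
  fix t assume "x \<le> t" "t \<le> y"
  then have "t \<in> wdom B C" using wdom_between assms by blast
  then show "\<exists>d. (wroot B C has_real_derivative d) (at t) \<and> 0 < d"
    using wroot_deriv[OF assms(1)] wroot_deriv_gt_0[OF assms(1)] by blast
qed

text \<open>F comes arbitrarily close to 0 at the right end of its domain, so the root reaches every
  value below 1. For C = 0 the domain is unbounded and the linear term beats the logarithm; for C >
  0 the logarithm blows up at 1/C.\<close>

lemma lwell_tail:
  assumes "0 \<le> B" "0 \<le> C" "0 < B + C"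
  shows "\<exists>z\<in>wdom B C. 0 < z \<and> lwell B C z \<le> - K"
proof (cases "C = 0")
  case True
  with assms have B: "0 < B" by simp
  have "filterlim (\<lambda>z. ln (1 + B * z) / B - z) at_bot at_top"
    using B by real_asymp
  then have "\<forall>\<^sub>F z in at_top. ln (1 + B * z) / B - z \<le> - K"
    by (simp add: filterlim_at_bot)
  then have "\<forall>\<^sub>F z in at_top. ln (1 + B * z) / B - z \<le> - K \<and> 0 < z"
    using eventually_gt_at_top[of 0] by eventually_elim auto
  then obtain z where "ln (1 + B * z) / B - z \<le> - K" "0 < z"
    using eventually_happens trivial_limit_at_top_linorder by blast
  with B True show ?thesis
    by (intro bexI[of _ z]) (auto simp: lwell_def slog_def wdom_def add_pos_pos)
next
  case False
  with assms have C: "0 < C" by simp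
  \<comment> \<open>\<open>e\<close> will be 1 - C z. The extra -1 in the exponent contributes -1/C,
    which absorbs the bound \<open>slog B z \<le> z \<le> 1 / C\<close> on the other term.\<close>
  define e where "e = exp (- \<bar>K\<bar> * C - 1)"
  have "0 \<le> \<bar>K\<bar> * C" using C by simp
  then have e: "0 < e" "e < 1" by (auto simp: e_def)
  define z where "z = (1 - e) / C"
  have Cz: "C * z = 1 - e" using C by (simp add: z_def)
  have z: "0 < z" "z \<le> 1 / C" using C e by (auto simp: z_def divide_right_mono)
  have dom: "z \<in> wdom B C" using e Cz z assms by (auto simp: wdom_def add_pos_nonneg)
  have "slog B z \<le> z"
  proof (cases "B = 0")
    case F: False
    with assms have "0 < B" by simp
    with ln_add_one_self_le_self[of "B * z"] z show ?thesis
      by (simp add: slog_def field_simps)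
  qed (simp add: slog_def)
  moreover have "slog C (- z) = (- \<bar>K\<bar> * C - 1) / C"
    using C Cz by (simp add: slog_def e_def)
  moreover have "(- \<bar>K\<bar> * C - 1) / C = - \<bar>K\<bar> - 1 / C" using C by (simp add: field_simps)
  ultimately have "lwell B C z \<le> - K" using z by (simp add: lwell_def)
  with dom z show ?thesis by blast
qed

lemma wroot_surj_pos:
  assumes "0 \<le> B" "0 \<le> C" "0 < B + C" "0 \<le> y" "y < 1"
  shows "\<exists>z\<in>wdom B C. wroot B C z = y"
proof -
  obtain z where z: "z \<in> wdom B C" "0 < z" "lwell B C z \<le> - (- ln (1 - y\<^sup>2))"
    using lwell_tail[OF assms(1-3)] by blast
  have y2: "y\<^sup>2 < 1" using assms by (simp add: abs_square_less_1)
  have "well B C z \<le> exp (ln (1 - y\<^sup>2))"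
    unfolding well_def using z(3) by simp
  also have "\<dots> = 1 - y\<^sup>2" using y2 by simp
  finally have "y\<^sup>2 \<le> (wroot B C z)\<^sup>2"
    using wroot_sq[OF assms(3) z(1)] by simp
  moreover have "0 \<le> wroot B C z"
    using wsig_pos[OF assms(3) z(1)] z by (simp add: wroot_def)
  ultimately have le: "y \<le> wroot B C z" by (rule power2_le_imp_le)
  have dom: "t \<in> wdom B C" if "0 \<le> t" "t \<le> z" for t
    using wdom_between[OF zero_in_wdom z(1)] that by simp
  have "\<exists>x\<ge>0. x \<le> z \<and> wroot B C x = y"
    by (rule IVT) (use le z assms dom in \<open>auto intro!: DERIV_isCont[OF wroot_deriv]\<close>)
  then show ?thesis using dom by blast
qed

lemma wroot_surj:
  assumes "0 \<le> B" "0 \<le> C" "0 < B + C" "- 1 < y" "y < 1"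
  shows "\<exists>z\<in>wdom B C. wroot B C z = y"
proof (cases "0 \<le> y")
  case False
  then obtain z where "z \<in> wdom C B" "wroot C B z = - y"
    using wroot_surj_pos[of C B "- y"] assms by (auto simp: add.commute)
  then show ?thesis
    by (intro bexI[of _ "- z"]) (auto simp: wroot_uminus wdom_uminus)
qed (use assms wroot_surj_pos in auto)

section \<open>Inverting the root; the function eta\<close>

definition winv :: "real \<Rightarrow> real \<Rightarrow> real \<Rightarrow> real" where
  "winv B C y = (THE z. z \<in> wdom B C \<and> wroot B C z = y)"


locale weight_pair =
  fixes B C :: real
  assumes B_nonneg: "0 \<le> B" and C_nonneg: "0 \<le> C" and sum_pos: "0 < B + C"
begin

lemma swap: "weight_pair C B"
  using B_nonneg C_nonneg sum_pos by unfold_locales (auto simp: add.commute)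

lemma winv_unique: "z \<in> wdom B C \<Longrightarrow> winv B C (wroot B C z) = z"
  unfolding winv_def
  by (rule the_equality) (use wroot_strict_mono[OF sum_pos] in \<open>auto, metis less_irrefl linorder_neqE_linordered_idom\<close>)

lemma winv:
  assumes "\<bar>y\<bar> < 1"
  shows "winv B C y \<in> wdom B C" "wroot B C (winv B C y) = y"
proof -
  obtain z where "z \<in> wdom B C" "wroot B C z = y"
    using wroot_surj[OF B_nonneg C_nonneg sum_pos, of y] assms by (auto simp: abs_less_iff)
  with winv_unique[of z] show "winv B C y \<in> wdom B C" "wroot B C (winv B C y) = y" by auto
qed

lemma winv_less_iff:
  assumes "\<bar>x\<bar> < 1" "\<bar>y\<bar> < 1"
  shows "winv B C x < winv B C y \<longleftrightarrow> x < y"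
  using winv[OF assms(1)] winv[OF assms(2)] wroot_strict_mono[OF sum_pos]
  by (metis linorder_neqE_linordered_idom order_less_asym)

lemma winv_0 [simp]: "winv B C 0 = 0"
  using winv_unique[of 0] by simp

lemma winv_isCont:
  assumes "\<bar>y\<bar> < 1"
  shows "isCont (winv B C) y"
proof -
  define a b where "a = (y - 1) / 2" and "b = (y + 1) / 2"
  have ab: "a < y" "y < b" "\<bar>a\<bar> < 1" "\<bar>b\<bar> < 1" using assms by (auto simp: a_def b_def)
  have dom: "z \<in> wdom B C" if "winv B C a \<le> z" "z \<le> winv B C b" for z
    using wdom_between[OF winv(1)[OF ab(3)] winv(1)[OF ab(4)] that] .
  have "isCont (winv B C) (wroot B C (winv B C y))"
  proof (rule isCont_inverse_function2[where f = "wroot B C" and a = "winv B C a" and b = "winv B C b"])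
    show "winv B C a < winv B C y" "winv B C y < winv B C b"
      using ab assms by (auto simp: winv_less_iff)
    show "winv B C (wroot B C z) = z" if "winv B C a \<le> z" "z \<le> winv B C b" for z
      using winv_unique dom that by blast
    show "isCont (wroot B C) z" if "winv B C a \<le> z" "z \<le> winv B C b" for z
      by (rule DERIV_isCont[OF wroot_deriv[OF sum_pos]]) (use dom that in blast)
  qed
  then show ?thesis using winv(2)[OF assms] by simp
qed

definition eta :: "real \<Rightarrow> real" where
  "eta y = wsig B C (winv B C y)"

lemma eta_pos: "\<bar>y\<bar> < 1 \<Longrightarrow> 0 < eta y"
  unfolding eta_def by (intro wsig_pos sum_pos winv)

lemma winv_eta: "\<bar>y\<bar> < 1 \<Longrightarrow> winv B C y * eta y = y"
  using winv(2)[of y] by (simp add: eta_def wroot_def)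

lemma eta_0: "eta 0 = sqrt ((B + C) / 2)"
  by (simp add: eta_def wsig_def)

lemma winv_deriv:
  assumes "\<bar>y\<bar> < 1"
  shows "(winv B C has_real_derivative
    2 * eta y * dwell B C (winv B C y) / ((B + C) * well B C (winv B C y))) (at y)"
proof -
  note z = winv[OF assms]
  have "(winv B C has_real_derivative
    inverse ((B + C) * well B C (winv B C y) / (2 * eta y * dwell B C (winv B C y)))) (at y)"
    unfolding eta_def
  proof (rule DERIV_inverse_function[where f = "wroot B C" and a = "-1" and b = 1])
    show "wroot B C (winv B C t) = t" if "- 1 < t" "t < 1" for t
      using winv(2)[of t] that by auto
  qed (use assms z wroot_deriv[OF sum_pos z(1)] wroot_deriv_gt_0[OF sum_pos z(1)] winv_isCont in auto)
  then show ?thesis by (simp add: field_simps)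
qed

lemma wsig_isCont: "z \<in> wdom B C \<Longrightarrow> isCont (wsig B C) z"
proof (cases "z = 0")
  case False
  assume z: "z \<in> wdom B C"
  have "isCont (\<lambda>z. wroot B C z / z) z"
    using False by (intro continuous_intros DERIV_isCont[OF wroot_deriv[OF sum_pos z]])
  moreover have "\<forall>\<^sub>F t in nhds z. wroot B C t / t = wsig B C t"
    using t1_space_nhds[OF False] by eventually_elim (simp add: wroot_def)
  ultimately show ?thesis by (simp add: isCont_cong)
qed (use wsig_isCont_0[OF sum_pos] in simp)

lemma eta_isCont: "\<bar>y\<bar> < 1 \<Longrightarrow> isCont eta y"
  unfolding eta_def
  by (rule isCont_o2[OF winv_isCont wsig_isCont[OF winv(1)]])

lemma eta_le:
  assumes "0 < x" "x \<le> y" "y < 1"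
  shows "eta y \<le> 1 / winv B C x"
proof -
  have x: "0 < winv B C x" using winv_less_iff[of 0 x] assms by simp
  have xy: "winv B C x \<le> winv B C y" using winv_less_iff[of y x] assms by (simp add: not_less[symmetric])
  have "eta y = y / winv B C y" using winv_eta[of y] assms x xy by (simp add: field_simps)
  also have "\<dots> \<le> 1 / winv B C y" using assms x xy by (intro divide_right_mono) auto
  also have "\<dots> \<le> 1 / winv B C x" using x xy by (simp add: frac_le)
  finally show ?thesis .
qed

text \<open>eta is y / z, and z approaches the right end of \<open>wdom\<close>, which is 1/C or
  infinity. The reciprocal 1/z tends to C in either case, so C = 0 needs no separate
  argument.\<close>

lemma eta_tendsto_1: "(eta \<longlongrightarrow> C) (at_left 1)"
proof -
  have "((\<lambda>y. 1 / winv B C y) \<longlongrightarrow> C) (at_left 1)"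
  proof (rule order_tendstoI)
    fix a :: real assume a: "a < C"
    have "\<forall>\<^sub>F y in at_left 1. 0 < y \<and> y < (1::real)"
      using eventually_at_left_real[of 0 "1::real"] by simp
    then show "\<forall>\<^sub>F y in at_left 1. a < 1 / winv B C y"
    proof eventually_elim
      case (elim y)
      then have "0 < winv B C y" using winv_less_iff[of 0 y] by simp
      moreover have "C * winv B C y < 1" using winv(1)[of y] elim by (simp add: wdom_def)
      ultimately have "C < 1 / winv B C y" by (simp add: field_simps)
      with a show ?case by simp
    qed
  next
    fix a :: real assume a: "C < a"
    \<comment> \<open>The point 1/a lies in the domain because a > C; once y passes its root, z
      exceeds 1/a.\<close>
    define z where "z = 1 / a"
    have z: "0 < z" "z \<in> wdom B C"
      using a B_nonneg C_nonneg by (auto simp: z_def wdom_def add_pos_nonneg)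
    have "wroot B C z < 1" using wroot_abs_less_1[OF sum_pos z(2)] by simp
    then have "\<forall>\<^sub>F y in at_left 1. wroot B C z < y \<and> y < (1::real)"
      using eventually_at_left_real[of "wroot B C z" 1] by simp
    then show "\<forall>\<^sub>F y in at_left 1. 1 / winv B C y < a"
    proof eventually_elim
      case (elim y)
      then have "z < winv B C y"
        using winv_less_iff[of "wroot B C z" y] wroot_abs_less_1[OF sum_pos z(2)] winv_unique[OF z(2)] by auto
      with z(1) have "1 / winv B C y < 1 / z" by (intro divide_strict_left_mono) auto
      then show ?case by (simp add: z_def)
    qed
  qed
  then have "((\<lambda>y. y * (1 / winv B C y)) \<longlongrightarrow> 1 * C) (at_left 1)"
    by (intro tendsto_mult tendsto_ident_at)
  moreover have "\<forall>\<^sub>F y in at_left 1. 0 < y \<and> y < (1::real)"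
    using eventually_at_left_real[of 0 "1::real"] by simp
  then have "\<forall>\<^sub>F y in at_left 1. y * (1 / winv B C y) = eta y"
  proof eventually_elim
    case (elim y)
    then have "0 < winv B C y" using winv_less_iff[of 0 y] by simp
    with winv_eta[of y] elim show ?case by (simp add: field_simps)
  qed
  ultimately show ?thesis using tendsto_cong by fastforce
qed

text \<open>Supplies the dominating constant for the limit of the period: compactness up to 1/2, and
  beyond that eta is at most 1/z at y = 1/2.\<close>

lemma eta_bounded_pos: "\<exists>K. \<forall>y. 0 \<le> y \<and> y < 1 \<longrightarrow> eta y \<le> K"
proof -
  have "continuous_on {0..1/2} eta"
    by (intro continuous_at_imp_continuous_on ballI eta_isCont) auto
  then have "bounded (eta ` {0..1/2})"
    by (intro compact_imp_bounded compact_continuous_image) auto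
  then obtain K where K: "\<And>y. y \<in> {0..1/2} \<Longrightarrow> \<bar>eta y\<bar> \<le> K"
    unfolding bounded_iff by (metis imageI real_norm_def)
  have "eta y \<le> max K (1 / winv B C (1/2))" if "0 \<le> y" "y < 1" for y
    using K[of y] eta_le[of "1/2" y] that by (cases "y \<le> 1/2") auto
  then show ?thesis by blast
qed

text \<open>Differentiating y / z(y) gives 1/z minus a multiple of (1 - F) / z^3. Splitting off (C -
  B) / 3 and taking out a common factor leaves \<open>wcmp - 1\<close>.\<close>

lemma eta_deriv:
  assumes "\<bar>y\<bar> < 1" "y \<noteq> 0"
  defines "z \<equiv> winv B C y"
  shows "(eta has_real_derivative
    (C - B) / 3 + (wcmp B C z - 1) * (2 * dwell B C z / ((B + C) * well B C z * z ^ 3))) (at y)"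
proof -
  have z: "z \<in> wdom B C" "z * eta y = y"
    unfolding z_def using winv winv_eta assms by auto
  have z0: "z \<noteq> 0" using z assms by auto
  define Q where "Q = dwell B C z"
  have Q: "0 < Q" unfolding Q_def by (rule dwell_pos[OF z(1)])
  define F where "F = well B C z"
  have F: "0 < F" by (simp add: F_def)
  define k where "k = B + C"
  have k: "0 < k" using sum_pos by (simp add: k_def)
  have sq: "z * (z * (eta y * eta y)) = 1 - F"
  proof -
    have "z * (z * (eta y * eta y)) = (z * eta y)\<^sup>2" by (simp add: power2_eq_square mult_ac)
    also have "\<dots> = (wroot B C z)\<^sup>2" using z(2) winv(2)[OF assms(1)] by (simp add: z_def)
    also have "\<dots> = 1 - F" using wroot_sq[OF sum_pos z(1)] by (simp add: F_def)
    finally show ?thesis .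
  qed
  have "((\<lambda>y. y / winv B C y) has_real_derivative
      (1 * z - y * (2 * eta y * Q / (k * F))) / (z * z)) (at y)"
    unfolding z_def Q_def F_def k_def
    by (intro DERIV_divide DERIV_ident winv_deriv assms) (use z0 in \<open>auto simp: z_def\<close>)
  moreover have "(1 * z - y * (2 * eta y * Q / (k * F))) / (z * z)
      = (C - B) / 3 + (wcmp B C z - 1) * (2 * Q / (k * F * z ^ 3))"
  proof -
    define L where "L = (C - B) / 3"
    have "wcmp B C z = F * (1 + k * z\<^sup>2 * (1 - L * z) / (2 * Q))"
      by (simp add: wcmp_def F_def Q_def k_def L_def)
    moreover have "(F * (1 + k * z\<^sup>2 * (1 - L * z) / (2 * Q)) - 1) * (2 * Q / (k * F * z ^ 3))
       = 1 / z - L - (1 - F) * (2 * Q) / (k * F * z ^ 3)"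
      using Q F k z0 by (simp add: field_simps power2_eq_square power3_eq_cube)
    moreover have "(1 * z - (z * e) * (2 * e * Q / (k * F))) / (z * z)
       = 1 / z - (z * (z * (e * e))) * (2 * Q) / (k * F * z ^ 3)" for e
      using Q F k z0 by (simp add: field_simps power3_eq_cube)
    from this[of "eta y"]
    have "(1 * z - y * (2 * eta y * Q / (k * F))) / (z * z) = 1 / z - (1 - F) * (2 * Q) / (k * F * z ^ 3)"
      unfolding z(2) sq .
    ultimately show ?thesis by (simp add: L_def)
  qed
  ultimately have D: "((\<lambda>y. y / winv B C y) has_real_derivative
      (C - B) / 3 + (wcmp B C z - 1) * (2 * Q / (k * F * z ^ 3))) (at y)" by simp
  have "(eta has_real_derivative (C - B) / 3 + (wcmp B C z - 1) * (2 * Q / (k * F * z ^ 3))) (at y)"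
  proof (rule has_field_derivative_transform_within_open[OF D])
    show "open ({-1<..<1} - {0::real})" by (intro open_Diff) auto
    show "y \<in> {-1<..<1} - {0}" using assms by auto
    show "t / winv B C t = eta t" if "t \<in> {-1<..<1} - {0}" for t
    proof -
      have t: "\<bar>t\<bar> < 1" "t \<noteq> 0" using that by auto
      then have "winv B C t \<noteq> 0" using winv(2)[of t] by auto
      with winv_eta[OF t(1)] show ?thesis by (simp add: field_simps)
    qed
  qed
  then show ?thesis by (simp add: Q_def F_def k_def)
qed

definition eta_sum :: "real \<Rightarrow> real" where
  "eta_sum y = eta y + eta (- y)"

lemma eta_sum_abs: "eta_sum \<bar>y\<bar> = eta_sum y"
  by (simp add: eta_sum_def abs_if)

text \<open>The slope of \<open>eta\<close> exceeds its value \<open>(C - B) / 3\<close> at the origin to the right of the origin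
  and stays below it to the left, or conversely.\<close>

lemma eta_sum_strict_mono:
  assumes s: "\<And>z. z \<in> wdom B C \<Longrightarrow> 0 < s * wlin B C z" and xy: "0 \<le> x" "x < y" "y < 1"
  shows "s * eta_sum x < s * eta_sum y"
proof (rule DERIV_pos_imp_increasing_open[OF xy(2)])
  fix t assume t: "x < t" "t < y"
  define D where "D u = (wcmp B C u - 1) * (2 * dwell B C u / ((B + C) * well B C u * u ^ 3))" for u
  have abs: "\<bar>t\<bar> < 1" "\<bar>- t\<bar> < 1" "t \<noteq> 0" "- t \<noteq> 0" using t xy by auto
  have minus_t: "((\<lambda>t. eta (- t)) has_real_derivative ((C - B) / 3 + D (winv B C (- t))) * - 1) (at t)"
    by (rule DERIV_chain2[where f = eta and g = uminus])
       (use eta_deriv[OF abs(2,4)] in \<open>auto simp: D_def intro!: derivative_eq_intros\<close>)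
  have "((\<lambda>t. s * eta_sum t) has_real_derivative
      s * (((C - B) / 3 + D (winv B C t)) + ((C - B) / 3 + D (winv B C (- t))) * - 1)) (at t)"
    unfolding eta_sum_def
    by (intro DERIV_cmult DERIV_add minus_t) (use eta_deriv[OF abs(1,3)] in \<open>simp add: D_def\<close>)
  moreover have "s * (((C - B) / 3 + D (winv B C t)) + ((C - B) / 3 + D (winv B C (- t))) * - 1)
      = s * D (winv B C t) - s * D (winv B C (- t))"
    by (simp add: right_diff_distrib)
  ultimately have "((\<lambda>t. s * eta_sum t) has_real_derivative
      s * D (winv B C t) - s * D (winv B C (- t))) (at t)" by simp
  moreover have "0 < s * D (winv B C t)"
  proof -
    have u: "0 < winv B C t" using winv_less_iff[of 0 t] t xy by simp
    note w = winv(1)[OF abs(1)]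
    have "0 < (s * (wcmp B C (winv B C t) - 1)) *
      (2 * dwell B C (winv B C t) / ((B + C) * well B C (winv B C t) * winv B C t ^ 3))"
      by (intro mult_pos_pos wcmp_sgn[OF sum_pos s w] divide_pos_pos) (use u sum_pos dwell_pos[OF w] in auto)
    then show ?thesis by (simp add: D_def mult_ac)
  qed
  moreover have "s * D (winv B C (- t)) < 0"
  proof -
    have u: "winv B C (- t) < 0" using winv_less_iff[of "- t" 0] t xy by simp
    note w = winv(1)[OF abs(2)]
    have "(s * (wcmp B C (winv B C (- t)) - 1)) *
      (2 * dwell B C (winv B C (- t)) / ((B + C) * well B C (winv B C (- t)) * winv B C (- t) ^ 3)) < 0"
      by (intro mult_pos_neg wcmp_sgn[OF sum_pos s w] divide_pos_neg)
        (use u sum_pos dwell_pos[OF w] in \<open>auto intro!: mult_pos_neg simp: power_less_zero_eq\<close>)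
    then show ?thesis by (simp add: D_def mult_ac)
  qed
  ultimately show "\<exists>d. ((\<lambda>t. s * eta_sum t) has_real_derivative d) (at t) \<and> 0 < d"
    by (intro exI[of _ "s * D (winv B C t) - s * D (winv B C (- t))"]) auto
next
  show "continuous_on {x..y} (\<lambda>t. s * eta_sum t)"
    unfolding eta_sum_def
    by (intro continuous_intros continuous_at_imp_continuous_on ballI eta_isCont
        isCont_o2[where f = uminus and g = eta]) (use xy in auto)
qed

end

text \<open>Carries the limit and the bound near 1 for the swapped pair over to this function near
  -1.\<close>

lemma (in weight_pair) eta_uminus:
  assumes "\<bar>y\<bar> < 1"
  shows "eta (- y) = weight_pair.eta C B y"
proof -
  interpret sw: weight_pair C B by (rule swap)
  have "winv B C (- y) = - winv C B y"
    using winv_unique[of "- winv C B y"] sw.winv[OF assms] by (simp add: wroot_uminus wdom_uminus)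
  then show ?thesis by (simp add: eta_def sw.eta_def wsig_uminus)
qed

lemma (in weight_pair) eta_sum_tendsto_1: "(eta_sum \<longlongrightarrow> B + C) (at_left 1)"
proof -
  interpret sw: weight_pair C B by (rule swap)
  have "\<forall>\<^sub>F y in at_left 1. 0 < y \<and> y < (1::real)"
    using eventually_at_left_real[of 0 "1::real"] by simp
  then have "\<forall>\<^sub>F y in at_left 1. sw.eta y + eta y = eta_sum y"
    by eventually_elim (simp add: eta_sum_def eta_uminus)
  with tendsto_add[OF sw.eta_tendsto_1 eta_tendsto_1] show ?thesis
    using tendsto_cong by fastforce
qed

lemma (in weight_pair) eta_sum_bounded: "\<exists>K. \<forall>y. \<bar>y\<bar> < 1 \<longrightarrow> \<bar>eta_sum y\<bar> \<le> K"
proof -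
  interpret sw: weight_pair C B by (rule swap)
  obtain K1 K2 where K: "\<And>y. 0 \<le> y \<Longrightarrow> y < 1 \<Longrightarrow> eta y \<le> K1" "\<And>y. 0 \<le> y \<Longrightarrow> y < 1 \<Longrightarrow> sw.eta y \<le> K2"
    using eta_bounded_pos sw.eta_bounded_pos by blast
  have "\<bar>eta_sum y\<bar> \<le> K1 + K2" if y: "\<bar>y\<bar> < 1" for y
  proof -
    have "eta_sum y = eta \<bar>y\<bar> + sw.eta \<bar>y\<bar>"
      using eta_sum_abs[of y] eta_uminus[of "\<bar>y\<bar>"] y by (simp add: eta_sum_def)
    then show ?thesis
      using K[of "\<bar>y\<bar>"] y eta_pos[of "\<bar>y\<bar>"] sw.eta_pos[of "\<bar>y\<bar>"] by auto
  qed
  then show ?thesis by blast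
qed

section \<open>Orbits and their period\<close>

lemma continuous_antiderivative:
  fixes g :: "real \<Rightarrow> real"
  assumes "continuous_on UNIV g"
  obtains G where "\<And>x. (G has_real_derivative g x) (at x)"
proof -
  \<comment> \<open>For each x at most one of the two intervals is nondegenerate, so this is the
    oriented integral from 0 to x.\<close>
  define G where "G x = integral {0..x} g - integral {x..0} g" for x
  have int: "g integrable_on {a..b}" for a b
    by (intro integrable_continuous_interval continuous_on_subset[OF assms]) auto
  have "(G has_real_derivative g x) (at x)" for x
  proof -
    define R where "R = \<bar>x\<bar> + 1"
    have R: "0 < R" "\<bar>x\<bar> < R" by (auto simp: R_def)
    have GR: "G y = integral {-R..y} g - integral {-R..0} g" if "y \<in> {-R..R}" for y
    proof (cases "0 \<le> y")
      case True
      then have "integral {-R..0} g + integral {0..y} g = integral {-R..y} g"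
        using R by (intro Henstock_Kurzweil_Integration.integral_combine int) auto
      moreover have "integral {y..0} g = 0" using True by (cases "y = 0") auto
      ultimately show ?thesis by (simp add: G_def)
    next
      case False
      then have "integral {-R..y} g + integral {y..0} g = integral {-R..0} g"
        using that by (intro Henstock_Kurzweil_Integration.integral_combine int) auto
      with False show ?thesis by (simp add: G_def)
    qed
    have "((\<lambda>y. integral {-R..y} g) has_real_derivative g x) (at x within {-R..R})"
      using R by (intro integral_has_real_derivative continuous_on_subset[OF assms]) auto
    then have "((\<lambda>y. integral {-R..y} g) has_real_derivative g x) (at x)"
      using R by (simp add: at_within_Icc_at)
    then have "((\<lambda>y. integral {-R..y} g - integral {-R..0} g) has_real_derivative g x) (at x)"
      by (auto intro!: derivative_eq_intros)
    then show ?thesis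
      by (rule has_field_derivative_transform_within_open[of _ _ _ "{-R<..<R}"]) (use R GR in auto)
  qed
  then show thesis by (rule that)
qed

text \<open>With b = 0 this is iteration of a period; with b nonzero it describes the angle as a
  function of the orbit parameter.\<close>

lemma quasi_periodic_iterate:
  fixes G :: "real \<Rightarrow> real"
  assumes "\<And>x. G (x + a) = G x + b"
  shows "G (x + real k * a) = G x + real k * b"
proof (induction k)
  case (Suc k)
  have "G (x + real (Suc k) * a) = G ((x + real k * a) + a)" by (simp add: algebra_simps)
  also have "\<dots> = G x + real k * b + b" by (simp only: assms Suc)
  finally show ?case by (simp add: algebra_simps)
qed simp

lemma quasi_periodic_iterate_int:
  fixes G :: "real \<Rightarrow> real"
  assumes "\<And>x. G (x + a) = G x + b"
  shows "G (x + of_int k * a) = G x + of_int k * b"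
proof (cases "0 \<le> k")
  case True
  with quasi_periodic_iterate[where G = G, OF assms, where x = x and k = "nat k"] show ?thesis by simp
next
  case False
  with quasi_periodic_iterate[where G = G, OF assms, where x = "x + of_int k * a" and k = "nat (- k)"]
  show ?thesis by simp
qed

text \<open>The fixed gain b per turn makes G unbounded in both directions, hence onto. The inverse
  T recovers the orbit parameter from the angle.\<close>

lemma quasi_periodic_inverse:
  fixes G g :: "real \<Rightarrow> real"
  assumes G: "\<And>x. (G has_real_derivative g x) (at x)" and pos: "\<And>x. 0 < g x"
    and per: "\<And>x. G (x + a) = G x + b" and a: "0 < a"
  obtains T where "\<And>s. G (T s) = s" "\<And>x. T (G x) = x"
    "\<And>s. (T has_real_derivative 1 / g (T s)) (at s)"
    "\<And>s. T (s + b) = T s + a" "0 < b" "strict_mono T"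
proof -
  have mono: "G x < G y" if "x < y" for x y
    by (rule DERIV_pos_imp_increasing[OF that]) (metis G pos)
  have b: "0 < b" using mono[of 0 a] per[of 0] a by simp
  have cont: "isCont G x" for x using G by (rule DERIV_isCont)
  have surj: "\<exists>x. G x = s" for s
  proof -
    obtain k1 :: nat where k1: "s - G 0 < real k1 * b"
      using b by (meson ex_less_of_nat_mult)
    obtain k2 :: nat where k2: "G 0 - s < real k2 * b"
      using b by (meson ex_less_of_nat_mult)
    have "G (- (real k2 * a)) \<le> s"
      using quasi_periodic_iterate[where G = G, OF per, where x = "- (real k2 * a)" and k = k2] k2 by simp
    moreover have "s \<le> G (real k1 * a)"
      using quasi_periodic_iterate[where G = G, OF per, where x = 0 and k = k1] k1 by simp
    ultimately have "\<exists>x\<ge>- (real k2 * a). x \<le> real k1 * a \<and> G x = s"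
      using a cont by (intro IVT) (auto intro: order_trans[of _ 0])
    then show ?thesis by blast
  qed
  have inj: "G x = G y \<longleftrightarrow> x = y" for x y
    using mono by (metis less_irrefl linorder_neqE_linordered_idom)
  define T where "T s = (THE x. G x = s)" for s
  have TG: "T (G x) = x" for x unfolding T_def by (rule the_equality) (auto simp: inj)
  have GT: "G (T s) = s" for s using surj[of s] TG by metis
  have "isCont T s" for s
  proof -
    have "isCont T (G (T s))"
      by (rule isCont_inverse_function2[where f = G and a = "T s - 1" and b = "T s + 1"]) (auto simp: TG cont)
    then show ?thesis by (simp add: GT)
  qed
  then have dT: "(T has_real_derivative 1 / g (T s)) (at s)" for s
    using DERIV_inverse_function[where f = G and g = T and x = s and a = "s - 1" and b = "s + 1", OF G]
    by (simp add: GT inverse_eq_divide) (metis less_irrefl pos)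
  have perT: "T (s + b) = T s + a" for s
    using per[of "T s"] by (metis GT TG)
  have "strict_mono T"
    unfolding strict_mono_def using mono GT by (metis linorder_neqE_linordered_idom order_less_asym less_irrefl)
  with GT TG dT perT b that show thesis by blast
qed

text \<open>The coordinate y on the orbit, with y / sqrt(1 - y^2) = E cos t;
  \<open>orbit_tan\<close> is the matching w. The parameter t = 0 belongs to the maximum of u and t
  = pi to its minimum.\<close>

definition orbit_sin :: "real \<Rightarrow> real \<Rightarrow> real" where
  "orbit_sin E t = E * cos t / sqrt (1 + E\<^sup>2 * (cos t)\<^sup>2)"

definition orbit_tan :: "real \<Rightarrow> real \<Rightarrow> real" where
  "orbit_tan E t = - E * sin t / sqrt (1 + E\<^sup>2 * (cos t)\<^sup>2)"

lemma orbit_den_pos: "0 < 1 + E\<^sup>2 * (cos t)\<^sup>2" for E t :: real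
  by (intro add_pos_nonneg) auto

lemma orbit_sin_sq: "1 - (orbit_sin E t)\<^sup>2 = 1 / (1 + E\<^sup>2 * (cos t)\<^sup>2)"
  using orbit_den_pos[of E t] by (simp add: orbit_sin_def power_divide power_mult_distrib field_simps)

lemma orbit_tan_sq: "1 + (orbit_tan E t)\<^sup>2 = (1 + E\<^sup>2) * (1 - (orbit_sin E t)\<^sup>2)"
proof -
  have "1 + (orbit_tan E t)\<^sup>2 = (1 + E\<^sup>2 * ((cos t)\<^sup>2 + (sin t)\<^sup>2)) / (1 + E\<^sup>2 * (cos t)\<^sup>2)"
    using orbit_den_pos[of E t]
    by (simp add: orbit_tan_def power_divide power_mult_distrib field_simps del: sin_cos_squared_add2)
  then show ?thesis unfolding orbit_sin_sq by simp
qed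

lemma orbit_sin_abs_less: "\<bar>orbit_sin E t\<bar> < 1"
proof -
  have "0 < 1 - (orbit_sin E t)\<^sup>2"
    unfolding orbit_sin_sq using orbit_den_pos[of E t] by simp
  then show ?thesis by (simp add: abs_square_less_1)
qed

lemma sqrt_orbit_den_deriv:
  "((\<lambda>t. sqrt (1 + E\<^sup>2 * (cos t)\<^sup>2)) has_real_derivative - (E\<^sup>2 * cos t * sin t) / sqrt (1 + E\<^sup>2 * (cos t)\<^sup>2)) (at t)"
  using orbit_den_pos[of E t]
  by (auto intro!: derivative_eq_intros simp: field_simps)

text \<open>With \<open>orbit_tan_deriv\<close> this says y' = w (1 - y^2), w' = - y (1 + w^2), a
  system without p and q. The quotient (1 + w^2) / (1 - y^2) is constant along it, and its value is
  1 + E^2.\<close>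

lemma orbit_sin_deriv:
  "(orbit_sin E has_real_derivative orbit_tan E t * (1 - (orbit_sin E t)\<^sup>2)) (at t)"
proof -
  define r where "r = sqrt (1 + E\<^sup>2 * (cos t)\<^sup>2)"
  have r: "0 < r" "r * r = 1 + E\<^sup>2 * (cos t)\<^sup>2" using orbit_den_pos[of E t] by (auto simp: r_def)
  have eq: "orbit_sin E = (\<lambda>t. E * cos t / sqrt (1 + E\<^sup>2 * (cos t)\<^sup>2))" by (auto simp: orbit_sin_def)
  have "(orbit_sin E has_real_derivative
      ((E * (- sin t)) * r - (E * cos t) * (- (E\<^sup>2 * cos t * sin t) / r)) / (r * r)) (at t)"
    unfolding eq r_def
    by (intro DERIV_divide sqrt_orbit_den_deriv) (use orbit_den_pos[of E t] in \<open>auto intro!: derivative_eq_intros\<close>)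
  moreover have "((E * (- sin t)) * r - (E * cos t) * (- (E\<^sup>2 * cos t * sin t) / r)) / (r * r)
      = (- E * sin t * (r * r) + E * cos t * (E\<^sup>2 * cos t * sin t)) / (r * r * r)"
    using r(1) by (simp add: field_simps)
  moreover have "\<dots> = - E * sin t / (r * r * r)"
    unfolding r(2) by (simp add: algebra_simps power2_eq_square)
  moreover have "\<dots> = orbit_tan E t * (1 - (orbit_sin E t)\<^sup>2)"
    unfolding orbit_sin_sq orbit_tan_def r_def[symmetric] r(2)[symmetric] using r(1) by simp
  ultimately show ?thesis by simp
qed

lemma orbit_tan_deriv:
  "(orbit_tan E has_real_derivative - orbit_sin E t * (1 + (orbit_tan E t)\<^sup>2)) (at t)"
proof -
  define r where "r = sqrt (1 + E\<^sup>2 * (cos t)\<^sup>2)"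
  have r: "0 < r" "r * r = 1 + E\<^sup>2 * (cos t)\<^sup>2" using orbit_den_pos[of E t] by (auto simp: r_def)
  have eq: "orbit_tan E = (\<lambda>t. - E * sin t / sqrt (1 + E\<^sup>2 * (cos t)\<^sup>2))" by (auto simp: orbit_tan_def)
  have "(orbit_tan E has_real_derivative
      ((- E * cos t) * r - (- E * sin t) * (- (E\<^sup>2 * cos t * sin t) / r)) / (r * r)) (at t)"
    unfolding eq r_def
    by (intro DERIV_divide sqrt_orbit_den_deriv) (use orbit_den_pos[of E t] in \<open>auto intro!: derivative_eq_intros\<close>)
  moreover have "((- E * cos t) * r - (- E * sin t) * (- (E\<^sup>2 * cos t * sin t) / r)) / (r * r)
      = (- E * cos t * (r * r) - E * sin t * (E\<^sup>2 * cos t * sin t)) / (r * r * r)"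
    using r(1) by (simp add: field_simps)
  moreover have "- E * cos t * (r * r) - E * sin t * (E\<^sup>2 * cos t * sin t)
      = - E * cos t * (1 + E\<^sup>2 * ((cos t)\<^sup>2 + (sin t)\<^sup>2))"
    unfolding r(2) by (simp add: algebra_simps power2_eq_square del: sin_cos_squared_add sin_cos_squared_add2 sin_cos_squared_add3)
  moreover have "- E * cos t * (1 + E\<^sup>2) / (r * r * r) = - orbit_sin E t * (1 + (orbit_tan E t)\<^sup>2)"
    unfolding orbit_tan_sq orbit_sin_sq unfolding orbit_sin_def r_def[symmetric] r(2)[symmetric] using r(1) by simp
  ultimately show ?thesis by simp
qed

lemma orbit_sin_simps:
  "orbit_sin E (- t) = orbit_sin E t" "orbit_sin E (pi + t) = - orbit_sin E t"
  "orbit_sin E (pi - t) = - orbit_sin E t" "orbit_sin E (t + 2 * pi) = orbit_sin E t"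
  by (simp_all add: orbit_sin_def cos_add cos_diff)

lemma frac_sqrt_strict_mono:
  fixes x y :: real
  assumes "x < y"
  shows "x / sqrt (1 + x\<^sup>2) < y / sqrt (1 + y\<^sup>2)"
proof (rule DERIV_pos_imp_increasing[OF assms])
  fix t :: real
  have p: "0 < 1 + t\<^sup>2" by (simp add: add_pos_nonneg)
  define r where "r = sqrt (1 + t\<^sup>2)"
  have r: "0 < r" "r * r = 1 + t\<^sup>2" using p by (auto simp: r_def)
  have "((\<lambda>t. sqrt (1 + t\<^sup>2)) has_real_derivative t / r) (at t)"
    unfolding r_def using p by (auto intro!: derivative_eq_intros simp: field_simps)
  then have "((\<lambda>t. t / sqrt (1 + t\<^sup>2)) has_real_derivative (1 * r - t * (t / r)) / (r * r)) (at t)"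
    unfolding r_def by (intro DERIV_divide DERIV_ident) (use r in \<open>auto simp: r_def\<close>)
  moreover have "1 * r - t * (t / r) = (r * r - t\<^sup>2) / r" using r(1) by (simp add: field_simps power2_eq_square)
  then have "0 < (1 * r - t * (t / r)) / (r * r)" using r p by (simp add: zero_less_mult_iff)
  ultimately show "\<exists>d. ((\<lambda>t. t / sqrt (1 + t\<^sup>2)) has_real_derivative d) (at t) \<and> 0 < d" by blast
qed

lemma orbit_sin_eq: "orbit_sin E t = (E * cos t) / sqrt (1 + (E * cos t)\<^sup>2)"
  by (simp add: orbit_sin_def power_mult_distrib)

lemma orbit_sin_mono_E: "E < E' \<Longrightarrow> 0 < cos t \<Longrightarrow> orbit_sin E t < orbit_sin E' t"
  unfolding orbit_sin_eq by (intro frac_sqrt_strict_mono) simp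

lemma orbit_sin_less_iff:
  assumes "0 < E" shows "orbit_sin E s < orbit_sin E t \<longleftrightarrow> cos s < cos t"
proof -
  have "cos s < cos t \<Longrightarrow> orbit_sin E s < orbit_sin E t" for s t
    unfolding orbit_sin_eq using assms by (intro frac_sqrt_strict_mono) simp
  moreover have "cos s = cos t \<Longrightarrow> orbit_sin E s = orbit_sin E t" for s t
    by (simp add: orbit_sin_def)
  ultimately show ?thesis by (metis linorder_neqE_linordered_idom order_less_asym less_irrefl)
qed

lemma frac_sqrt_tendsto_1: "filterlim (\<lambda>x::real. x / sqrt (1 + x\<^sup>2)) (at_left 1) at_top"
  by real_asymp

section \<open>The period integral as a function of E\<close>

context weight_pair
begin

definition eta_int :: "real \<Rightarrow> real" where
  "eta_int E = integral {0..pi/2} (\<lambda>t. eta_sum (orbit_sin E t))"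

lemma eta_sum_isCont: "\<bar>y\<bar> < 1 \<Longrightarrow> isCont eta_sum y"
  unfolding eta_sum_def
  by (intro continuous_intros eta_isCont isCont_o2[where f = uminus and g = eta]) auto

lemma eta_sum_orbit_continuous: "continuous_on S (\<lambda>x. eta_sum (orbit_sin (fst x) (snd x)))"
proof (rule continuous_on_compose2[of "{-1<..<1}" eta_sum])
  show "continuous_on {-1<..<1} eta_sum"
    by (intro continuous_at_imp_continuous_on ballI eta_sum_isCont) auto
  show "continuous_on S (\<lambda>x. orbit_sin (fst x) (snd x))"
    unfolding orbit_sin_def
    by (intro continuous_intros) (use orbit_den_pos in \<open>auto simp: less_imp_neq[symmetric]\<close>)
  show "(\<lambda>x. orbit_sin (fst x) (snd x)) ` S \<subseteq> {-1<..<1}"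
    using orbit_sin_abs_less by (force simp: abs_less_iff)
qed

lemma eta_sum_orbit_continuous_t: "continuous_on S (\<lambda>t. eta_sum (orbit_sin E t))"
proof -
  have "continuous_on S (Pair E)" by (intro continuous_intros)
  from continuous_on_compose2[OF eta_sum_orbit_continuous[of UNIV] this] show ?thesis by simp
qed

lemma eta_int_continuous: "continuous_on UNIV eta_int"
proof -
  have "continuous_on UNIV (\<lambda>E. integral (cbox 0 (pi/2)) (\<lambda>t. eta_sum (orbit_sin E t)))"
    by (rule integral_continuous_on_param)
       (use eta_sum_orbit_continuous[of "UNIV \<times> cbox 0 (pi/2)"] in \<open>simp add: split_beta\<close>)
  then show ?thesis by (simp add: eta_int_def[abs_def])
qed

lemma eta_int_0: "eta_int 0 = pi * sqrt ((B + C) / 2)"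
  by (simp add: eta_int_def orbit_sin_def eta_sum_def eta_0)

lemma eta_int_strict_mono:
  assumes "\<And>z. z \<in> wdom B C \<Longrightarrow> 0 < s * wlin B C z" "0 \<le> E" "E < E'"
  shows "s * eta_int E < s * eta_int E'"
proof -
  have "integral {0..pi/2} (\<lambda>t. s * eta_sum (orbit_sin E t)) < integral {0..pi/2} (\<lambda>t. s * eta_sum (orbit_sin E' t))"
  proof (rule integral_less_real)
    fix t assume t: "t \<in> {0<..<pi/2}"
    then have c: "0 < cos t" by (intro cos_gt_zero_pi) auto
    have "0 \<le> orbit_sin E t" unfolding orbit_sin_def using c assms(2) by simp
    then show "s * eta_sum (orbit_sin E t) < s * eta_sum (orbit_sin E' t)"
      using orbit_sin_mono_E[OF assms(3) c] orbit_sin_abs_less[of E' t]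
      by (intro eta_sum_strict_mono assms(1)) auto
  qed (use pi_gt_zero in \<open>auto intro!: continuous_intros eta_sum_orbit_continuous_t simp del: pi_gt_zero\<close>)
  then show ?thesis by (simp add: eta_int_def)
qed

text \<open>For each t below pi/2 the coordinate y tends to 1, where the sum of the two eta values
  tends to B + C; dominated convergence does the rest.\<close>

lemma eta_int_tendsto: "(\<lambda>k. eta_int (real k)) \<longlonglongrightarrow> pi / 2 * (B + C)"
proof -
  obtain K where K: "\<And>y. \<bar>y\<bar> < 1 \<Longrightarrow> \<bar>eta_sum y\<bar> \<le> K" using eta_sum_bounded by blast
  \<comment> \<open>At t = pi/2 the cosine vanishes and y stays 0 for every k, so the pointwise
    limit differs at this one point, which the integral ignores.\<close>
  define h where "h t = (if t = pi/2 then eta_sum 0 else B + C)" for t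
  have lim: "(\<lambda>k. eta_int (real k)) \<longlonglongrightarrow> integral {0..pi/2} h"
    unfolding eta_int_def
  proof (rule dominated_convergence(2)[where h = "\<lambda>_. K"])
    fix t assume t: "t \<in> {0..pi/2}"
    show "(\<lambda>k. eta_sum (orbit_sin (real k) t)) \<longlonglongrightarrow> h t"
    proof (cases "t = pi/2")
      case True
      then have "cos t = 0" by (metis cos_pi_half)
      with True show ?thesis by (simp add: h_def orbit_sin_def)
    next
      case False
      with t have c: "0 < cos t" by (intro cos_gt_zero_pi) auto
      have "filterlim (\<lambda>k. real k * cos t) at_top sequentially"
        using c by real_asymp
      then have "filterlim (\<lambda>k. orbit_sin (real k) t) (at_left 1) sequentially"
        unfolding orbit_sin_eq by (rule filterlim_compose[OF frac_sqrt_tendsto_1])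
      with False show ?thesis
        by (simp add: h_def filterlim_compose[OF eta_sum_tendsto_1])
    qed
  next
    show "(\<lambda>t. eta_sum (orbit_sin (real k) t)) integrable_on {0..pi/2}" for k
      by (intro integrable_continuous_interval eta_sum_orbit_continuous_t)
  qed (use K orbit_sin_abs_less in auto)
  have "integral {0..pi/2} h = integral {0..pi/2} (\<lambda>_. B + C)"
    by (rule integral_spike[of "{pi/2}"]) (auto simp: h_def)
  with lim show ?thesis by simp
qed

lemma eta_int_attains:
  assumes "min (pi * sqrt ((B + C) / 2)) (pi / 2 * (B + C)) < c"
    and "c < max (pi * sqrt ((B + C) / 2)) (pi / 2 * (B + C))"
  obtains E where "0 < E" "eta_int E = c"
proof -
  define a where "a = pi * sqrt ((B + C) / 2)"
  define b where "b = pi / 2 * (B + C)"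
  have lim: "(\<lambda>k. eta_int (real k)) \<longlonglongrightarrow> b" using eta_int_tendsto by (simp add: b_def)
  have cont: "isCont eta_int x" for x
    using eta_int_continuous continuous_on_eq_continuous_at by blast
  consider "a < c" "c < b" | "b < c" "c < a"
    using assms by (fold a_def b_def) (auto simp: min_def max_def split: if_splits)
  then have "\<exists>E\<ge>0. eta_int E = c"
  proof cases
    case 1
    with lim have "\<forall>\<^sub>F k in sequentially. c < eta_int (real k)" by (simp add: order_tendsto_iff)
    then obtain k where "c < eta_int (real k)" by (auto simp: eventually_sequentially)
    then show ?thesis
      using IVT[of eta_int 0 c "real k"] cont 1 eta_int_0 by (auto simp: a_def)
  next
    case 2
    with lim have "\<forall>\<^sub>F k in sequentially. eta_int (real k) < c" by (simp add: order_tendsto_iff)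
    then obtain k where "eta_int (real k) < c" by (auto simp: eventually_sequentially)
    then show ?thesis
      using IVT2[of eta_int "real k" c 0] cont 2 eta_int_0 by (auto simp: a_def)
  qed
  then obtain E where E: "0 \<le> E" "eta_int E = c" by blast
  moreover have "E \<noteq> 0"
  proof
    assume "E = 0"
    then have "c = a" using E eta_int_0 by (simp add: a_def)
    then show False using assms by (fold a_def b_def) (auto simp: min_def max_def split: if_splits)
  qed
  ultimately show thesis using that[of E] by simp
qed

end

section \<open>The family of oscillating solutions\<close>

text \<open>With \<open>z\<close> as parameter, the derivatives of \<open>2 ln u\<close> and \<open>2 ln r\<close> are the numerator and the
  denominator of the fraction in \<open>ratio\<close>, both divided by \<open>dwell B C z\<close>, and \<open>ratio\<close> is the
  first integral \<open>r\<^sup>q\<^sup>-\<^sup>1 dr = u\<^sup>p\<^sup>-\<^sup>1 du\<close> up to a constant.\<close>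

locale curve_family = weight_pair +
  fixes p q k1 k2 :: real
  assumes pq: "p < q"
    and rise_pos: "\<And>z. z \<in> wdom B C \<Longrightarrow> 0 < k1 * (1 + B * z) + k2 * (1 - C * z)"
    and fall_pos: "\<And>z. z \<in> wdom B C \<Longrightarrow> 0 < k1 * (1 + B * z) + k2 * (1 - C * z) - (B + C) * z"
    and ratio: "\<And>z. z \<in> wdom B C \<Longrightarrow>
      2 * ln ((k1 * (1 + B * z) + k2 * (1 - C * z)) / (k1 * (1 + B * z) + k2 * (1 - C * z) - (B + C) * z))
      = ((q - p) * k2 + q) * slog B z + (q - (q - p) * k1) * slog C (- z)"
begin

definition rise :: "real \<Rightarrow> real" where
  "rise z = k1 * (1 + B * z) + k2 * (1 - C * z)"

definition fall :: "real \<Rightarrow> real" where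
  "fall z = rise z - (B + C) * z"

lemma rise_pos': "z \<in> wdom B C \<Longrightarrow> 0 < rise z" and fall_pos': "z \<in> wdom B C \<Longrightarrow> 0 < fall z"
  using rise_pos fall_pos by (auto simp: rise_def fall_def)

text \<open>ln u up to a constant that depends on the orbit.\<close>

definition height :: "real \<Rightarrow> real" where
  "height z = (k2 * slog B z - k1 * slog C (- z)) / 2"

lemma height_deriv:
  assumes "z \<in> wdom B C"
  shows "(height has_real_derivative rise z / (2 * dwell B C z)) (at z)"
proof -
  have p: "0 < 1 + B * z" "0 < 1 - C * z" using assms by (auto simp: wdom_def)
  have C: "((\<lambda>z. slog C (- z)) has_real_derivative 1 / (1 + C * (- z)) * (- 1)) (at z)"
  proof (rule DERIV_chain2[where f = "slog C" and g = uminus])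
    show "(slog C has_real_derivative 1 / (1 + C * (- z))) (at (- z))"
      by (rule slog_deriv) (use p in simp)
  qed (auto intro!: derivative_eq_intros)
  have "(height has_real_derivative (k2 * (1 / (1 + B * z)) - k1 * (1 / (1 + C * (- z)) * (- 1))) / 2) (at z)"
    unfolding height_def by (intro DERIV_cdivide DERIV_diff DERIV_cmult C slog_deriv p)
  moreover have "(k2 * (1 / (1 + B * z)) - k1 * (1 / (1 + C * (- z)) * (- 1))) / 2 = rise z / (2 * dwell B C z)"
    using p by (simp add: rise_def dwell_def field_simps)
  ultimately show ?thesis by (simp only:)
qed

lemma height_strict_mono:
  assumes "x \<in> wdom B C" "y \<in> wdom B C" "x < y"
  shows "height x < height y"
proof (rule DERIV_pos_imp_increasing[OF assms(3)])
  fix t assume "x \<le> t" "t \<le> y"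
  then have t: "t \<in> wdom B C" using wdom_between assms by blast
  then show "\<exists>d. (height has_real_derivative d) (at t) \<and> 0 < d"
    using height_deriv[OF t] rise_pos'[OF t] dwell_pos[OF t] by (metis divide_pos_pos mult_pos_pos zero_less_numeral)
qed

text \<open>The equation is not scale invariant for p < q, so the size of u on each orbit is
  determined. The subtracted constant is the one that cancels the factor (1 + E^2)^(-q/2) in
  \<open>support_powr\<close>.\<close>

definition support :: "real \<Rightarrow> real \<Rightarrow> real" where
  "support E z = exp (height z - q * ln (1 + E\<^sup>2) / (2 * (q - p)))"

lemma support_less_iff:
  assumes "x \<in> wdom B C" "y \<in> wdom B C"
  shows "support E x < support E y \<longleftrightarrow> x < y"
  using height_strict_mono assms by (auto simp: support_def) (metis linorder_neqE_linordered_idom order_less_asym)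

text \<open>With 1 + w^2 = (1 + E^2) F the left side is u^p / r^q. Its value turns the second
  equation of the system into w' = (1 + w^2) (fall / rise - 1).\<close>

lemma support_powr:
  assumes "z \<in> wdom B C"
  shows "support E z powr (p - q) * ((1 + E\<^sup>2) * well B C z) powr (- q / 2) = fall z / rise z"
proof -
  define H where "H = ln (1 + E\<^sup>2)"
  have H: "exp H = 1 + E\<^sup>2" unfolding H_def using one_plus_sq_pos by (rule exp_ln)
  have "ln (rise z / fall z) = ((q - p) * (2 * height z) + q * lwell B C z) / 2"
  proof -
    have "2 * ln (rise z / fall z) = ((q - p) * k2 + q) * slog B z + (q - (q - p) * k1) * slog C (- z)"
      using ratio[OF assms] unfolding rise_def fall_def .
    also have "\<dots> = (q - p) * (k2 * slog B z - k1 * slog C (- z)) + q * lwell B C z"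
      unfolding lwell_def by (simp add: algebra_simps)
    also have "k2 * slog B z - k1 * slog C (- z) = 2 * height z" by (simp add: height_def)
    finally show ?thesis by simp
  qed
  moreover have "fall z / rise z = exp (- ln (rise z / fall z))"
    using rise_pos'[OF assms] fall_pos'[OF assms] by (simp add: exp_minus)
  moreover have "support E z powr (p - q) = exp ((p - q) * (height z - q * H / (2 * (q - p))))"
    by (simp add: support_def powr_def H_def)
  moreover have "((1 + E\<^sup>2) * well B C z) powr (- q / 2) = exp (- q / 2 * (H + lwell B C z))"
    unfolding H[symmetric] well_def exp_add[symmetric] by (simp add: powr_def)
  moreover have "(p - q) * (height z - q * H / (2 * (q - p))) + - q / 2 * (H + lwell B C z)
      = - (((q - p) * (2 * height z) + q * lwell B C z) / 2)"
    using pq by (simp add: field_simps)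
  ultimately show ?thesis by (simp add: exp_add[symmetric])
qed

text \<open>The derivative of the angle with respect to t: on the orbit dw/dt = - y (1 + w^2), while
  the solution requires dw/dtheta = - (1 + w^2) (B + C) z / rise, and y / z = eta.\<close>

definition rate :: "real \<Rightarrow> real \<Rightarrow> real" where
  "rate E t = rise (winv B C (orbit_sin E t)) * eta (orbit_sin E t) / (B + C)"

lemma rate_pos: "0 < rate E t"
  unfolding rate_def
  using orbit_sin_abs_less[of E t] sum_pos by (intro divide_pos_pos mult_pos_pos rise_pos' winv eta_pos)

lemma rate_eq: "rate E t = ((k1 + k2) * eta (orbit_sin E t) + (k1 * B - k2 * C) * orbit_sin E t) / (B + C)"
proof -
  have "rise z * e = (k1 + k2) * e + (k1 * B - k2 * C) * (z * e)" for z e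
    by (simp add: rise_def algebra_simps)
  from this[of "winv B C (orbit_sin E t)" "eta (orbit_sin E t)"] winv_eta[OF orbit_sin_abs_less[of E t]]
  show ?thesis by (simp add: rate_def)
qed

lemma rate_continuous: "continuous_on S (rate E)"
proof -
  have "continuous_on S (\<lambda>t. eta (orbit_sin E t))"
    by (intro continuous_at_imp_continuous_on ballI isCont_o2[OF DERIV_isCont[OF orbit_sin_deriv]] eta_isCont orbit_sin_abs_less)
  moreover have "continuous_on S (orbit_sin E)"
    by (intro continuous_at_imp_continuous_on ballI DERIV_isCont[OF orbit_sin_deriv])
  ultimately show ?thesis
    unfolding rate_eq[abs_def] using sum_pos by (intro continuous_intros) auto
qed

text \<open>The four points carry the values y, y, -y, -y, so the terms linear in y from
  \<open>rate_eq\<close> cancel and only the even part of eta is left.\<close>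

lemma rate_symmetrized:
  "rate E t + rate E (- t) + rate E (pi + t) + rate E (pi - t) = 2 * (k1 + k2) / (B + C) * eta_sum (orbit_sin E t)"
  unfolding rate_eq orbit_sin_simps eta_sum_def
  by (simp only: add_divide_distrib[symmetric] times_divide_eq_left) (simp add: algebra_simps)

definition period :: "real \<Rightarrow> real" where
  "period E = 2 * (k1 + k2) / (B + C) * eta_int E"

lemma angle_exists:
  obtains G where "\<And>t. (G has_real_derivative rate E t) (at t)" "G 0 = 0" "\<And>t. G (t + 2 * pi) = G t + period E"
proof -
  obtain G0 where G0: "\<And>t. (G0 has_real_derivative rate E t) (at t)"
    using continuous_antiderivative[OF rate_continuous] by blast
  define G where "G t = G0 t - G0 0" for t
  have G: "(G has_real_derivative rate E t) (at t)" for t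
    unfolding G_def using G0[of t] by (auto intro!: derivative_eq_intros)
  have chain: "((\<lambda>t. G (h t)) has_real_derivative rate E (h t) * h') (at t)"
    if "(h has_real_derivative h') (at t)" for h h' t
    using DERIV_chain2[OF G that] .
  have "((\<lambda>t. G (t + 2 * pi) - G t) has_real_derivative 0) (at t)" for t
  proof -
    have "((\<lambda>t. G (t + 2 * pi) - G t) has_real_derivative rate E (t + 2 * pi) * 1 - rate E t) (at t)"
      by (intro DERIV_diff chain G) (auto intro!: derivative_eq_intros)
    then show ?thesis by (simp add: rate_def orbit_sin_simps)
  qed
  then have const: "G (t + 2 * pi) - G t = G (s + 2 * pi) - G s" for s t
    using DERIV_isconst_all[of "\<lambda>t. G (t + 2 * pi) - G t" t s] by blast
  \<comment> \<open>The four terms fold a full turn from -pi/2 to 3 pi/2 onto the quarter from 0 to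
    pi/2, so the growth of \<open>R\<close> there is the gain of \<open>G\<close> over the
    turn.\<close>
  define R where "R t = G t - G (- t) + G (pi + t) - G (pi - t)" for t
  have R: "(R has_real_derivative 2 * (k1 + k2) / (B + C) * eta_sum (orbit_sin E t)) (at t)" for t
  proof -
    have "(R has_real_derivative rate E t - rate E (- t) * (- 1) + rate E (pi + t) * 1 - rate E (pi - t) * (- 1)) (at t)"
      unfolding R_def by (intro DERIV_diff DERIV_add chain G) (auto intro!: derivative_eq_intros)
    then show ?thesis unfolding rate_symmetrized[symmetric] by simp
  qed
  have "((\<lambda>t. 2 * (k1 + k2) / (B + C) * eta_sum (orbit_sin E t)) has_integral R (pi/2) - R 0) {0..pi/2}"
    by (rule fundamental_theorem_of_calculus)
       (use R in \<open>auto simp: has_real_derivative_iff_has_vector_derivative[symmetric] intro: has_field_derivative_at_within\<close>)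
  moreover have "((\<lambda>t. 2 * (k1 + k2) / (B + C) * eta_sum (orbit_sin E t)) has_integral period E) {0..pi/2}"
    unfolding period_def eta_int_def
    by (intro has_integral_mult_right integrable_integral integrable_continuous_interval eta_sum_orbit_continuous_t)
  ultimately have "R (pi/2) - R 0 = period E" by (rule has_integral_unique)
  moreover have "R (pi/2) - R 0 = G (- (pi/2) + 2 * pi) - G (- (pi/2))"
    by (simp add: R_def)
  ultimately have "G (t + 2 * pi) = G t + period E" for t
    using const[of t "- (pi/2)"] by simp
  with G show thesis by (intro that[of G]) (auto simp: G_def)
qed

definition oscillation :: "real \<Rightarrow> (real \<Rightarrow> real) \<Rightarrow> (real \<Rightarrow> real) \<Rightarrow> bool" where
  "oscillation E u w \<longleftrightarrow> polar_sol p q u w \<and> w 0 = 0 \<and> u 0 = support E (winv B C (orbit_sin E 0)) \<and>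
     (\<forall>x. u (x + period E) = u x) \<and> (\<forall>x. u x = u 0 \<longleftrightarrow> (\<exists>k::int. x = of_int k * period E)) \<and>
     (\<forall>x. local_max_point u x \<longleftrightarrow> (\<exists>k::int. x = of_int k * period E)) \<and> 0 < period E"

lemma oscillation_exists:
  assumes E: "0 < E"
  shows "\<exists>u w. oscillation E u w"
proof -
  obtain G where G: "\<And>t. (G has_real_derivative rate E t) (at t)" "G 0 = 0" "\<And>t. G (t + 2 * pi) = G t + period E"
    using angle_exists by blast
  obtain T where T: "\<And>s. G (T s) = s" "\<And>x. T (G x) = x" "\<And>s. (T has_real_derivative 1 / rate E (T s)) (at s)"
    "\<And>s. T (s + period E) = T s + 2 * pi" "0 < period E" "strict_mono T"
    using quasi_periodic_inverse[OF G(1) rate_pos G(3)] by (metis pi_gt_zero mult_pos_pos zero_less_numeral)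
  define y where "y s = orbit_sin E (T s)" for s
  define z where "z s = winv B C (y s)" for s
  define u where "u s = support E (z s)" for s
  define w where "w s = orbit_tan E (T s)" for s
  have y: "\<bar>y s\<bar> < 1" for s unfolding y_def by (rule orbit_sin_abs_less)
  have z: "z s \<in> wdom B C" "wroot B C (z s) = y s" for s unfolding z_def using winv[OF y] by auto
  have F: "well B C (z s) = 1 - (y s)\<^sup>2" for s
    using wroot_sq[OF sum_pos z(1), of s] z(2)[of s] by simp
  have w2: "1 + (w s)\<^sup>2 = (1 + E\<^sup>2) * well B C (z s)" for s
    unfolding w_def F y_def by (rule orbit_tan_sq)
  have rt: "rate E (T s) = rise (z s) * eta (y s) / (B + C)" for s
    by (simp add: rate_def z_def y_def)
  have ze: "z s * eta (y s) = y s" for s unfolding z_def by (rule winv_eta[OF y])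
  have du: "(u has_real_derivative u s * w s) (at s)" for s
  proof -
    have "(y has_real_derivative w s * well B C (z s) * (1 / rate E (T s))) (at s)"
      unfolding F unfolding y_def w_def
      by (intro DERIV_chain2[where f = "orbit_sin E"] orbit_sin_deriv T)
    then have "(z has_real_derivative (2 * eta (y s) * dwell B C (z s) / ((B + C) * well B C (z s))) *
        (w s * well B C (z s) * (1 / rate E (T s)))) (at s)"
      unfolding z_def by (intro DERIV_chain2[where f = "winv B C"] winv_deriv[OF y])
    then have "(u has_real_derivative (u s * (rise (z s) / (2 * dwell B C (z s)))) * ((2 * eta (y s) * dwell B C (z s) / ((B + C) * well B C (z s))) *
        (w s * well B C (z s) * (1 / rate E (T s))))) (at s)"
      unfolding u_def support_def[abs_def]
      by (intro DERIV_chain2[where f = "\<lambda>z. exp (height z - q * ln (1 + E\<^sup>2) / (2 * (q - p)))" and g = z])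
         (auto intro!: derivative_eq_intros height_deriv z)
    moreover have "(u s * (rise (z s) / (2 * dwell B C (z s)))) * ((2 * eta (y s) * dwell B C (z s) / ((B + C) * well B C (z s))) *
        (w s * well B C (z s) * (1 / rate E (T s)))) = u s * w s"
    proof -
      have alg: "(a * (r / (2 * d))) * ((2 * e * d / (k * f)) * (v * f * (1 / (r * e / k)))) = a * v"
        if "0 < r" "0 < d" "0 < k" "0 < f" "0 < e" for a r d e k f v :: real
        using that by (simp add: field_simps)
      show ?thesis
        unfolding rt by (rule alg[OF rise_pos'[OF z(1)] dwell_pos[OF z(1)] sum_pos well_pos eta_pos[OF y]])
    qed
    ultimately show ?thesis by simp
  qed
  have dw: "(w has_real_derivative u s powr (p - q) * (1 + (w s)\<^sup>2) powr (1 - q / 2) - (1 + (w s)\<^sup>2)) (at s)" for s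
  proof -
    have "(w has_real_derivative - y s * (1 + (w s)\<^sup>2) * (1 / rate E (T s))) (at s)"
      unfolding y_def w_def by (intro DERIV_chain2[where f = "orbit_tan E"] orbit_tan_deriv T)
    \<comment> \<open>Since z eta = y and fall = rise - (B + C) z, dividing by the rate turns -y
      into fall / rise - 1.\<close>
    moreover have "- y s * (1 + (w s)\<^sup>2) * (1 / rate E (T s)) = (1 + (w s)\<^sup>2) * (fall (z s) / rise (z s) - 1)"
    proof -
      have "- (a * e) * v * (1 / (r * e / k)) = v * ((r - k * a) / r - 1)"
        if "0 < r" "0 < k" "0 < e" for a r e k v :: real
        using that by (simp add: field_simps)
      from this[OF rise_pos'[OF z(1)[of s]] sum_pos eta_pos[OF y[of s]], of "z s" "1 + (w s)\<^sup>2"]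
      show ?thesis unfolding rt ze fall_def .
    qed
    moreover have "u s powr (p - q) * (1 + (w s)\<^sup>2) powr (1 - q / 2) = (1 + (w s)\<^sup>2) * (fall (z s) / rise (z s))"
    proof -
      have "(1 + (w s)\<^sup>2) powr (1 - q / 2) = (1 + (w s)\<^sup>2) powr 1 * (1 + (w s)\<^sup>2) powr (- q / 2)"
        unfolding powr_add[symmetric] by simp
      also have "(1 + (w s)\<^sup>2) powr 1 = 1 + (w s)\<^sup>2" using one_plus_sq_pos by simp
      finally show ?thesis
        using support_powr[OF z(1), of E s] by (simp add: u_def w2 mult_ac)
    qed
    ultimately show ?thesis by (simp add: right_diff_distrib)
  qed
  have sol: "polar_sol p q u w"
    unfolding polar_sol_def using du dw by (auto simp: u_def support_def)
  have T0: "T 0 = 0" using T(2)[of 0] G(2) by simp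
  \<comment> \<open>u is increasing in z, z in y, and y in cos t, so the level sets and extrema of u
    are those of the cosine of \<open>T\<close>.\<close>
  have less: "u s < u s' \<longleftrightarrow> cos (T s) < cos (T s')" for s s'
  proof -
    have "u s < u s' \<longleftrightarrow> z s < z s'" unfolding u_def by (rule support_less_iff[OF z(1) z(1)])
    also have "\<dots> \<longleftrightarrow> y s < y s'" unfolding z_def by (rule winv_less_iff[OF y y])
    also have "\<dots> \<longleftrightarrow> cos (T s) < cos (T s')" unfolding y_def by (rule orbit_sin_less_iff[OF E])
    finally show ?thesis .
  qed
  have G2pi: "G (of_int k * (2 * pi)) = of_int k * period E" for k
    using quasi_periodic_iterate_int[where G = G, OF G(3), of 0 k] G(2) by simp
  have cos1: "cos (T s) = 1 \<longleftrightarrow> (\<exists>k::int. s = of_int k * period E)" for s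
  proof
    assume "cos (T s) = 1"
    then obtain k :: int where "T s = of_int k * (2 * pi)" by (auto simp: cos_one_2pi_int)
    then have "s = of_int k * period E" using G2pi[of k] T(1)[of s] by simp
    then show "\<exists>k::int. s = of_int k * period E" by blast
  next
    assume "\<exists>k::int. s = of_int k * period E"
    then obtain k :: int where "s = of_int k * period E" by blast
    then have "T s = of_int k * (2 * pi)" using G2pi[of k] T(2) by metis
    then show "cos (T s) = 1" by (auto simp: cos_one_2pi_int)
  qed
  have eq0: "u s = u 0 \<longleftrightarrow> cos (T s) = 1" for s
  proof -
    have "cos (T s) < 1 \<or> cos (T s) = 1" using cos_le_one[of "T s"] by linarith
    then show ?thesis using less[of s 0] less[of 0 s] by (auto simp: T0)
  qed
  have max: "local_max_point u s \<longleftrightarrow> cos (T s) = 1" for s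
  proof
    assume "cos (T s) = 1"
    then have "u s' \<le> u s" for s' using less[of s s'] cos_le_one[of "T s'"] by auto
    then show "local_max_point u s" unfolding local_max_point_def using zero_less_one by blast
  next
    assume "local_max_point u s"
    then obtain e where e: "0 < e" "\<And>s'. \<bar>s' - s\<bar> < e \<Longrightarrow> u s' \<le> u s"
      by (auto simp: local_max_point_def)
    have "u s * w s = 0"
      by (rule DERIV_local_max[OF du e(1)]) (use e in \<open>simp add: abs_minus_commute\<close>)
    then have "w s = 0" using polar_solD(1)[OF sol, of s] by simp
    then have sin0: "sin (T s) = 0"
      using E orbit_den_pos[of E "T s"] by (simp add: w_def orbit_tan_def)
    \<comment> \<open>The remaining critical points have cosine -1. They are minima: a slightly
      larger angle, with \<open>T\<close> advancing by less than pi, already has larger u.\<close>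
    show "cos (T s) = 1"
    proof (rule ccontr)
      assume "cos (T s) \<noteq> 1"
      with sin0 have c: "cos (T s) = - 1"
        using sin_cos_squared_add[of "T s"] by (simp add: power2_eq_1_iff)
      have "isCont T s" by (rule DERIV_isCont[OF T(3)])
      then obtain d where d: "0 < d" "\<And>s'. dist s' s < d \<Longrightarrow> dist (T s') (T s) < pi"
        unfolding continuous_at_eps_delta using pi_gt_zero by blast
      define s' where "s' = s + min e d / 2"
      have s': "s < s'" "\<bar>s' - s\<bar> < e" "dist s' s < d" using e d by (auto simp: s'_def dist_real_def)
      have dT: "0 < T s' - T s" "T s' - T s < pi"
        using T(6) s'(1) d(2)[OF s'(3)] by (auto simp: strict_mono_def dist_real_def)
      have "cos (T s') = cos (T s + (T s' - T s))" by simp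
      also have "\<dots> = - cos (T s' - T s)" unfolding cos_add c sin0 by simp
      also have "\<dots> > - 1" using cos_monotone_0_pi[of 0 "T s' - T s"] dT by simp
      finally have "u s < u s'" using less[of s s'] c by simp
      with e(2)[OF s'(2)] show False by simp
    qed
  qed
  have "u (x + period E) = u x" for x
    by (simp add: u_def z_def y_def T(4) orbit_sin_simps)
  moreover have "w 0 = 0" "u 0 = support E (winv B C (orbit_sin E 0))"
    by (simp_all add: w_def orbit_tan_def u_def z_def y_def T0)
  ultimately have "oscillation E u w"
    unfolding oscillation_def using sol eq0 max cos1 T(5) by blast
  then show ?thesis by blast
qed

text \<open>At a maximum w = 0, so (1 + E^2) F = 1 there. This ties E to z, and
  \<open>support_powr\<close> then fixes u through an injective power.\<close>

lemma maximum_attained: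
  assumes "z \<in> wdom B C" "0 < z" "0 < M" "M powr (q - p) = rise z / fall z"
  obtains E where "0 < E" "support E (winv B C (orbit_sin E 0)) = M"
proof -
  define y where "y = wroot B C z"
  have y: "0 < y" "y < 1"
    using wroot_strict_mono[OF sum_pos _ assms(1,2)] wroot_abs_less_1[OF sum_pos assms(1)] by (auto simp: y_def)
  then have y2: "y\<^sup>2 < 1" by (simp add: abs_square_less_1)
  \<comment> \<open>Solves E / sqrt(1 + E^2) = y, the value of \<open>orbit_sin\<close> at t =
    0.\<close>
  define E where "E = y / sqrt (1 - y\<^sup>2)"
  have E: "0 < E" using y y2 by (simp add: E_def)
  have E2: "1 + E\<^sup>2 = 1 / (1 - y\<^sup>2)" using y2 by (simp add: E_def power_divide field_simps)
  have "orbit_sin E 0 = y"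
    using y2 by (simp add: orbit_sin_def E2 real_sqrt_divide) (simp add: E_def)
  then have z: "winv B C (orbit_sin E 0) = z" using winv_unique[OF assms(1)] by (simp add: y_def)
  have "well B C z = 1 - y\<^sup>2"
    using wroot_sq[OF sum_pos assms(1)] by (simp add: y_def)
  then have "(1 + E\<^sup>2) * well B C z = 1"
    unfolding E2 using y2 by simp
  then have "support E z powr (p - q) = fall z / rise z"
    using support_powr[OF assms(1), of E] by simp
  also have "\<dots> = inverse (M powr (q - p))" unfolding assms(4) by simp
  also have "\<dots> = M powr (p - q)" by (simp add: powr_minus[symmetric])
  finally have "(support E z powr (p - q)) powr (1 / (p - q)) = (M powr (p - q)) powr (1 / (p - q))" by simp
  then have "support E z = M"
    using pq assms(3) by (simp add: powr_powr support_def)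
  with z E show thesis by (intro that) auto
qed

end

section \<open>Immersed solutions\<close>

lemma polar_sol_shift:
  assumes "polar_sol p q u w"
  shows "polar_sol p q (\<lambda>x. u (x + c)) (\<lambda>x. w (x + c))"
proof -
  have "((\<lambda>x. f (x + c)) has_real_derivative d) (at x)" if "(f has_real_derivative d) (at (x + c))" for f d x
    using that by (simp add: DERIV_shift)
  then show ?thesis using assms by (simp add: polar_sol_def)
qed

lemma polar_sol_const: "0 < c \<Longrightarrow> c powr (p - q) = 1 \<Longrightarrow> polar_sol p q (\<lambda>_. c) (\<lambda>_. 0)"
  by (simp add: polar_sol_def)

text \<open>At a maximum w = 0, so w' = u^(p - q) - 1. Were this positive, w would be positive just
  to the right and u would increase beyond its maximum.\<close>

lemma polar_sol_at_max:
  assumes s: "polar_sol p q u w" and max: "\<And>x. u x \<le> u a"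
  shows "w a = 0" "u a powr (p - q) \<le> 1"
proof -
  note U = polar_solD[OF s]
  have "u a * w a = 0"
    by (rule DERIV_local_max[OF U(2) zero_less_one]) (use max in auto)
  then show wa: "w a = 0" using U(1)[of a] by simp
  show "u a powr (p - q) \<le> 1"
  proof (rule ccontr)
    assume "\<not> u a powr (p - q) \<le> 1"
    then have "0 < u a powr (p - q) * (1 + (w a)\<^sup>2) powr (1 - q / 2) - (1 + (w a)\<^sup>2)" using wa by simp
    from DERIV_pos_inc_right[OF U(3) this]
    obtain d where d: "0 < d" "\<And>h. 0 < h \<Longrightarrow> h < d \<Longrightarrow> 0 < w (a + h)" using wa by auto
    have "u a < u (a + d / 2)"
    proof (rule DERIV_pos_imp_increasing_open[where f = u])
      fix x assume "a < x" "x < a + d / 2"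
      then have "0 < w x" using d(2)[of "x - a"] d(1) by simp
      with U(1,2)[of x] show "\<exists>y. (u has_real_derivative y) (at x) \<and> 0 < y" by (meson mult_pos_pos)
    qed (use d U(2) in \<open>auto intro!: continuous_at_imp_continuous_on DERIV_isCont\<close>)
    with max[of "a + d / 2"] show False by simp
  qed
qed

lemma polar_sol_at_min:
  assumes s: "polar_sol p q u w" and min: "\<And>x. u a \<le> u x"
  shows "w a = 0" "1 \<le> u a powr (p - q)"
proof -
  note U = polar_solD[OF s]
  have "u a * w a = 0"
    by (rule DERIV_local_min[OF U(2) zero_less_one]) (use min in auto)
  then show wa: "w a = 0" using U(1)[of a] by simp
  show "1 \<le> u a powr (p - q)"
  proof (rule ccontr)
    assume "\<not> 1 \<le> u a powr (p - q)"
    then have "u a powr (p - q) * (1 + (w a)\<^sup>2) powr (1 - q / 2) - (1 + (w a)\<^sup>2) < 0" using wa by simp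
    from DERIV_neg_dec_right[OF U(3) this]
    obtain d where d: "0 < d" "\<And>h. 0 < h \<Longrightarrow> h < d \<Longrightarrow> w (a + h) < 0" using wa by auto
    have "u (a + d / 2) < u a"
    proof (rule DERIV_neg_imp_decreasing_open[where f = u])
      fix x assume "a < x" "x < a + d / 2"
      then have "w x < 0" using d(2)[of "x - a"] d(1) by simp
      with U(1,2)[of x] show "\<exists>y. (u has_real_derivative y) (at x) \<and> y < 0" by (meson mult_pos_neg)
    qed (use d U(2) in \<open>auto intro!: continuous_at_imp_continuous_on DERIV_isCont\<close>)
    with min[of "a + d / 2"] show False by simp
  qed
qed

lemma periodic_attains_extrema:
  fixes u :: "real \<Rightarrow> real"
  assumes cont: "continuous_on UNIV u" and per: "\<And>x. u (x + T) = u x" and T: "0 < T"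
  obtains a b where "\<And>x. u x \<le> u a" "\<And>x. u b \<le> u x"
proof -
  have red: "\<exists>y\<in>{0..T}. u x = u y" for x
  proof (intro bexI)
    have "u (x + of_int (- \<lfloor>x / T\<rfloor>) * T) = u x + of_int (- \<lfloor>x / T\<rfloor>) * 0"
      by (rule quasi_periodic_iterate_int) (simp add: per)
    then show "u x = u (x - of_int \<lfloor>x / T\<rfloor> * T)" by simp
    show "x - of_int \<lfloor>x / T\<rfloor> * T \<in> {0..T}"
      using floor_divide_lower[OF T, of x] floor_divide_upper[OF T, of x] by (auto simp: distrib_right)
  qed
  have c: "continuous_on {0..T} u" by (rule continuous_on_subset[OF cont]) simp
  obtain a where "a \<in> {0..T}" "\<And>y. y \<in> {0..T} \<Longrightarrow> u y \<le> u a"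
    using continuous_attains_sup[OF _ _ c] T by fastforce
  moreover obtain b where "b \<in> {0..T}" "\<And>y. y \<in> {0..T} \<Longrightarrow> u b \<le> u y"
    using continuous_attains_inf[OF _ _ c] T by fastforce
  ultimately show thesis using that red by metis
qed

lemma immersed_extrema:
  assumes "immersed_solution_n p q n u"
  shows "\<exists>a b. (\<forall>x. u x \<le> u a) \<and> (\<forall>x. u b \<le> u x)"
proof (rule periodic_attains_extrema[of u "2 * pi * real n"])
  show "continuous_on UNIV u"
    using polar_solD(2)[OF immersed_polar_sol[OF assms]]
    by (auto intro!: continuous_at_imp_continuous_on DERIV_isCont)
  show "u (x + 2 * pi * real n) = u x" for x
    using assms by (simp add: immersed_solution_n_def periodic_with_def)
  show "0 < 2 * pi * real n" using assms by (simp add: immersed_solution_n_def)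
qed blast

text \<open>The value at the maximum is an equilibrium, and w = 0 there, so uniqueness identifies u
  with the constant solution.\<close>

lemma immersed_constant:
  assumes "immersed_solution_n p q n u" "\<And>x. u x \<le> u a" "u a powr (p - q) = 1"
  shows "u x = u a"
proof -
  note s = immersed_polar_sol[OF assms(1)]
  from polar_sol_unique[OF s polar_sol_const[OF polar_solD(1)[OF s, of a] assms(3)], of a]
  show ?thesis using polar_sol_at_max(1)[OF s assms(2)] by simp
qed

text \<open>u^(p - q) is at most 1 at the maximum and at least 1 at the minimum, while for p >= q
  this power is nondecreasing in u; so both values are 1.\<close>

lemma immersed_constant_if_ge:
  assumes "q \<le> p" "immersed_solution p q u"
  shows "is_constant_fun u"
proof -
  obtain n where n: "immersed_solution_n p q n u" using assms(2) by (auto simp: immersed_solution_def)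
  obtain a b where ab: "\<And>x. u x \<le> u a" "\<And>x. u b \<le> u x" using immersed_extrema[OF n] by metis
  note s = immersed_polar_sol[OF n]
  have pos: "0 < u x" for x using polar_solD(1)[OF s] .
  have "u a powr (p - q) \<le> 1" "1 \<le> u b powr (p - q)"
    using polar_sol_at_max(2)[OF s ab(1)] polar_sol_at_min(2)[OF s ab(2)] by auto
  moreover have "u b powr (p - q) \<le> u a powr (p - q)"
    using assms(1) ab pos[of b] by (intro powr_mono2) auto
  ultimately have "u a powr (p - q) = 1" by simp
  from immersed_constant[OF n ab(1) this] show ?thesis by (auto simp: is_constant_fun_def)
qed

lemma immersed_max_ge_1:
  assumes "p < q" "immersed_solution_n p q n u" "\<And>x. u x \<le> u a"
  shows "1 \<le> u a"
proof (rule ccontr)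
  assume "\<not> 1 \<le> u a"
  note s = immersed_polar_sol[OF assms(2)]
  have "1 < u a powr (p - q)"
    using \<open>\<not> 1 \<le> u a\<close> polar_solD(1)[OF s, of a] assms(1)
    by (simp add: powr_def mult_neg_neg)
  then show False using polar_sol_at_max(2)[OF s assms(3)] by simp
qed

text \<open>\<open>J\<close> is r^q / q - u^p / p with r^2 = u^2 (1 + w^2).\<close>

lemma polar_first_integral:
  assumes s: "polar_sol p q u w" and pq: "p \<noteq> 0" "q \<noteq> 0"
  defines "J \<equiv> \<lambda>x. u x powr q * (1 + (w x)\<^sup>2) powr (q / 2) / q - u x powr p / p"
  shows "J x = J y"
proof -
  note U = polar_solD[OF s]
  have "(J has_real_derivative 0) (at x)" for x
  proof -
    define X where "X = u x"
    define S where "S = 1 + (w x)\<^sup>2"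
    have pos: "0 < X" "0 < S" unfolding X_def S_def by (auto simp: U one_plus_sq_pos)
    have du: "((\<lambda>x. u x powr a) has_real_derivative a * X powr a * w x) (at x)" for a
    proof -
      have "((\<lambda>x. u x powr a) has_real_derivative (a * u x powr (a - 1)) * (u x * w x)) (at x)"
        by (intro DERIV_chain2[where f = "\<lambda>x. x powr a", OF _ U(2)] has_real_derivative_powr U(1))
      moreover have "u x powr a = u x powr (a - 1) * u x"
        using U(1)[of x] by (simp add: powr_mult_base mult.commute)
      ultimately show ?thesis by (simp add: mult_ac X_def)
    qed
    have dS: "((\<lambda>x. (1 + (w x)\<^sup>2) powr (q / 2)) has_real_derivative
        (q / 2 * S powr (q / 2 - 1)) * (2 * w x * (X powr (p - q) * S powr (1 - q / 2) - S))) (at x)"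
      unfolding S_def
      by (intro DERIV_chain2[where f = "\<lambda>x. x powr (q / 2)"] has_real_derivative_powr one_plus_sq_pos)
         (auto intro!: derivative_eq_intros U simp: X_def)
    have "(J has_real_derivative
      ((q * X powr q * w x) * S powr (q / 2) +
       ((q / 2 * S powr (q / 2 - 1)) * (2 * w x * (X powr (p - q) * S powr (1 - q / 2) - S))) * X powr q) / q
      - (p * X powr p * w x) / p) (at x)"
      unfolding J_def
      using DERIV_diff[OF DERIV_cdivide[OF DERIV_mult[OF du[of q] dS], of q] DERIV_cdivide[OF du[of p], of p]]
      by (simp add: X_def S_def)
    moreover have "((q * X powr q * w x) * S powr (q / 2) +
       ((q / 2 * S powr (q / 2 - 1)) * (2 * w x * (X powr (p - q) * S powr (1 - q / 2) - S))) * X powr q) / q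
      - (p * X powr p * w x) / p = 0"
    proof -
      have 1: "S powr (q / 2 - 1) * S powr (1 - q / 2) = 1" "X powr (p - q) * X powr q = X powr p"
        "S powr (q / 2 - 1) * S = S powr (q / 2)"
        using pos by (simp_all add: powr_add[symmetric] powr_mult_base mult.commute[of _ S])
      have "((q / 2 * S powr (q / 2 - 1)) * (2 * w x * (X powr (p - q) * S powr (1 - q / 2) - S))) * X powr q
        = q * w x * ((S powr (q / 2 - 1) * S powr (1 - q / 2)) * (X powr (p - q) * X powr q) - (S powr (q / 2 - 1) * S) * X powr q)"
        by (simp add: algebra_simps)
      also have "\<dots> = q * w x * (X powr p - S powr (q / 2) * X powr q)" unfolding 1 by simp
      finally show ?thesis using pq by (simp add: field_simps)
    qed
    ultimately show ?thesis by simp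
  qed
  then show ?thesis using DERIV_isconst_all by blast
qed

text \<open>At an extremum the first integral is u^p (u^(q-p) / q - 1/p). It is negative at the
  minimum, where u^(q-p) <= 1 < q/p, hence also at the maximum.\<close>

lemma immersed_max_less:
  assumes "0 < p" "p < q" "immersed_solution_n p q n u" "\<And>x. u x \<le> u a"
  shows "u a powr (q - p) < q / p"
proof -
  note s = immersed_polar_sol[OF assms(3)]
  obtain a' b where "\<And>x. u x \<le> u a'" and b: "\<And>x. u b \<le> u x" using immersed_extrema[OF assms(3)] by metis
  have pos: "0 < u x" for x using polar_solD(1)[OF s] .
  have split: "u x powr q = u x powr p * u x powr (q - p)" for x
    by (simp add: powr_add[symmetric])
  have "u b powr q / q - u b powr p / p = u a powr q / q - u a powr p / p"
    using polar_first_integral[OF s, of b a] assms(1,2)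
      polar_sol_at_max(1)[OF s assms(4)] polar_sol_at_min(1)[OF s b] by simp
  moreover have "u b powr q / q - u b powr p / p < 0"
  proof -
    have "1 \<le> u b powr (p - q)" by (rule polar_sol_at_min(2)[OF s b])
    then have "u b powr (q - p) \<le> 1"
      using pos[of b] powr_minus[of "u b" "q - p"] by (simp add: one_le_inverse_iff)
    then have "u b powr (q - p) / q < 1 / p"
      using assms(1,2) by (smt (verit) frac_less2 divide_right_mono)
    then have "u b powr p * (u b powr (q - p) / q - 1 / p) < 0"
      using pos[of b] by (intro mult_pos_neg) auto
    then show ?thesis by (simp add: split[of b] algebra_simps)
  qed
  ultimately have "u a powr p * (u a powr (q - p) / q - 1 / p) < 0"
    by (simp add: split[of a] algebra_simps)
  then have "u a powr (q - p) / q < 1 / p" using pos[of a] by (simp add: mult_less_0_iff)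
  then show ?thesis using assms(1,2) by (simp add: field_simps)
qed

text \<open>The half-open interval makes the count independent of the offset: a point at 0 is
  counted once and its translate at the right end is not.\<close>

lemma card_arithmetic_progression:
  fixes a T :: real
  assumes T: "0 < T"
  shows "finite {x. 0 \<le> x \<and> x < real j * T \<and> (\<exists>k::int. x = a + of_int k * T)}"
    "card {x. 0 \<le> x \<and> x < real j * T \<and> (\<exists>k::int. x = a + of_int k * T)} = j"
proof -
  define k0 where "k0 = \<lceil>- a / T\<rceil>"
  have "{x. 0 \<le> x \<and> x < real j * T \<and> (\<exists>k::int. x = a + of_int k * T)} = (\<lambda>k. a + of_int k * T) ` {k0..<k0 + int j}"
  proof -
    have "(0 \<le> a + of_int k * T \<and> a + of_int k * T < real j * T) \<longleftrightarrow> k \<in> {k0..<k0 + int j}" for k :: int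
    proof -
      have "0 \<le> a + of_int k * T \<longleftrightarrow> - a / T \<le> of_int k"
        unfolding pos_divide_le_eq[OF T] by linarith
      also have "\<dots> \<longleftrightarrow> k0 \<le> k" by (simp add: k0_def ceiling_le_iff)
      finally have 1: "0 \<le> a + of_int k * T \<longleftrightarrow> k0 \<le> k" .
      have "a + of_int k * T < real j * T \<longleftrightarrow> of_int (k - int j) < - a / T"
        unfolding pos_less_divide_eq[OF T] by (auto simp: left_diff_distrib)
      also have "\<dots> \<longleftrightarrow> k - int j < k0" unfolding k0_def less_ceiling_iff ..
      finally show ?thesis using 1 by auto
    qed
    then show ?thesis by blast
  qed
  moreover have "inj_on (\<lambda>k. a + of_int k * T) {k0..<k0 + int j}" using T by (auto intro!: inj_onI)
  ultimately show "finite {x. 0 \<le> x \<and> x < real j * T \<and> (\<exists>k::int. x = a + of_int k * T)}"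
    "card {x. 0 \<le> x \<and> x < real j * T \<and> (\<exists>k::int. x = a + of_int k * T)} = j"
    by (simp_all add: card_image)
qed

section \<open>Identifying immersed solutions with members of the family\<close>

context curve_family
begin

lemma weights_pos: "0 < k1 + k2"
  using rise_pos[of 0] by simp

lemma good_solution_exists:
  assumes mn: "0 < m" "0 < n" "coprime m n" and E: "0 < E" "period E * real m = 2 * pi * real n"
  shows "\<exists>u. good_solution p q m n u"
proof -
  obtain u w where uw: "oscillation E u w" using oscillation_exists[OF E(1)] by blast
  then have u: "polar_sol p q u w" and u_per: "\<And>x. u (x + period E) = u x"
    and u_0: "\<And>x. u x = u 0 \<longleftrightarrow> (\<exists>k::int. x = of_int k * period E)"
    and u_max: "\<And>x. local_max_point u x \<longleftrightarrow> (\<exists>k::int. x = of_int k * period E)"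
    and E_pos: "0 < period E"
    unfolding oscillation_def by blast+
  have per: "periodic_with (2 * pi * real n) u"
    unfolding periodic_with_def E(2)[symmetric]
  proof
    show "u (x + period E * real m) = u x" for x
      using quasi_periodic_iterate[of u "period E" 0 x m] u_per by (simp add: mult.commute)
  qed
  have "\<not> is_constant_fun u"
  proof
    assume "is_constant_fun u"
    then have "u (period E / 2) = u 0" unfolding is_constant_fun_def by metis
    then obtain k :: int where "period E / 2 = of_int k * period E" using u_0 by blast
    then have "of_int (2 * k) = (of_int 1 :: real)" using E_pos by (simp add: field_simps)
    then have "2 * k = 1" by (simp only: of_int_eq_iff)
    then show False by presburger
  qed
  moreover have "total_curvature_index u n"
    unfolding total_curvature_index_def
  proof (intro conjI allI impI per mn)
    fix k :: nat assume k: "0 < k \<and> k < n"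
    show "\<not> periodic_with (2 * pi * real k) u"
    proof
      assume "periodic_with (2 * pi * real k) u"
      then have "u (2 * pi * real k) = u 0" unfolding periodic_with_def by (metis add_0)
      then obtain j :: int where "2 * pi * real k = of_int j * period E" using u_0 by blast
      \<comment> \<open>Multiplying by m replaces the period by 2 pi n / m and gives k m = j n;
        coprimality then makes n divide k, impossible for 0 < k < n.\<close>
      then have "2 * pi * real k * real m = of_int j * (2 * pi * real n)"
        using E(2) by (metis mult.assoc)
      then have "real k * real m = of_int j * real n" by simp
      then have "of_int (int k * int m) = (of_int (j * int n) :: real)" by simp
      then have "int k * int m = j * int n" by (simp only: of_int_eq_iff)
      then have "int n dvd int k * int m" by simp
      then have "int n dvd int k"
        using mn(3) by (metis coprime_commute coprime_dvd_mult_left_iff coprime_int_iff)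
      then have "n dvd k" by simp
      with k show False by (auto dest: dvd_imp_le)
    qed
  qed
  moreover have "{x. 0 \<le> x \<and> x < 2 * pi * real n \<and> local_max_point u x}
      = {x. 0 \<le> x \<and> x < real m * period E \<and> (\<exists>k::int. x = 0 + of_int k * period E)}"
    using E(2) by (simp add: u_max mult.commute)
  ultimately have "good_solution p q m n u"
    unfolding good_solution_def num_maxima_def
    using polar_sol_immersed[OF u mn(2) per] polar_sol_solves(2)[OF u]
      card_arithmetic_progression[OF E_pos, of m 0] by auto
  then show ?thesis by blast
qed

text \<open>Stated for maxima of immersed solutions and not for every number above 1, because for 0
  < p < q the family only reaches maxima M with M^(q-p) < q/p.\<close>

definition covers_maxima :: bool where
  "covers_maxima \<longleftrightarrow> (\<forall>n u a. immersed_solution_n p q n u \<longrightarrow> (\<forall>x. u x \<le> u a) \<longrightarrow> 1 < u a \<longrightarrow>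
     (\<exists>z\<in>wdom B C. 0 < z \<and> u a powr (q - p) = rise z / fall z))"

text \<open>The maximum selects E, and uniqueness from the maximum point makes u a rotated member of
  the family. Periodicity gives 2 pi n = j periods with one maximum in each, so counting maxima
  yields j = m.\<close>

lemma good_solution_period:
  assumes cov: covers_maxima and good: "good_solution p q m n u"
  obtains E a where "0 < E" "\<And>x. u x \<le> u a" "u a = support E (winv B C (orbit_sin E 0))"
    "period E * real m = 2 * pi * real n"
proof -
  have n: "immersed_solution_n p q n u" and nonconst: "\<not> is_constant_fun u"
    and card: "card {x. 0 \<le> x \<and> x < 2 * pi * real n \<and> local_max_point u x} = m"
    using good by (auto simp: good_solution_def num_maxima_def)
  note s = immersed_polar_sol[OF n]
  define w where "w x = deriv u x / u x" for x
  have s: "polar_sol p q u w" using s by (simp add: w_def[abs_def])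
  obtain a b where a: "\<And>x. u x \<le> u a" and "\<And>x. u b \<le> u x" using immersed_extrema[OF n] by metis
  have "u a \<noteq> 1"
  proof
    assume "u a = 1"
    then have "u x = u a" for x by (intro immersed_constant[OF n a]) simp
    with nonconst show False unfolding is_constant_fun_def by blast
  qed
  with immersed_max_ge_1[OF pq n a] have gt: "1 < u a" by simp
  with cov n a obtain z where z: "z \<in> wdom B C" "0 < z" "u a powr (q - p) = rise z / fall z"
    unfolding covers_maxima_def by blast
  obtain E where E: "0 < E" "support E (winv B C (orbit_sin E 0)) = u a"
    using maximum_attained[OF z(1,2) _ z(3)] gt by auto
  obtain v w' where vw: "oscillation E v w'" using oscillation_exists[OF E(1)] by blast
  then have v: "polar_sol p q v w'" "w' 0 = 0" "v 0 = support E (winv B C (orbit_sin E 0))"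
    "\<And>x. v (x + period E) = v x" "\<And>x. v x = v 0 \<longleftrightarrow> (\<exists>k::int. x = of_int k * period E)"
    "\<And>x. local_max_point v x \<longleftrightarrow> (\<exists>k::int. x = of_int k * period E)" "0 < period E"
    unfolding oscillation_def by blast+
  have uv: "u (x + a) = v x" for x
    using polar_sol_unique[OF polar_sol_shift[OF s, of a] v(1), of 0] v(2,3) E(2) polar_sol_at_max(1)[OF s a] by simp
  have "v (2 * pi * real n) = v 0"
    using n uv[of "2 * pi * real n"] uv[of 0] by (simp add: immersed_solution_n_def periodic_with_def add.commute)
  then obtain j :: int where j: "2 * pi * real n = of_int j * period E" using v(5) by blast
  have "0 < 2 * pi * real n" using n by (simp add: immersed_solution_n_def)
  with j v(7) have "0 < j" by (simp add: zero_less_mult_iff)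
  then have j': "2 * pi * real n = real (nat j) * period E" using j by simp
  have lm: "local_max_point u x \<longleftrightarrow> (\<exists>k::int. x = a + of_int k * period E)" for x
  proof -
    have "local_max_point u x \<longleftrightarrow> local_max_point v (x - a)"
    proof
      assume "local_max_point u x"
      then obtain e where "0 < e" "\<And>y. \<bar>y - x\<bar> < e \<Longrightarrow> u y \<le> u x" by (auto simp: local_max_point_def)
      then show "local_max_point v (x - a)"
        unfolding local_max_point_def uv[symmetric] by (intro exI[of _ e]) (auto simp: algebra_simps)
    next
      assume "local_max_point v (x - a)"
      then obtain e where e: "0 < e" "\<And>y. \<bar>y - (x - a)\<bar> < e \<Longrightarrow> v y \<le> v (x - a)" by (auto simp: local_max_point_def)
      show "local_max_point u x"
        unfolding local_max_point_def
        using e(1) e(2)[of "y - a" for y] uv[of "x - a"] uv[of "y - a" for y] by (intro exI[of _ e]) simp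
    qed
    then show ?thesis unfolding v(6) by (auto simp: algebra_simps)
  qed
  have "m = nat j"
    using card card_arithmetic_progression(2)[OF v(7), of "nat j" a] unfolding lm j' by simp
  then have "period E * real m = 2 * pi * real n" using j' by (simp add: mult.commute)
  then show thesis using that[OF E(1) a E(2)[symmetric]] by blast
qed

text \<open>Equal m and n give equal periods, strict monotonicity gives equal E, and equal maxima
  then give equal initial data.\<close>

lemma good_solution_unique:
  assumes cov: covers_maxima and s: "\<And>z. z \<in> wdom B C \<Longrightarrow> 0 < s * wlin B C z" and m: "0 < m"
    and good: "good_solution p q m n u" "good_solution p q m n v"
  shows "\<exists>c \<theta>0. c > 0 \<and> (\<forall>\<theta>. v \<theta> = c * u (\<theta> + \<theta>0))"
proof -
  obtain E a where u: "0 < E" "\<And>x. u x \<le> u a" "u a = support E (winv B C (orbit_sin E 0))"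
    "period E * real m = 2 * pi * real n"
    using good_solution_period[OF cov good(1)] by blast
  obtain E' b where v: "0 < E'" "\<And>x. v x \<le> v b" "v b = support E' (winv B C (orbit_sin E' 0))"
    "period E' * real m = 2 * pi * real n"
    using good_solution_period[OF cov good(2)] by blast
  have "period E = period E'" using u(4) v(4) m by (metis mult_cancel_right of_nat_0_less_iff less_irrefl)
  then have "eta_int E = eta_int E'"
    using weights_pos sum_pos by (simp add: period_def)
  then have "E = E'"
    using eta_int_strict_mono[OF s, of E E'] eta_int_strict_mono[OF s, of E' E] u(1) v(1)
    by (cases E E' rule: linorder_cases) auto
  then have eq: "u a = v b" using u(3) v(3) by simp
  have su: "polar_sol p q u (\<lambda>x. deriv u x / u x)" "polar_sol p q v (\<lambda>x. deriv v x / v x)"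
    using good immersed_polar_sol by (auto simp: good_solution_def)
  have "v (x + b) = u (x + a)" for x
    using polar_sol_unique[OF polar_sol_shift[OF su(2), of b] polar_sol_shift[OF su(1), of a], of 0 x]
      eq polar_sol_at_max(1)[OF su(1) u(2)] polar_sol_at_max(1)[OF su(2) v(2)] by simp
  \<comment> \<open>Only a rotation is needed: the scaling factor is 1.\<close>
  from this[of "x - b" for x] have "v x = 1 * u (x + (a - b))" for x by (simp add: algebra_simps)
  then show ?thesis using zero_less_one by blast
qed

end

section \<open>Explicit solutions\<close>

lemma angle_reduce:
  obtains \<theta>0 :: real where "0 \<le> \<theta>0" "\<theta>0 < 2 * pi"
    "\<And>x. cos (x - \<theta>0) = cos (x - a)" "\<And>x. sin (x - \<theta>0) = sin (x - a)"
proof -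
  define k where "k = \<lfloor>a / (2 * pi)\<rfloor>"
  have "cos (y + of_int k * (2 * pi)) = cos y + of_int k * 0" "sin (y + of_int k * (2 * pi)) = sin y + of_int k * 0" for y
    by (rule quasi_periodic_iterate_int; simp)+
  from this(1)[of "x - a" for x] this(2)[of "x - a" for x] show thesis
    using floor_divide_lower[of "2 * pi" a] floor_divide_upper[of "2 * pi" a]
    by (intro that[of "a - of_int k * (2 * pi)"]) (auto simp: k_def algebra_simps)
qed

lemma immersed_eq_explicit:
  assumes "immersed_solution_n p q n u" "\<And>x. u x \<le> u a"
    and "polar_sol p q v w" "v a = u a" "w a = 0"
  shows "u x = v x"
  using polar_sol_unique[OF immersed_polar_sol[OF assms(1)] assms(3), of a x]
    polar_sol_at_max(1)[OF immersed_polar_sol[OF assms(1)] assms(2)] assms(4,5) by simp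

text \<open>Support function of the unit circle seen from a point at distance l from its centre; l <
  1 keeps it positive.\<close>

lemma polar_sol_circle:
  assumes "0 \<le> l" "l < 1"
  shows "polar_sol 1 2 (\<lambda>x. 1 + l * cos (x - a)) (\<lambda>x. - l * sin (x - a) / (1 + l * cos (x - a)))"
  unfolding polar_sol_def
proof (intro allI conjI)
  fix x
  define c s where "c = cos (x - a)" and "s = sin (x - a)"
  have cs: "c\<^sup>2 + s\<^sup>2 = 1" by (simp add: c_def s_def)
  have "l * - 1 \<le> l * c" using assms by (intro mult_left_mono) (auto simp: c_def)
  then have v: "0 < 1 + l * c" using assms by linarith
  then show "0 < 1 + l * cos (x - a)" by (simp add: c_def)
  show "((\<lambda>x. 1 + l * cos (x - a)) has_real_derivative
      (1 + l * cos (x - a)) * (- l * sin (x - a) / (1 + l * cos (x - a)))) (at x)"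
    using v unfolding c_def by (auto intro!: derivative_eq_intros)
  have "((\<lambda>x. - l * sin (x - a) / (1 + l * cos (x - a))) has_real_derivative
      ((- l * c) * (1 + l * c) - (- l * s) * (- l * s)) / ((1 + l * c) * (1 + l * c))) (at x)"
    unfolding c_def s_def
    by (rule DERIV_divide) (use v in \<open>auto intro!: derivative_eq_intros simp: c_def\<close>)
  moreover have "((- l * c) * (1 + l * c) - (- l * s) * (- l * s)) / ((1 + l * c) * (1 + l * c))
      = (1 + l * c) powr (1 - 2) * (1 + (- l * s / (1 + l * c))\<^sup>2) powr (1 - 2 / 2) - (1 + (- l * s / (1 + l * c))\<^sup>2)"
  proof -
    define V where "V = 1 + l * c"
    have V: "0 < V" "- l * c = 1 - V" using v by (auto simp: V_def)
    have 1: "(1 + (- l * s / V)\<^sup>2) powr (1 - 2 / 2) = 1"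
      using one_plus_sq_pos[of "- l * s / V"] by simp
    have 2: "V powr (1 - 2) = 1 / V" using V(1) by (simp add: powr_minus_divide)
    have "((1 - V) * V - t * t) / (V * V) = 1 / V * 1 - (1 + (t / V)\<^sup>2)" for t
      using V(1) by (simp add: diff_divide_distrib left_diff_distrib power2_eq_square)
    from this[of "- l * s"] show ?thesis unfolding V_def[symmetric] V(2) 1 2 .
  qed
  ultimately show "((\<lambda>x. - l * sin (x - a) / (1 + l * cos (x - a))) has_real_derivative
      (1 + l * cos (x - a)) powr (1 - 2) * (1 + (- l * sin (x - a) / (1 + l * cos (x - a)))\<^sup>2) powr (1 - 2 / 2)
      - (1 + (- l * sin (x - a) / (1 + l * cos (x - a)))\<^sup>2)) (at x)"
    by (simp only: c_def s_def)
qed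

text \<open>The reciprocal of u is sqrt(1 - \<mu>^2 sin^2) + \<mu> cos, the radial function of an
  off-centre unit circle. So u belongs to the polar dual of that circle, an ellipse with a focus at
  the origin.\<close>

lemma polar_sol_focal_ellipse:
  assumes "0 \<le> \<mu>" "\<mu> < 1"
  shows "polar_sol (- 2) (- 1)
    (\<lambda>x. (sqrt (1 - \<mu>\<^sup>2 * (sin (x - a))\<^sup>2) - \<mu> * cos (x - a)) / (1 - \<mu>\<^sup>2))
    (\<lambda>x. \<mu> * sin (x - a) / sqrt (1 - \<mu>\<^sup>2 * (sin (x - a))\<^sup>2))"
  unfolding polar_sol_def
proof (intro allI conjI)
  fix x
  define c s r v where "c = cos (x - a)" and "s = sin (x - a)" and "r = sqrt (1 - \<mu>\<^sup>2 * s\<^sup>2)"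
    and "v = (r - \<mu> * c) / (1 - \<mu>\<^sup>2)"
  have cs: "c\<^sup>2 + s\<^sup>2 = 1" by (simp add: c_def s_def)
  have m2: "0 < 1 - \<mu>\<^sup>2" using assms by (simp add: abs_square_less_1)
  have "\<mu>\<^sup>2 * s\<^sup>2 \<le> \<mu>\<^sup>2 * 1" by (intro mult_left_mono) (auto simp: s_def abs_square_le_1)
  then have rad: "0 < 1 - \<mu>\<^sup>2 * s\<^sup>2" using m2 by linarith
  then have r: "0 < r" "r\<^sup>2 = 1 - \<mu>\<^sup>2 * s\<^sup>2" by (auto simp: r_def)
  have "r\<^sup>2 - (\<mu> * c)\<^sup>2 = 1 - \<mu>\<^sup>2 * (c\<^sup>2 + s\<^sup>2)" unfolding r(2) by (simp add: algebra_simps power_mult_distrib)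
  then have prod: "(r - \<mu> * c) * (r + \<mu> * c) = 1 - \<mu>\<^sup>2" unfolding cs by (simp add: power2_eq_square algebra_simps)
  have "(\<mu> * c)\<^sup>2 < r\<^sup>2" using prod m2 by (simp add: power2_eq_square algebra_simps)
  then have "\<bar>\<mu> * c\<bar> < r" using r(1) by (metis abs_le_square_iff abs_of_pos not_le)
  then have pos: "0 < r - \<mu> * c" "0 < r + \<mu> * c" by auto
  then have v: "0 < v" using m2 by (simp add: v_def)
  then show "0 < (sqrt (1 - \<mu>\<^sup>2 * (sin (x - a))\<^sup>2) - \<mu> * cos (x - a)) / (1 - \<mu>\<^sup>2)"
    by (simp add: v_def r_def s_def c_def)
  have dr: "((\<lambda>x. sqrt (1 - \<mu>\<^sup>2 * (sin (x - a))\<^sup>2)) has_real_derivative - \<mu>\<^sup>2 * s * c / r) (at x)"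
  proof -
    have "((\<lambda>x. 1 - \<mu>\<^sup>2 * (sin (x - a))\<^sup>2) has_real_derivative - (2 * \<mu>\<^sup>2 * s * c)) (at x)"
      by (auto intro!: derivative_eq_intros simp: s_def c_def)
    from DERIV_chain2[OF DERIV_real_sqrt this] rad
    have "((\<lambda>x. sqrt (1 - \<mu>\<^sup>2 * (sin (x - a))\<^sup>2)) has_real_derivative inverse r / 2 * - (2 * \<mu>\<^sup>2 * s * c)) (at x)"
      by (simp add: s_def r_def)
    then show ?thesis using r(1) by (simp add: field_simps)
  qed
  show "((\<lambda>x. (sqrt (1 - \<mu>\<^sup>2 * (sin (x - a))\<^sup>2) - \<mu> * cos (x - a)) / (1 - \<mu>\<^sup>2)) has_real_derivative
      (sqrt (1 - \<mu>\<^sup>2 * (sin (x - a))\<^sup>2) - \<mu> * cos (x - a)) / (1 - \<mu>\<^sup>2) * (\<mu> * sin (x - a) / sqrt (1 - \<mu>\<^sup>2 * (sin (x - a))\<^sup>2))) (at x)"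
  proof -
    have "((\<lambda>x. \<mu> * cos (x - a)) has_real_derivative - \<mu> * s) (at x)"
      by (auto intro!: derivative_eq_intros simp: s_def)
    from DERIV_cdivide[OF DERIV_diff[OF dr this]]
    have "((\<lambda>x. (sqrt (1 - \<mu>\<^sup>2 * (sin (x - a))\<^sup>2) - \<mu> * cos (x - a)) / (1 - \<mu>\<^sup>2)) has_real_derivative
      (- \<mu>\<^sup>2 * s * c / r - - \<mu> * s) / (1 - \<mu>\<^sup>2)) (at x)" .
    moreover have "(- \<mu>\<^sup>2 * s * c / r - - \<mu> * s) / (1 - \<mu>\<^sup>2) = (r - \<mu> * c) / (1 - \<mu>\<^sup>2) * (\<mu> * s / r)"
    proof -
      have "- \<mu>\<^sup>2 * s * c / r - - \<mu> * s = (r - \<mu> * c) * (\<mu> * s / r)"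
        using r(1) by (simp add: field_simps power2_eq_square)
      then show ?thesis by simp
    qed
    ultimately show ?thesis by (simp only: r_def s_def c_def)
  qed
  have w2: "1 + (\<mu> * s / r)\<^sup>2 = (1 / r)\<^sup>2"
  proof -
    have "1 + (\<mu> * s / r)\<^sup>2 = (r\<^sup>2 + \<mu>\<^sup>2 * s\<^sup>2) / r\<^sup>2" using r(1) by (simp add: power_divide power_mult_distrib add_divide_distrib)
    then show ?thesis unfolding r(2) by (simp add: power_divide r(2))
  qed
  have "((\<lambda>x. \<mu> * sin (x - a) / sqrt (1 - \<mu>\<^sup>2 * (sin (x - a))\<^sup>2)) has_real_derivative
      ((\<mu> * c) * r - (\<mu> * s) * (- \<mu>\<^sup>2 * s * c / r)) / (r * r)) (at x)"
  proof -
    have "((\<lambda>x. \<mu> * sin (x - a)) has_real_derivative \<mu> * c) (at x)"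
      by (auto intro!: derivative_eq_intros simp: c_def)
    from DERIV_divide[OF this dr] r(1) show ?thesis by (simp add: r_def s_def)
  qed
  moreover have "((\<mu> * c) * r - (\<mu> * s) * (- \<mu>\<^sup>2 * s * c / r)) / (r * r) = \<mu> * c / r ^ 3"
  proof -
    have "((\<mu> * c) * r - (\<mu> * s) * (- \<mu>\<^sup>2 * s * c / r)) / (r * r) = \<mu> * c * (r\<^sup>2 + \<mu>\<^sup>2 * s\<^sup>2) / r ^ 3"
      using r(1) by (simp add: field_simps power2_eq_square power3_eq_cube)
    then show ?thesis unfolding r(2) by simp
  qed
  moreover have "\<mu> * c / r ^ 3 = v powr (- 2 - - 1) * (1 + (\<mu> * s / r)\<^sup>2) powr (1 - - 1 / 2) - (1 + (\<mu> * s / r)\<^sup>2)"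
  proof -
    have "(1 + (\<mu> * s / r)\<^sup>2) powr (1 - - 1 / 2) = (1 / r) powr 3"
      unfolding w2 using sq_powr_half[of "1 / r" 3] r(1) by simp
    also have "\<dots> = 1 / r ^ 3" using r(1) by (simp add: power_divide)
    finally have 1: "(1 + (\<mu> * s / r)\<^sup>2) powr (1 - - 1 / 2) = 1 / r ^ 3" .
    have "v powr (- 2 - - 1) = 1 / v" using v by (simp add: powr_minus_divide)
    also have "1 / v = r + \<mu> * c"
      using prod pos m2 by (simp add: v_def field_simps)
    finally show ?thesis unfolding 1 unfolding w2 using r(1) by (simp add: field_simps power2_eq_square power3_eq_cube)
  qed
  ultimately show "((\<lambda>x. \<mu> * sin (x - a) / sqrt (1 - \<mu>\<^sup>2 * (sin (x - a))\<^sup>2)) has_real_derivative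
    ((sqrt (1 - \<mu>\<^sup>2 * (sin (x - a))\<^sup>2) - \<mu> * cos (x - a)) / (1 - \<mu>\<^sup>2)) powr (- 2 - - 1) *
    (1 + (\<mu> * sin (x - a) / sqrt (1 - \<mu>\<^sup>2 * (sin (x - a))\<^sup>2))\<^sup>2) powr (1 - - 1 / 2) -
    (1 + (\<mu> * sin (x - a) / sqrt (1 - \<mu>\<^sup>2 * (sin (x - a))\<^sup>2))\<^sup>2)) (at x)"
    by (simp only: v_def r_def s_def c_def)
qed

lemma polar_sol_central_ellipse:
  fixes A D :: real
  assumes "0 < A" "0 < D" "A * D = 1"
  shows "polar_sol (- 2) 2
    (\<lambda>x. sqrt (A * (cos (x - a))\<^sup>2 + D * (sin (x - a))\<^sup>2))
    (\<lambda>x. (D - A) * sin (x - a) * cos (x - a) / (A * (cos (x - a))\<^sup>2 + D * (sin (x - a))\<^sup>2))"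
  unfolding polar_sol_def
proof (intro allI conjI)
  fix x
  define c s h where "c = cos (x - a)" and "s = sin (x - a)" and "h = A * c\<^sup>2 + D * s\<^sup>2"
  have cs: "c\<^sup>2 + s\<^sup>2 = 1" by (simp add: c_def s_def)
  have "0 < A * c\<^sup>2 \<or> 0 < D * s\<^sup>2"
    using assms cs by (cases "c = 0") auto
  moreover have "0 \<le> A * c\<^sup>2" "0 \<le> D * s\<^sup>2" using assms by auto
  ultimately have h: "0 < h" unfolding h_def by linarith
  then show "0 < sqrt (A * (cos (x - a))\<^sup>2 + D * (sin (x - a))\<^sup>2)"
    by (simp add: h_def c_def s_def)
  have dh: "((\<lambda>x. A * (cos (x - a))\<^sup>2 + D * (sin (x - a))\<^sup>2) has_real_derivative 2 * ((D - A) * s * c)) (at x)"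
    by (auto intro!: derivative_eq_intros simp: s_def c_def algebra_simps)
  show "((\<lambda>x. sqrt (A * (cos (x - a))\<^sup>2 + D * (sin (x - a))\<^sup>2)) has_real_derivative
     sqrt (A * (cos (x - a))\<^sup>2 + D * (sin (x - a))\<^sup>2) *
     ((D - A) * sin (x - a) * cos (x - a) / (A * (cos (x - a))\<^sup>2 + D * (sin (x - a))\<^sup>2))) (at x)"
  proof -
    have "((\<lambda>x. sqrt (A * (cos (x - a))\<^sup>2 + D * (sin (x - a))\<^sup>2)) has_real_derivative
        inverse (sqrt h) / 2 * (2 * ((D - A) * s * c))) (at x)"
      using DERIV_chain2[OF DERIV_real_sqrt dh] h by (simp add: h_def s_def c_def)
    moreover have "inverse (sqrt h) / 2 * (2 * ((D - A) * s * c)) = sqrt h * ((D - A) * s * c / h)"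
    proof -
      define g where "g = sqrt h"
      have g: "0 < g" "h = g * g" using h by (auto simp: g_def)
      show ?thesis unfolding g_def[symmetric] unfolding g(2) using g(1) by (simp add: field_simps)
    qed
    ultimately show ?thesis by (simp only: h_def s_def c_def)
  qed
  have "((\<lambda>x. (D - A) * sin (x - a) * cos (x - a) / (A * (cos (x - a))\<^sup>2 + D * (sin (x - a))\<^sup>2)) has_real_derivative
      ((D - A) * (c\<^sup>2 - s\<^sup>2) * h - (D - A) * s * c * (2 * ((D - A) * s * c))) / (h * h)) (at x)"
  proof -
    have "((\<lambda>x. (D - A) * sin (x - a) * cos (x - a)) has_real_derivative (D - A) * (c\<^sup>2 - s\<^sup>2)) (at x)"
      by (auto intro!: derivative_eq_intros simp: s_def c_def power2_eq_square algebra_simps)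
    from DERIV_divide[OF this dh] h show ?thesis by (simp add: h_def s_def c_def)
  qed
  moreover have "((D - A) * (c\<^sup>2 - s\<^sup>2) * h - (D - A) * s * c * (2 * ((D - A) * s * c))) / (h * h)
      = sqrt h powr (- 2 - 2) * (1 + ((D - A) * s * c / h)\<^sup>2) powr (1 - 2 / 2) - (1 + ((D - A) * s * c / h)\<^sup>2)"
  proof -
    have "0 < 1 + ((D - A) * s * c / h)\<^sup>2" by (rule one_plus_sq_pos)
    then have 1: "(1 + ((D - A) * s * c / h)\<^sup>2) powr (1 - 2 / 2) = 1" by simp
    have 2: "sqrt h powr (- 2 - 2) = 1 / (h * h)"
    proof -
      have "sqrt h powr (- 4) = 1 / sqrt h ^ 4" using h by (simp add: powr_minus_divide)
      also have "sqrt h ^ 4 = (sqrt h ^ 2) ^ 2" by (simp flip: power_mult)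
      finally show ?thesis using h by (simp add: power2_eq_square)
    qed
    \<comment> \<open>Both sides become polynomials in c^2 and s^2 whose mixed terms carry A D = 1;
      together with c^2 + s^2 = 1 this leaves 1 - h^2.\<close>
    have key: "(D - A) * (c\<^sup>2 - s\<^sup>2) * h - (D - A) * s * c * ((D - A) * s * c) = 1 - h * h"
    proof -
      have "(D - A) * (c\<^sup>2 - s\<^sup>2) * h - (D - A) * s * c * ((D - A) * s * c)
          = (A * D) * (c ^ 4 + s ^ 4) - A * A * c ^ 4 - D * D * s ^ 4"
        unfolding h_def by (simp add: algebra_simps power2_eq_square power4_eq_xxxx)
      moreover have "h * h = A * A * c ^ 4 + 2 * (A * D) * (c\<^sup>2 * s\<^sup>2) + D * D * s ^ 4"
        unfolding h_def by (simp add: algebra_simps power2_eq_square power4_eq_xxxx)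
      moreover have "c ^ 4 + s ^ 4 = (c\<^sup>2 + s\<^sup>2)\<^sup>2 - 2 * (c\<^sup>2 * s\<^sup>2)"
        by (simp add: algebra_simps power2_eq_square power4_eq_xxxx)
      ultimately show ?thesis unfolding assms(3) cs by simp
    qed
    have "((D - A) * (c\<^sup>2 - s\<^sup>2) * h - (D - A) * s * c * (2 * ((D - A) * s * c))) / (h * h)
      = ((D - A) * (c\<^sup>2 - s\<^sup>2) * h - (D - A) * s * c * ((D - A) * s * c)) / (h * h) - ((D - A) * s * c / h)\<^sup>2"
      by (simp add: diff_divide_distrib power2_eq_square)
    also have "\<dots> = 1 / (h * h) - 1 - ((D - A) * s * c / h)\<^sup>2"
      unfolding key using h by (simp add: diff_divide_distrib)
    finally show ?thesis unfolding 1 2 by simp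
  qed
  ultimately show "((\<lambda>x. (D - A) * sin (x - a) * cos (x - a) / (A * (cos (x - a))\<^sup>2 + D * (sin (x - a))\<^sup>2)) has_real_derivative
      sqrt (A * (cos (x - a))\<^sup>2 + D * (sin (x - a))\<^sup>2) powr (- 2 - 2) *
      (1 + ((D - A) * sin (x - a) * cos (x - a) / (A * (cos (x - a))\<^sup>2 + D * (sin (x - a))\<^sup>2))\<^sup>2) powr (1 - 2 / 2) -
      (1 + ((D - A) * sin (x - a) * cos (x - a) / (A * (cos (x - a))\<^sup>2 + D * (sin (x - a))\<^sup>2))\<^sup>2)) (at x)"
    by (simp only: h_def s_def c_def)
qed

lemma immersed_circle:
  assumes "immersed_solution 1 2 u"
  shows "\<exists>lam \<theta>0. lam \<ge> 0 \<and> 0 \<le> \<theta>0 \<and> \<theta>0 < 2 * pi \<and> (\<forall>\<theta>. u \<theta> = 1 + lam * cos (\<theta> - \<theta>0))"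
proof -
  obtain n where n: "immersed_solution_n 1 2 n u" using assms by (auto simp: immersed_solution_def)
  obtain a where a: "\<forall>x. u x \<le> u a" using immersed_extrema[OF n] by blast
  have "1 \<le> u a" using immersed_max_ge_1[OF _ n] a by simp
  \<comment> \<open>The bound q/p is 2 and the exponent q - p is 1, which gives \<lambda> <
    1.\<close>
  moreover have "u a < 2" using immersed_max_less[OF _ _ n, of a] a calculation by simp
  ultimately have l: "0 \<le> u a - 1" "u a - 1 < 1" by auto
  have u: "u x = 1 + (u a - 1) * cos (x - a)" for x
    by (rule immersed_eq_explicit[OF n _ polar_sol_circle[OF l, of a]]) (use a in auto)
  obtain \<theta>0 where \<theta>0: "0 \<le> \<theta>0" "\<theta>0 < 2 * pi" "\<And>x. cos (x - \<theta>0) = cos (x - a)"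
    using angle_reduce[of a] by metis
  show ?thesis
    by (rule exI[of _ "u a - 1"], rule exI[of _ \<theta>0], unfold \<theta>0(3)) (intro conjI allI l(1) \<theta>0(1,2) u)
qed

lemma immersed_focal_ellipse:
  assumes "immersed_solution (- 2) (- 1) u"
  shows "\<exists>mu \<theta>0. 0 \<le> mu \<and> mu < 1 \<and> 0 \<le> \<theta>0 \<and> \<theta>0 < 2 * pi \<and>
    (\<forall>\<theta>. u \<theta> = (sqrt (1 - mu\<^sup>2 * (sin (\<theta> - \<theta>0))\<^sup>2) - mu * cos (\<theta> - \<theta>0)) / (1 - mu\<^sup>2))"
proof -
  obtain n where n: "immersed_solution_n (- 2) (- 1) n u" using assms by (auto simp: immersed_solution_def)
  obtain a where a: "\<forall>x. u x \<le> u a" using immersed_extrema[OF n] by blast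
  have ge: "1 \<le> u a" using immersed_max_ge_1[OF _ n] a by simp
  \<comment> \<open>The explicit solution is largest where the cosine is -1, with value 1 / (1 -
    \<mu>); this fixes \<mu>, and the phase is \<open>a - pi\<close> rather than
    \<open>a\<close>.\<close>
  define mu where "mu = 1 - 1 / u a"
  have mu: "0 \<le> mu" "mu < 1" using ge by (auto simp: mu_def)
  have start: "(1 + mu) / (1 - mu\<^sup>2) = u a"
  proof -
    have "1 - mu\<^sup>2 = (1 - mu) * (1 + mu)" by (simp add: power2_eq_square algebra_simps)
    then have "(1 + mu) / (1 - mu\<^sup>2) = 1 / (1 - mu)" using mu by simp
    then show ?thesis using ge by (simp add: mu_def)
  qed
  have u: "u x = (sqrt (1 - mu\<^sup>2 * (sin (x - (a - pi)))\<^sup>2) - mu * cos (x - (a - pi))) / (1 - mu\<^sup>2)" for x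
    by (rule immersed_eq_explicit[OF n _ polar_sol_focal_ellipse[OF mu, of "a - pi"]]) (use a start in auto)
  obtain \<theta>0 where \<theta>0: "0 \<le> \<theta>0" "\<theta>0 < 2 * pi" "\<And>x. cos (x - \<theta>0) = cos (x - (a - pi))" "\<And>x. sin (x - \<theta>0) = sin (x - (a - pi))"
    using angle_reduce[of "a - pi"] by metis
  show ?thesis
    by (rule exI[of _ mu], rule exI[of _ \<theta>0], unfold \<theta>0(3,4)) (intro conjI allI mu \<theta>0(1,2) u)
qed

lemma immersed_central_ellipse:
  assumes "immersed_solution (- 2) 2 u"
  shows "\<exists>lam \<theta>0. lam > 0 \<and> 0 \<le> \<theta>0 \<and> \<theta>0 < 2 * pi \<and>
    (\<forall>\<theta>. u \<theta> = sqrt (lam\<^sup>2 * (cos (\<theta> - \<theta>0))\<^sup>2 + lam powr (-2) * (sin (\<theta> - \<theta>0))\<^sup>2))"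
proof -
  obtain n where n: "immersed_solution_n (- 2) 2 n u" using assms by (auto simp: immersed_solution_def)
  obtain a where a: "\<forall>x. u x \<le> u a" using immersed_extrema[OF n] by blast
  define lam where "lam = u a"
  have lam: "0 < lam" using immersed_max_ge_1[OF _ n, of a] a by (simp add: lam_def)
  have AD: "0 < lam\<^sup>2" "0 < lam powr (-2)" "lam\<^sup>2 * lam powr (-2) = 1"
    using lam by (auto simp: powr_minus field_simps)
  have u: "u x = sqrt (lam\<^sup>2 * (cos (x - a))\<^sup>2 + lam powr (-2) * (sin (x - a))\<^sup>2)" for x
    by (rule immersed_eq_explicit[OF n _ polar_sol_central_ellipse[OF AD, of a]]) (use a lam in \<open>auto simp: lam_def\<close>)
  obtain \<theta>0 where \<theta>0: "0 \<le> \<theta>0" "\<theta>0 < 2 * pi" "\<And>x. cos (x - \<theta>0) = cos (x - a)" "\<And>x. sin (x - \<theta>0) = sin (x - a)"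
    using angle_reduce[of a] by metis
  show ?thesis
    by (rule exI[of _ lam], rule exI[of _ \<theta>0], unfold \<theta>0(3,4)) (intro conjI allI lam \<theta>0(1,2) u)
qed

section \<open>The three sign cases\<close>

lemma min_max_reciprocal:
  fixes a b t X :: real
  assumes "0 < a" "0 < b" "0 < t" "0 < X" "min a b < t" "t < max a b"
  shows "min (X / a) (X / b) < X / t" "X / t < max (X / a) (X / b)"
proof -
  have *: "X / y < X / x" if "0 < x" "x < y" for x y
    using that assms(4) by (intro divide_strict_left_mono) auto
  have "(a < t \<and> t < b) \<or> (b < t \<and> t < a)"
    using assms(5,6) by (auto simp: min_def max_def split: if_splits)
  then show "min (X / a) (X / b) < X / t" "X / t < max (X / a) (X / b)"
    using *[of a t] *[of t b] *[of b t] *[of t a] assms(1-3) by (auto simp: min_less_iff_disj less_max_iff_disj)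
qed

context curve_family
begin

text \<open>The two normalisations identify the end values of the period as 2 pi / sqrt(q - p) and 2
  pi / Xi. Taking reciprocals carries the betweenness of m/n over to the period.\<close>

lemma period_attains:
  assumes k: "sqrt (q - p) * (k1 + k2) = sqrt (2 * (B + C))" and xi: "(k1 + k2) * Xi p q = 2"
    and mn: "0 < m" "0 < n"
    and between: "min (sqrt (q - p)) (Xi p q) < real m / real n" "real m / real n < max (sqrt (q - p)) (Xi p q)"
  shows "\<exists>E>0. period E * real m = 2 * pi * real n"
proof -
  define \<kappa> where "\<kappa> = k1 + k2"
  have \<kappa>: "0 < \<kappa>" using weights_pos by (simp add: \<kappa>_def)
  define S where "S = sqrt (q - p)"
  have S: "0 < S" using pq by (simp add: S_def)
  have Xi: "0 < Xi p q" using xi \<kappa> by (fold \<kappa>_def) (metis zero_less_mult_pos zero_less_numeral)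
  \<comment> \<open>The required equation \<open>period E * m = 2 * pi * n\<close> is equivalent to
    \<open>eta_int E = X / (m / n)\<close>.\<close>
  define X where "X = pi * (B + C) / \<kappa>"
  have X: "0 < X" using sum_pos \<kappa> by (simp add: X_def)
  have "pi / 2 * (B + C) = X / Xi p q"
    using xi Xi \<kappa> by (simp add: X_def \<kappa>_def[symmetric] field_simps)
  moreover have "pi * sqrt ((B + C) / 2) = X / S"
  proof -
    have "(B + C) / 2 * (2 * (B + C)) = (B + C)\<^sup>2" by (simp add: power2_eq_square)
    then have "sqrt ((B + C) / 2) * sqrt (2 * (B + C)) = B + C"
      unfolding real_sqrt_mult[symmetric] using sum_pos by simp
    then have "sqrt ((B + C) / 2) * (S * \<kappa>) = B + C" using k by (simp add: S_def \<kappa>_def)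
    then show ?thesis using S \<kappa> by (simp add: X_def field_simps)
  qed
  ultimately obtain E where E: "0 < E" "eta_int E = X / (real m / real n)"
    using eta_int_attains[of "X / (real m / real n)"]
      min_max_reciprocal[OF S Xi _ X, of "real m / real n"] between mn unfolding S_def by (metis divide_pos_pos of_nat_0_less_iff)
  have "period E * real m = 2 * pi * real n"
    using sum_pos \<kappa> mn by (simp add: period_def E(2) X_def \<kappa>_def[symmetric])
  with E(1) show ?thesis by blast
qed

lemma classification:
  assumes "sqrt (q - p) * (k1 + k2) = sqrt (2 * (B + C))" "(k1 + k2) * Xi p q = 2"
    and cov: covers_maxima and mn: "0 < m" "0 < n" "coprime m n"
    and "min (sqrt (q - p)) (Xi p q) < real m / real n" "real m / real n < max (sqrt (q - p)) (Xi p q)"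
    and BC: "(B, C) \<noteq> (1, 1)"
  shows "(\<exists>u. good_solution p q m n u) \<and>
    ((1 \<le> B \<and> 1 \<le> C \<or> B \<le> 1 \<and> C \<le> 1) \<longrightarrow>
      (\<exists>u. good_solution p q m n u \<and>
         (\<forall>v. good_solution p q m n v \<longrightarrow> (\<exists>c \<theta>0. c > 0 \<and> (\<forall>\<theta>. v \<theta> = c * u (\<theta> + \<theta>0))))))"
proof -
  obtain E where "0 < E" "period E * real m = 2 * pi * real n"
    using period_attains assms by blast
  then obtain u where u: "good_solution p q m n u" using good_solution_exists mn by blast
  have "\<exists>c \<theta>0. c > 0 \<and> (\<forall>\<theta>. v \<theta> = c * u (\<theta> + \<theta>0))"
    if "1 \<le> B \<and> 1 \<le> C \<or> B \<le> 1 \<and> C \<le> 1" "good_solution p q m n v" for v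
    using that(1)
  proof
    assume "1 \<le> B \<and> 1 \<le> C"
    then show ?thesis
      by (intro good_solution_unique[where s = 1, OF cov _ mn(1) u that(2)]) (simp, blast intro: wlin_pos[OF _ _ BC])
  next
    assume "B \<le> 1 \<and> C \<le> 1"
    then show ?thesis
      by (intro good_solution_unique[where s = "- 1", OF cov _ mn(1) u that(2)])
         (simp, blast intro: wlin_neg[OF B_nonneg C_nonneg sum_pos _ _ BC])
  qed
  with u show ?thesis by blast
qed

end

text \<open>Up to a common factor r^q and u^p are 1 + q z / 2 and 1 + p z / 2, which makes r^q / q -
  u^p / p constant for nonzero p and q. These two expressions are rise and fall.\<close>

lemma curve_family_opposite:
  assumes "p \<le> 0" "0 \<le> q" "p < q"
  shows "curve_family (q / 2) (- p / 2) p q 1 0"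
proof
  fix z assume z: "z \<in> wdom (q / 2) (- p / 2)"
  then have pos: "0 < 1 + q / 2 * z" "0 < 1 + (- p / 2) * (- z)" by (auto simp: wdom_def)
  then show "0 < 1 * (1 + q / 2 * z) + 0 * (1 - - p / 2 * z)" by simp
  have fall: "1 * (1 + q / 2 * z) + 0 * (1 - - p / 2 * z) - (q / 2 + - p / 2) * z = 1 + (- p / 2) * (- z)"
    by (simp add: algebra_simps)
  then show "0 < 1 * (1 + q / 2 * z) + 0 * (1 - - p / 2 * z) - (q / 2 + - p / 2) * z" using pos by simp
  show "2 * ln ((1 * (1 + q / 2 * z) + 0 * (1 - - p / 2 * z)) / (1 * (1 + q / 2 * z) + 0 * (1 - - p / 2 * z) - (q / 2 + - p / 2) * z))
      = ((q - p) * 0 + q) * slog (q / 2) z + (q - (q - p) * 1) * slog (- p / 2) (- z)"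
  proof -
    have "2 * ln ((1 + q / 2 * z) / (1 + (- p / 2) * (- z))) = 2 * (q / 2 * slog (q / 2) z) - 2 * ((- p / 2) * slog (- p / 2) (- z))"
      unfolding mult_slog[OF pos(1)] mult_slog[OF pos(2)] using pos by (simp add: ln_div)
    then show ?thesis unfolding fall by simp
  qed
qed (use assms in auto)

text \<open>The previous choice would make C = - p / 2 negative. Here z is defined by r^q / u^p = 1
  + q z / 2, and the first integral makes u^(-p) proportional to 1 - C z. The end point 1/C
  corresponds to r^q / u^p = q/p.\<close>

lemma curve_family_positive:
  assumes "0 < p" "p < q"
  shows "curve_family (q / 2) (p * q / (2 * (q - p))) p q (q / (q - p)) 0"
proof
  fix z assume z: "z \<in> wdom (q / 2) (p * q / (2 * (q - p)))"
  then have pos: "0 < 1 + q / 2 * z" by (auto simp: wdom_def)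
  have k: "0 < q / (q - p)" using assms by simp
  show "0 < q / (q - p) * (1 + q / 2 * z) + 0 * (1 - p * q / (2 * (q - p)) * z)"
    using mult_pos_pos[OF k pos] by simp
  have sum: "q / 2 + p * q / (2 * (q - p)) = q / (q - p) * (q / 2)" using assms by (simp add: field_simps)
  have fall: "q / (q - p) * (1 + q / 2 * z) + 0 * (1 - p * q / (2 * (q - p)) * z) - (q / 2 + p * q / (2 * (q - p))) * z = q / (q - p)"
    unfolding sum by (simp add: distrib_left)
  then show "0 < q / (q - p) * (1 + q / 2 * z) + 0 * (1 - p * q / (2 * (q - p)) * z) - (q / 2 + p * q / (2 * (q - p))) * z"
    using k by simp
  show "2 * ln ((q / (q - p) * (1 + q / 2 * z) + 0 * (1 - p * q / (2 * (q - p)) * z)) /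
      (q / (q - p) * (1 + q / 2 * z) + 0 * (1 - p * q / (2 * (q - p)) * z) - (q / 2 + p * q / (2 * (q - p))) * z))
      = ((q - p) * 0 + q) * slog (q / 2) z + (q - (q - p) * (q / (q - p))) * slog (p * q / (2 * (q - p))) (- z)"
  proof -
    have "q / (q - p) * (1 + q / 2 * z) / (q / (q - p)) = 1 + q / 2 * z" using assms by (intro nonzero_mult_div_cancel_left) simp
    moreover have "2 * ln (1 + q / 2 * z) = q * slog (q / 2) z" using mult_slog[OF pos] by simp
    moreover have "(q - p) * (q / (q - p)) = q" using assms by simp
    ultimately show ?thesis unfolding fall by simp
  qed
next
  have "0 < p * q / (2 * (q - p))" using assms by simp
  then show "0 \<le> p * q / (2 * (q - p))" by (rule less_imp_le)
  show "0 < q / 2 + p * q / (2 * (q - p))"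
    using \<open>0 < p * q / (2 * (q - p))\<close> assms by (intro add_pos_pos) auto
qed (use assms in auto)

text \<open>Mirror image of the positive case under (p, q) -> (-q, -p), which exchanges B and C: now
  u^p / r^q = 1 + p z / 2.\<close>

lemma curve_family_negative:
  assumes "p < q" "q < 0"
  shows "curve_family (p * q / (2 * (q - p))) (- p / 2) p q 1 (q / (p - q))"
proof
  fix z assume z: "z \<in> wdom (p * q / (2 * (q - p))) (- p / 2)"
  then have pos: "0 < 1 + (- p / 2) * (- z)" by (auto simp: wdom_def)
  have k: "0 < p / (p - q)" using assms by (simp add: divide_neg_neg)
  have B: "p * q / (2 * (q - p)) = q / (p - q) * (- p / 2)" using assms by (simp add: field_simps)
  have k1: "1 + q / (p - q) = p / (p - q)" using assms by (simp add: field_simps)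
  have rise: "1 * (1 + p * q / (2 * (q - p)) * z) + q / (p - q) * (1 - - p / 2 * z) = p / (p - q)"
    unfolding B k1[symmetric] by (simp add: algebra_simps)
  then show "0 < 1 * (1 + p * q / (2 * (q - p)) * z) + q / (p - q) * (1 - - p / 2 * z)" using k by simp
  have sum: "p * q / (2 * (q - p)) + - p / 2 = p / (p - q) * (- p / 2)" unfolding B k1[symmetric] by (simp add: algebra_simps)
  have fall: "1 * (1 + p * q / (2 * (q - p)) * z) + q / (p - q) * (1 - - p / 2 * z) - (p * q / (2 * (q - p)) + - p / 2) * z
      = p / (p - q) * (1 + (- p / 2) * (- z))"
    unfolding rise sum by (simp add: distrib_left)
  show "0 < 1 * (1 + p * q / (2 * (q - p)) * z) + q / (p - q) * (1 - - p / 2 * z) - (p * q / (2 * (q - p)) + - p / 2) * z"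
    unfolding fall using k pos by (rule mult_pos_pos)
  show "2 * ln ((1 * (1 + p * q / (2 * (q - p)) * z) + q / (p - q) * (1 - - p / 2 * z)) /
      (1 * (1 + p * q / (2 * (q - p)) * z) + q / (p - q) * (1 - - p / 2 * z) - (p * q / (2 * (q - p)) + - p / 2) * z))
      = ((q - p) * (q / (p - q)) + q) * slog (p * q / (2 * (q - p))) z + (q - (q - p) * 1) * slog (- p / 2) (- z)"
  proof -
    have "p / (p - q) / (p / (p - q) * (1 + (- p / 2) * (- z))) = inverse (1 + (- p / 2) * (- z))"
    proof -
      have "K / (K * y) = inverse y" if "0 < K" for K y :: real using that by (simp add: field_simps)
      from this[OF k] show ?thesis .
    qed
    moreover have "2 * ln (inverse (1 + (- p / 2) * (- z))) = p * slog (- p / 2) (- z)"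
      unfolding ln_inverse using mult_slog[OF pos] by simp
    moreover have "(q - p) * (q / (p - q)) + q = 0" using assms by (simp add: field_simps)
    ultimately show ?thesis unfolding fall unfolding rise by simp
  qed
next
  have "0 < p * q / (2 * (q - p))" using assms by (simp add: mult_neg_neg)
  then show "0 \<le> p * q / (2 * (q - p))" by (rule less_imp_le)
  show "0 < p * q / (2 * (q - p)) + - p / 2"
    using \<open>0 < p * q / (2 * (q - p))\<close> assms by (intro add_pos_pos) auto
qed (use assms in auto)

lemma covers_maxima_opposite:
  assumes "p \<le> 0" "0 \<le> q" "p < q"
  shows "curve_family.covers_maxima (q / 2) (- p / 2) p q 1 0"
proof -
  interpret curve_family "q / 2" "- p / 2" p q 1 0 by (rule curve_family_opposite[OF assms])
  have "\<exists>z\<in>wdom (q / 2) (- p / 2). 0 < z \<and> M powr (q - p) = rise z / fall z" if "1 < M" for M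
  proof -
    define R where "R = M powr (q - p)"
    have R: "1 < R" using that assms by (simp add: R_def gr_one_powr)
    \<comment> \<open>Solving (1 + q z / 2) / (1 + p z / 2) = R for z gives z N = R - 1.\<close>
    define N where "N = q / 2 + (- p / 2) * R"
    have "0 \<le> (- p / 2) * (R - 1)" using assms R by (intro mult_nonneg_nonneg) auto
    then have N: "0 < N" using assms by (simp add: N_def algebra_simps)
    define z where "z = (R - 1) / N"
    have z: "0 < z" "z * N = R - 1" using R N by (auto simp: z_def)
    have "(1 + q / 2 * z) * N = N + q / 2 * (z * N)" by (simp add: algebra_simps)
    also have "\<dots> = R * (q / 2 + (- p / 2))" unfolding z(2) unfolding N_def by (simp add: field_simps)
    finally have 1: "1 + q / 2 * z = R * (q / 2 + (- p / 2)) / N" using N by (simp add: field_simps)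
    have "(1 - (- p / 2) * z) * N = N - (- p / 2) * (z * N)" by (simp add: algebra_simps)
    also have "\<dots> = q / 2 + (- p / 2)" unfolding z(2) unfolding N_def by (simp add: field_simps)
    finally have 2: "1 - (- p / 2) * z = (q / 2 + (- p / 2)) / N" using N by (simp add: field_simps)
    have s: "0 < q / 2 + (- p / 2)" using assms by simp
    have "z \<in> wdom (q / 2) (- p / 2)"
      unfolding wdom_def mem_Collect_eq 1 2 using s N R by (intro conjI divide_pos_pos mult_pos_pos) auto
    moreover have "rise z = 1 + q / 2 * z" unfolding rise_def by simp
    moreover have "fall z = 1 - (- p / 2) * z" unfolding fall_def rise_def by (simp add: algebra_simps)
    ultimately have "z \<in> wdom (q / 2) (- p / 2)" "rise z / fall z = R"
      unfolding 1 2 using s N by auto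
    with z(1) show ?thesis unfolding R_def by (intro bexI[of _ z]) auto
  qed
  then show ?thesis unfolding covers_maxima_def by blast
qed

lemma covers_maxima_positive:
  assumes "0 < p" "p < q"
  shows "curve_family.covers_maxima (q / 2) (p * q / (2 * (q - p))) p q (q / (q - p)) 0"
proof -
  interpret curve_family "q / 2" "p * q / (2 * (q - p))" p q "q / (q - p)" 0
    by (rule curve_family_positive[OF assms])
  have "\<exists>z\<in>wdom (q / 2) (p * q / (2 * (q - p))). 0 < z \<and> M powr (q - p) = rise z / fall z"
    if "1 < M" "M powr (q - p) < q / p" for M
  proof -
    define R where "R = M powr (q - p)"
    have R: "1 < R" "R < q / p" using that assms by (simp_all add: R_def gr_one_powr)
    define z where "z = (R - 1) / (q / 2)"
    have "q / 2 * z = R - 1" using assms by (simp add: z_def)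
    then have "1 + q / 2 * z = R" by linarith
    moreover have "0 < z" unfolding z_def by (rule divide_pos_pos) (use R assms in auto)
    ultimately have z: "0 < z" "1 + q / 2 * z = R" by auto
    have "p * q / (2 * (q - p)) * z = (R - 1) * p / (q - p)" using assms by (simp add: z_def field_simps)
    \<comment> \<open>This is R < q/p, the bound from the first integral; it is exactly what keeps z
      below 1/C.\<close>
    also have "(R - 1) * p < q - p" using R assms by (simp add: field_simps)
    then have "(R - 1) * p / (q - p) < 1" using assms by simp
    finally have "z \<in> wdom (q / 2) (p * q / (2 * (q - p)))"
      using z R by (simp add: wdom_def)
    moreover have "rise z / fall z = R"
    proof -
      have sum: "q / 2 + p * q / (2 * (q - p)) = q / (q - p) * (q / 2)" using assms by (simp add: field_simps)
      have "rise z = q / (q - p) * R" unfolding rise_def z(2) by simp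
      moreover have "fall z = q / (q - p)"
        unfolding fall_def sum rise_def by (simp add: distrib_left)
      moreover have "q / (q - p) \<noteq> 0" using assms by simp
      ultimately show ?thesis by (metis nonzero_mult_div_cancel_left)
    qed
    ultimately show ?thesis using z(1) unfolding R_def by (intro bexI[of _ z]) auto
  qed
  then show ?thesis unfolding covers_maxima_def using immersed_max_less[OF assms] by blast
qed

lemma covers_maxima_negative:
  assumes "p < q" "q < 0"
  shows "curve_family.covers_maxima (p * q / (2 * (q - p))) (- p / 2) p q 1 (q / (p - q))"
proof -
  interpret curve_family "p * q / (2 * (q - p))" "- p / 2" p q 1 "q / (p - q)"
    by (rule curve_family_negative[OF assms])
  have "\<exists>z\<in>wdom (p * q / (2 * (q - p))) (- p / 2). 0 < z \<and> M powr (q - p) = rise z / fall z"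
    if "1 < M" for M
  proof -
    define R where "R = M powr (q - p)"
    have R: "1 < R" using that assms by (simp add: R_def gr_one_powr)
    \<comment> \<open>Here rise / fall is 1 / (1 + p z / 2), and this z makes it R.\<close>
    define z where "z = (1 - 1 / R) / (- p / 2)"
    have z: "0 < z" unfolding z_def by (rule divide_pos_pos) (use R assms in auto)
    have "(- p / 2) * z = 1 - 1 / R" using assms by (simp add: z_def)
    then have pz: "1 - (- p / 2) * z = 1 / R" by linarith
    have dom: "z \<in> wdom (p * q / (2 * (q - p))) (- p / 2)"
      unfolding wdom_def mem_Collect_eq pz
      by (intro conjI add_pos_nonneg mult_nonneg_nonneg B_nonneg) (use z R in auto)
    have k1: "1 + q / (p - q) = p / (p - q)" using assms by (simp add: field_simps)
    have B: "p * q / (2 * (q - p)) = q / (p - q) * (- p / 2)" using assms by (simp add: field_simps)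
    have rise: "rise z = p / (p - q)"
      unfolding rise_def unfolding B k1[symmetric] by (simp add: algebra_simps)
    have sum: "p * q / (2 * (q - p)) + - p / 2 = p / (p - q) * (- p / 2)"
      unfolding B k1[symmetric] by (simp add: algebra_simps)
    have "fall z = p / (p - q) * (1 - (- p / 2) * z)"
      unfolding fall_def rise sum by (simp add: algebra_simps)
    then have "fall z = p / (p - q) * (1 / R)" unfolding pz .
    moreover have "p / (p - q) \<noteq> 0" using assms by simp
    moreover have "K / (K * (1 / R)) = R" if "K \<noteq> 0" for K using that R by simp
    ultimately have "rise z / fall z = R" unfolding rise by metis
    with z dom show ?thesis unfolding R_def by (intro bexI[of _ z]) auto
  qed
  then show ?thesis unfolding covers_maxima_def by blast
qed

lemma sqrt_ratio:
  fixes d k s :: real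
  assumes "0 < k" "d * k\<^sup>2 = s"
  shows "sqrt d * k = sqrt s"
  using assms by (auto simp: real_sqrt_mult)

text \<open>The regions (i) to (iv) express that B and C lie on the same side of 1. The bounds at 2
  and -2 come from q / 2 and - p / 2; the fractional ones are p q / (2 (q - p)) >= 1 or <= 1 solved
  for p or for q.\<close>

lemma oscillating_solutions:
  fixes p q :: real and m n :: nat
  assumes mn: "0 < m" "0 < n" "coprime m n" and pq: "p < q"
    and ex: "(p, q) \<notin> {(1, 2), (- 2, - 1), (- 2, 2)}"
    and between: "min (sqrt (q - p)) (Xi p q) < real m / real n" "real m / real n < max (sqrt (q - p)) (Xi p q)"
  shows "(\<exists>u. good_solution p q m n u) \<and>
       (((p \<le> -2 \<and> q \<ge> 2) \<or> (p \<le> -2 \<and> q \<le> 2 * p / (2 - p)) \<or>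
         (q \<ge> 2 \<and> p \<ge> 2 * q / (2 + q)) \<or>
         (p \<ge> -2 \<and> q \<le> 2 \<and> q \<ge> 2 * p / (2 - p))) \<longrightarrow>
        (\<exists>u. good_solution p q m n u \<and>
           (\<forall>v. good_solution p q m n v \<longrightarrow>
              (\<exists>c \<theta>0. c > 0 \<and> (\<forall>\<theta>. v \<theta> = c * u (\<theta> + \<theta>0))))))"
    (is "?ex \<and> (?region \<longrightarrow> ?unique)")
proof -
  consider "p \<le> 0" "0 \<le> q" | "0 < p" | "q < 0" by linarith
  then show ?thesis
  proof cases
    case 1
    interpret curve_family "q / 2" "- p / 2" p q 1 0 by (rule curve_family_opposite[OF 1 pq])
    have "?ex \<and> ((1 \<le> q / 2 \<and> 1 \<le> - p / 2 \<or> q / 2 \<le> 1 \<and> - p / 2 \<le> 1) \<longrightarrow> ?unique)"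
    proof (rule classification[OF _ _ covers_maxima_opposite[OF 1 pq] mn between])
      show "sqrt (q - p) * (1 + 0) = sqrt (2 * (q / 2 + - p / 2))" by simp
      show "(1 + 0) * Xi p q = 2" using 1 pq by (cases "p = 0") (auto simp: Xi_def)
      show "(q / 2, - p / 2) \<noteq> (1, 1)" using ex by auto
    qed
    moreover have "?region \<Longrightarrow> 1 \<le> q / 2 \<and> 1 \<le> - p / 2 \<or> q / 2 \<le> 1 \<and> - p / 2 \<le> 1"
    proof -
      assume ?region
      \<comment> \<open>Regions (ii) and (iii) are excluded by signs here: 2 p / (2 - p) is negative
        while q is not, and 2 q / (2 + q) is positive while p is not.\<close>
      moreover have "\<not> (p \<le> -2 \<and> q \<le> 2 * p / (2 - p))"
        using 1 divide_neg_pos[of "2 * p" "2 - p"] by auto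
      moreover have "\<not> (q \<ge> 2 \<and> p \<ge> 2 * q / (2 + q))"
      proof
        assume a: "q \<ge> 2 \<and> p \<ge> 2 * q / (2 + q)"
        then have "0 < 2 * q / (2 + q)" by (intro divide_pos_pos) auto
        with a 1 show False by linarith
      qed
      ultimately show ?thesis by auto
    qed
    ultimately show ?thesis by blast
  next
    case 2
    let ?C = "p * q / (2 * (q - p))"
    interpret curve_family "q / 2" ?C p q "q / (q - p)" 0 by (rule curve_family_positive[OF 2 pq])
    have C: "1 \<le> ?C \<longleftrightarrow> 2 * (q - p) \<le> p * q" "?C \<le> 1 \<longleftrightarrow> p * q \<le> 2 * (q - p)"
      using pq by (simp_all add: pos_le_divide_eq pos_divide_le_eq)
    have "?ex \<and> ((1 \<le> q / 2 \<and> 1 \<le> ?C \<or> q / 2 \<le> 1 \<and> ?C \<le> 1) \<longrightarrow> ?unique)"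
    proof (rule classification[OF _ _ covers_maxima_positive[OF 2 pq] mn between])
      show "sqrt (q - p) * (q / (q - p) + 0) = sqrt (2 * (q / 2 + ?C))"
      proof (rule sqrt_ratio)
        show "0 < q / (q - p) + 0" using 2 pq by simp
        have "d * (q / d + 0)\<^sup>2 = 2 * (q / 2 + p * q / (2 * d))" if "d = q - p" "0 < d" for d
        proof -
          have p: "p = q - d" using that(1) by simp
          show ?thesis unfolding p using that(2) by (simp add: field_simps power2_eq_square)
        qed
        from this[of "q - p"] pq show "(q - p) * (q / (q - p) + 0)\<^sup>2 = 2 * (q / 2 + ?C)" by simp
      qed
      show "(q / (q - p) + 0) * Xi p q = 2" using 2 pq by (simp add: Xi_def field_simps)
      show "(q / 2, ?C) \<noteq> (1, 1)"
      proof
        assume "(q / 2, ?C) = (1, 1)"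
        then have "q = 2" "?C = 1" by auto
        then have "p = 1" using C by simp
        with \<open>q = 2\<close> ex show False by simp
      qed
    qed
    moreover have "?region \<Longrightarrow> 1 \<le> q / 2 \<and> 1 \<le> ?C \<or> q / 2 \<le> 1 \<and> ?C \<le> 1"
    proof -
      assume ?region
      then consider "q \<ge> 2" "p \<ge> 2 * q / (2 + q)" | "q \<le> 2" "q \<ge> 2 * p / (2 - p)" using 2 by auto
      then show ?thesis
      proof cases
        case 1
        then have "2 * q \<le> p * (2 + q)" by (simp add: pos_divide_le_eq)
        with 1 show ?thesis unfolding C by (simp add: algebra_simps)
      next
        case b: 2
        then have "2 * p \<le> q * (2 - p)" using pq by (simp add: pos_divide_le_eq)
        with b show ?thesis unfolding C by (simp add: algebra_simps)
      qed
    qed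
    ultimately show ?thesis by blast
  next
    case 3
    let ?B = "p * q / (2 * (q - p))"
    interpret curve_family ?B "- p / 2" p q 1 "q / (p - q)" by (rule curve_family_negative[OF pq 3])
    have B: "1 \<le> ?B \<longleftrightarrow> 2 * (q - p) \<le> p * q" "?B \<le> 1 \<longleftrightarrow> p * q \<le> 2 * (q - p)"
      using pq by (simp_all add: pos_le_divide_eq pos_divide_le_eq)
    have k: "1 + q / (p - q) = p / (p - q)" using pq by (simp add: field_simps)
    have "?ex \<and> ((1 \<le> ?B \<and> 1 \<le> - p / 2 \<or> ?B \<le> 1 \<and> - p / 2 \<le> 1) \<longrightarrow> ?unique)"
    proof (rule classification[OF _ _ covers_maxima_negative[OF pq 3] mn between])
      show "sqrt (q - p) * (1 + q / (p - q)) = sqrt (2 * (?B + - p / 2))"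
        unfolding k
      proof (rule sqrt_ratio)
        show "0 < p / (p - q)" using 3 pq by (simp add: divide_neg_neg)
        have "d * (p / (- d))\<^sup>2 = 2 * (p * q / (2 * d) + - p / 2)" if "d = q - p" "0 < d" for d
        proof -
          have "q = d + p" using that(1) by simp
          then show ?thesis using that(2) by (simp add: field_simps power2_eq_square)
        qed
        from this[of "q - p"] pq show "(q - p) * (p / (p - q))\<^sup>2 = 2 * (?B + - p / 2)" by simp
      qed
      show "(1 + q / (p - q)) * Xi p q = 2" unfolding k using 3 pq by (simp add: Xi_def field_simps)
      show "(?B, - p / 2) \<noteq> (1, 1)"
      proof
        assume "(?B, - p / 2) = (1, 1)"
        then have B1: "?B = 1" and "- p / 2 = 1" unfolding prod.inject by blast+
        then have "p = - 2" by linarith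
        have "2 * (q - p) \<le> p * q" "p * q \<le> 2 * (q - p)"
          unfolding B[symmetric] B1 by auto
        with \<open>p = - 2\<close> have "q = - 1" by simp
        with \<open>p = - 2\<close> ex show False by simp
      qed
    qed
    moreover have "?region \<Longrightarrow> 1 \<le> ?B \<and> 1 \<le> - p / 2 \<or> ?B \<le> 1 \<and> - p / 2 \<le> 1"
    proof -
      assume ?region
      then consider "p \<le> -2" "q \<le> 2 * p / (2 - p)" | "p \<ge> -2" "q \<ge> 2 * p / (2 - p)" using 3 by auto
      then show ?thesis
      proof cases
        case 1
        then have "q * (2 - p) \<le> 2 * p" by (simp add: pos_le_divide_eq)
        with 1 show ?thesis unfolding B by (simp add: algebra_simps)
      next
        case b: 2
        then have "2 * p \<le> q * (2 - p)" using pq 3 by (simp add: pos_divide_le_eq)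
        with b show ?thesis unfolding B by (simp add: algebra_simps)
      qed
    qed
    ultimately show ?thesis by blast
  qed
qed

theorem theorem1p3:
  shows
  "(\<forall>(p::real) q u. p \<ge> q \<longrightarrow> immersed_solution p q u \<longrightarrow> is_constant_fun u)
 \<and> (\<forall>u. immersed_solution 1 2 u \<longrightarrow>
       (\<exists>lam \<theta>0. lam \<ge> 0 \<and> 0 \<le> \<theta>0 \<and> \<theta>0 < 2 * pi \<and>
          (\<forall>\<theta>. u \<theta> = 1 + lam * cos (\<theta> - \<theta>0))))
 \<and> (\<forall>u. immersed_solution (-2) (-1) u \<longrightarrow>
       (\<exists>mu \<theta>0. 0 \<le> mu \<and> mu < 1 \<and> 0 \<le> \<theta>0 \<and> \<theta>0 < 2 * pi \<and>
          (\<forall>\<theta>. u \<theta> = (sqrt (1 - mu\<^sup>2 * (sin (\<theta> - \<theta>0))\<^sup>2) - mu * cos (\<theta> - \<theta>0)) / (1 - mu\<^sup>2))))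
 \<and> (\<forall>u. immersed_solution (-2) 2 u \<longrightarrow>
       (\<exists>lam \<theta>0. lam > 0 \<and> 0 \<le> \<theta>0 \<and> \<theta>0 < 2 * pi \<and>
          (\<forall>\<theta>. u \<theta> = sqrt (lam\<^sup>2 * (cos (\<theta> - \<theta>0))\<^sup>2 + lam powr (-2) * (sin (\<theta> - \<theta>0))\<^sup>2))))
 \<and> (\<forall>(p::real) q (m::nat) (n::nat).
       0 < m \<and> 0 < n \<and> coprime m n \<and> p < q \<and>
       (p, q) \<notin> {(1, 2), (-2, -1), (-2, 2)} \<and>
       min (sqrt (q - p)) (Xi p q) < real m / real n \<and>
       real m / real n < max (sqrt (q - p)) (Xi p q) \<longrightarrow>
       (\<exists>u. good_solution p q m n u) \<and>
       (((p \<le> -2 \<and> q \<ge> 2) \<or> (p \<le> -2 \<and> q \<le> 2 * p / (2 - p)) \<or>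
         (q \<ge> 2 \<and> p \<ge> 2 * q / (2 + q)) \<or>
         (p \<ge> -2 \<and> q \<le> 2 \<and> q \<ge> 2 * p / (2 - p))) \<longrightarrow>
        (\<exists>u. good_solution p q m n u \<and>
           (\<forall>v. good_solution p q m n v \<longrightarrow>
              (\<exists>c \<theta>0. c > 0 \<and> (\<forall>\<theta>. v \<theta> = c * u (\<theta> + \<theta>0)))))))"
proof (intro conjI allI impI immersed_constant_if_ge immersed_circle immersed_focal_ellipse immersed_central_ellipse)
qed (use oscillating_solutions in blast)+

end
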